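(* Let $n\ge2$, $p>0$, and let $\mu$ be a measure on $\mathbb{R}^n$ with a continuous density $g$ that is $p$-concave and $\frac1p$-homogeneous. Let $K$ be an origin-symmetric convex body and $L$ a star body in $\mathbb{R}^n$, and let $\varepsilon\ge0$ be such that $$P_{\mu,K}(\theta)\le\mu_{n-1}(L\cap\theta^\perp)+\varepsilon\qquad\text{for all }\theta\in S^{n-1}.$$ Setting $q=\frac{1}{n+\frac1p}$, we have $$\mu(K)^{1-q}\le\left(\frac{1-\frac1n}{1-q}\right)\mu(L)^{1-q}+\frac{\omega_n}{\mu(B_2^n)^q\,\omega_{n-1}}\,\varepsilon.$$
   Context: A function $f\ge0$ is $p$-concave ($p\neq0$) if $f(\lambda x+(1-\lambda)y)\ge(\lambda f(x)^p+(1-\lambda)f(y)^p)^{1/p}$ for all $\lambda\in[0,1]$ and $x,y$ in the support of $f$; it is $s$-homogeneous if $f(ax)=a^sf(x)$ for all $a>0$, $x\in\mathbb{R}^n$. A star body is a compact set $L$ such that $x\in L$ implies $[0,x)\subseteq\operatorname{int}L$. $\omega_k$ is the volume of the $k$-dimensional Euclidean unit ball, $B_2^n$ the unit ball. Mixed $\mu$-measure: $\mu_1(A,B)=\liminf_{\varepsilon\to0}\frac{\mu(A+\varepsilon B)-\mu(A)}{\varepsilon}$. $\mu$-projection: $P_{\mu,K}(\theta)=\frac n2\int_0^1\mu_1(tK,[-\theta,\theta])\,dt$. For $A\subseteq\theta^\perp$, $\mu_{n-1}(A)=\int_A g\,d\lambda_{n-1}$ with $\lambda_{n-1}$ Lebesgue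 measure on $\theta^\perp$. *)

theory Defs
  imports "HOL-Analysis.Analysis"
begin

definition msum :: "'a::real_vector set \<Rightarrow> 'a set \<Rightarrow> 'a set" where
  "msum A B = {a + b | a b. a \<in> A \<and> b \<in> B}"

definition sdil :: "real \<Rightarrow> 'a::real_vector set \<Rightarrow> 'a set" where
  "sdil t A = (\<lambda>x. t *\<^sub>R x) ` A"

definition mu :: "('a::euclidean_space \<Rightarrow> real) \<Rightarrow> 'a set \<Rightarrow> real" where
  "mu g A = measure (density lborel (\<lambda>x. ennreal (g x))) A"

definition mixed_mu :: "('a::euclidean_space \<Rightarrow> real) \<Rightarrow> 'a set \<Rightarrow> 'a set \<Rightarrow> ennreal" where
  "mixed_mu g A B =
     Liminf (at_right 0) (\<lambda>e. ennreal ((mu g (msum A (sdil e B)) - mu g A) / e))"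

definition mu_proj :: "(real^'n \<Rightarrow> real) \<Rightarrow> (real^'n) set \<Rightarrow> real^'n \<Rightarrow> ennreal" where
  "mu_proj g K \<theta> =
     ennreal (real CARD('n) / 2) *
     set_nn_integral lborel {0..1} (\<lambda>t. mixed_mu g (sdil t K) (closed_segment (-\<theta>) \<theta>))"

text \<open>(n-1)-dimensional Lebesgue measure on the hyperplane orthogonal to theta, realised as the
  image of Lebesgue measure on an (n-1)-dimensional Euclidean space 'm under a linear isometry
  onto that hyperplane; mu_{n-1}(A) is the integral of g over A with respect to it.\<close>
definition hyp_iso :: "'m::euclidean_space itself \<Rightarrow> real^'n \<Rightarrow> ('m \<Rightarrow> real^'n)" where
  "hyp_iso _ \<theta> = (SOME f. linear f \<and> (\<forall>y. norm (f y) = norm y) \<and> range f = {x. x \<bullet> \<theta> = 0})"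

definition mu_hyp :: "'m::euclidean_space itself \<Rightarrow> (real^'n \<Rightarrow> real) \<Rightarrow> real^'n \<Rightarrow> (real^'n) set \<Rightarrow> ennreal" where
  "mu_hyp M g \<theta> A =
     (\<integral>\<^sup>+ y. ennreal (g (hyp_iso M \<theta> y)) * indicator A (hyp_iso M \<theta> y) \<partial>(lborel :: 'm measure))"

definition p_concave :: "real \<Rightarrow> ('a::real_vector \<Rightarrow> real) \<Rightarrow> bool" where
  "p_concave p f \<longleftrightarrow> (\<forall>x. 0 \<le> f x) \<and>
     (\<forall>x y l. 0 < f x \<longrightarrow> 0 < f y \<longrightarrow> 0 \<le> l \<longrightarrow> l \<le> 1 \<longrightarrow>
        f (l *\<^sub>R x + (1 - l) *\<^sub>R y) \<ge> (l * f x powr p + (1 - l) * f y powr p) powr (1 / p))"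

definition homogeneous :: "real \<Rightarrow> ('a::real_vector \<Rightarrow> real) \<Rightarrow> bool" where
  "homogeneous s f \<longleftrightarrow> (\<forall>a x. 0 < a \<longrightarrow> f (a *\<^sub>R x) = a powr s * f x)"

definition convex_body :: "'a::euclidean_space set \<Rightarrow> bool" where
  "convex_body K \<longleftrightarrow> compact K \<and> convex K \<and> interior K \<noteq> {}"

definition origin_symmetric :: "'a::real_vector set \<Rightarrow> bool" where
  "origin_symmetric K \<longleftrightarrow> (\<forall>x\<in>K. - x \<in> K)"

definition star_body :: "'a::euclidean_space set \<Rightarrow> bool" where
  "star_body L \<longleftrightarrow> compact L \<and> (\<forall>x\<in>L. closed_segment 0 x - {x} \<subseteq> interior L)"

end

theory Submission
  imports Defs
begin

text \<open>
  Let \<open>d = n + 1/p = 1/q\<close>, let \<open>\<phi>\<close> be the gauge of \<open>K\<close> and \<open>\<xi>\<close> its almost everywhere gradient. By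
  homogeneity \<open>P(\<theta>) = (n/2d) \<mu>\<^sub>1(K, [-\<theta>, \<theta>])\<close> and \<open>\<mu>(A) = (d + 1) \<integral> g (1 - \<psi>)\<^sub>+\<close> for every convex body \<open>A\<close>
  with gauge \<open>\<psi>\<close>. Comparing \<open>\<phi>\<close> with the gauge of \<open>K + h [-\<theta>, \<theta>]\<close>, Fatou's lemma yields
  \<open>\<mu>\<^sub>1(K, [-\<theta>, \<theta>]) \<ge> (d + 1) \<integral>\<^sub>K g \<phi> |\<xi> \<bullet> \<theta>|\<close>; comparing it with the gauge of \<open>K + \<eta> B\<close>, the
  Brunn--Minkowski inequality for \<open>\<mu>\<close> (Prekopa--Leindler plus homogeneity) yields
  \<open>\<integral>\<^sub>K g \<phi> |\<xi>| \<ge> (d/(d + 1)) \<mu>(K)\<^bsup>1-q\<^esup> \<mu>(B)\<^bsup>q\<^esup>\<close>.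
  Averaging the hypothesis over all directions with the weight \<open>1/|v|\<close> on the unit ball replaces
  \<open>|\<xi> \<bullet> \<theta>|\<close> by a multiple of \<open>|\<xi>|\<close>, and bounds the average of \<open>\<mu>\<^sub>n\<^sub>-\<^sub>1(L \<inter> \<theta>\<^sup>\<bottom>)\<close>, a limit of slab
  measures, by a multiple of \<open>\<integral>\<^sub>L g/|x|\<close>. Among sets of given \<open>\<mu>\<close>-measure the latter integral is
  largest for a centred ball, where it can be computed.
  Only one-sided estimates are needed, so neither surface measures nor the measurability
  of \<open>P\<close> in \<open>\<theta>\<close> enters.
\<close>

section \<open>Dilations, Minkowski sums and Lebesgue measure\<close>

lemma sdil_eq_vimage: "c \<noteq> 0 \<Longrightarrow> sdil c A = (\<lambda>x. (1 / c) *\<^sub>R x) -` A"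
  by (auto simp: sdil_def image_iff intro!: bexI[where x="(1 / c) *\<^sub>R _"])

lemma mem_sdil_iff: "c \<noteq> 0 \<Longrightarrow> x \<in> sdil c A \<longleftrightarrow> (1 / c) *\<^sub>R x \<in> A"
  by (simp add: sdil_eq_vimage)

lemma sdil_one [simp]: "sdil 1 A = A"
  by (simp add: sdil_def)

lemma sdil_sdil: "sdil a (sdil b A) = sdil (a * b) A"
  by (auto simp: sdil_def image_image)

lemma sdil_msum: "sdil c (msum A B) = msum (sdil c A) (sdil c B)"
  unfolding sdil_def msum_def by (force simp: scaleR_add_right image_iff)

lemma sdil_cball: "t > 0 \<Longrightarrow> sdil t (cball (0::'a::real_normed_vector) r) = cball 0 (t * r)"
  by (auto simp: sdil_eq_vimage field_simps)

lemma compact_msum: "compact A \<Longrightarrow> compact B \<Longrightarrow> compact (msum A (B :: 'a::real_normed_vector set))"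
  unfolding msum_def by (rule compact_sums)

lemma compact_sdil: "compact A \<Longrightarrow> compact (sdil c (A :: 'a::real_normed_vector set))"
  unfolding sdil_def by (rule compact_scaling)

lemma bounded_sdil: "bounded A \<Longrightarrow> bounded (sdil c (A :: 'a::real_normed_vector set))"
  unfolding sdil_def by (rule bounded_scaling)

lemma convex_msum: "convex A \<Longrightarrow> convex B \<Longrightarrow> convex (msum A B)"
  using convex_sums[of A B] by (auto simp: msum_def intro: back_subst[of convex])

lemma convex_sdil: "convex A \<Longrightarrow> convex (sdil c A)"
  unfolding sdil_def by (rule convex_scaling)

lemma sets_sdil [measurable]:
  fixes A :: "'a::euclidean_space set"
  assumes "A \<in> sets borel" "c \<noteq> 0"
  shows "sdil c A \<in> sets borel"
  using assms by (simp add: sdil_eq_vimage) (rule measurable_sets_borel[where M=borel], auto)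

lemma cball_measurable [measurable]: "cball c r \<in> sets (borel :: 'a::metric_space measure)"
  by (simp add: borel_closed)

lemma nn_integral_lborel_shift:
  fixes f :: "'a::euclidean_space \<Rightarrow> ennreal"
  assumes [measurable]: "f \<in> borel_measurable borel"
  shows "(\<integral>\<^sup>+x. f (c + x) \<partial>lborel) = (\<integral>\<^sup>+x. f x \<partial>lborel)"
  by (subst (2) lborel_distr_plus[of c, symmetric]) (simp add: nn_integral_distr)

lemma nn_integral_lborel_scaleR:
  fixes f :: "'a::euclidean_space \<Rightarrow> ennreal"
  assumes [measurable]: "f \<in> borel_measurable borel" and "c > 0"
  shows "(\<integral>\<^sup>+x. f x \<partial>lborel) = ennreal (c ^ DIM('a)) * (\<integral>\<^sup>+x. f (c *\<^sub>R x) \<partial>lborel)"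
  by (subst lborel_affine[of c 0])
     (use \<open>c > 0\<close> in \<open>simp_all add: nn_integral_density nn_integral_distr nn_integral_cmult\<close>)

lemma emeasure_lborel_sdil:
  fixes A :: "'a::euclidean_space set"
  assumes [measurable]: "A \<in> sets borel" and "c > 0"
  shows "emeasure lborel (sdil c A) = ennreal (c ^ DIM('a)) * emeasure lborel A"
proof -
  have [measurable]: "sdil c A \<in> sets borel" using \<open>c > 0\<close> by (intro sets_sdil) auto
  have "indicator (sdil c A) (c *\<^sub>R x) = (indicator A x :: ennreal)" for x
    using \<open>c > 0\<close> by (simp add: indicator_def mem_sdil_iff)
  then show ?thesis
    using nn_integral_lborel_scaleR[of "indicator (sdil c A)" c] \<open>c > 0\<close> by simp
qed

lemma emeasure_unit_cball:
  "emeasure lborel (cball (0::'a::euclidean_space) 1) = ennreal (unit_ball_vol (DIM('a)))"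
  using emeasure_cball[of 1 "0::'a"] by simp

section \<open>The Prekopa--Leindler inequality\<close>

lemma compact_inner_approx:
  fixes A :: "'a::euclidean_space set"
  assumes "A \<in> sets borel" "bounded A" "A \<noteq> {}" "e > 0"
  obtains T where "compact T" "T \<subseteq> A" "T \<noteq> {}" "emeasure lborel A \<le> emeasure lborel T + ennreal e"
proof -
  have "A \<in> sets lebesgue" using assms by auto
  then obtain S where S: "closed S" "S \<subseteq> A" "emeasure lebesgue (A - S) < ennreal e"
    using sets_lebesgue_inner_closed[of A e] \<open>e > 0\<close> by metis
  obtain a where a: "a \<in> A" using assms by auto
  have [measurable]: "S \<in> sets borel" using S by (simp add: borel_closed)
  show ?thesis
  proof (rule that[of "insert a S"])
    show "compact (insert a S)"
      using S assms by (meson bounded_subset compact_eq_bounded_closed compact_insert)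
    have "emeasure lborel A = emeasure lborel S + emeasure lborel (A - S)"
      using S assms by (subst plus_emeasure) (auto intro!: arg_cong[where f="emeasure lborel"])
    also have "emeasure lborel (A - S) = emeasure lebesgue (A - S)"
      using assms by auto
    also have "emeasure lborel S + \<dots> \<le> emeasure lborel (insert a S) + ennreal e"
      using S by (intro add_mono emeasure_mono) auto
    finally show "emeasure lborel A \<le> emeasure lborel (insert a S) + ennreal e" .
  qed (use S a in auto)
qed

lemma emeasure_lborel_translation:
  fixes A :: "'a::euclidean_space set"
  assumes [measurable]: "A \<in> sets borel"
  shows "emeasure lborel ((+) c ` A) = emeasure lborel A"
proof -
  have vimage: "(+) c ` A = (+) (- c) -` A" by (force simp: image_iff)
  have [measurable]: "(+) c ` A \<in> sets borel"
    unfolding vimage by (rule measurable_sets_borel[where M=borel]) auto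
  have "indicator ((+) c ` A) (c + x) = (indicator A x :: ennreal)" for x
    by (simp add: vimage indicator_def)
  then show ?thesis using nn_integral_lborel_shift[of "indicator ((+) c ` A)" c] by simp
qed

text \<open>The translates \<open>min B + A\<close> and \<open>max A + B\<close> lie in \<open>A + B\<close> and meet in a single point.\<close>

lemma brunn_minkowski_real_compact:
  fixes A B :: "real set"
  assumes "compact A" "compact B" "A \<noteq> {}" "B \<noteq> {}"
  shows "emeasure lborel A + emeasure lborel B \<le> emeasure lborel (msum A B)"
proof -
  obtain top where top: "top \<in> A" "\<And>a. a \<in> A \<Longrightarrow> a \<le> top"
    using compact_attains_sup[of A] assms by auto
  obtain bot where bot: "bot \<in> B" "\<And>b. b \<in> B \<Longrightarrow> bot \<le> b"
    using compact_attains_inf[of B] assms by auto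
  let ?A = "(+) bot ` A" and ?B = "(+) top ` B"
  have [measurable]: "A \<in> sets borel" "B \<in> sets borel" "?A \<in> sets borel"
    "?B \<in> sets borel" "msum A B \<in> sets borel"
    using assms by (auto intro!: borel_compact compact_translation compact_msum)
  have "?A \<inter> ?B \<subseteq> {bot + top}"
  proof
    fix x assume "x \<in> ?A \<inter> ?B"
    then obtain a b where "x = bot + a" "x = top + b" "a \<in> A" "b \<in> B" by blast
    with top(2)[of a] bot(2)[of b] show "x \<in> {bot + top}" by simp
  qed
  then have "emeasure lborel (?A \<inter> ?B) = 0"
    using emeasure_mono[of "?A \<inter> ?B" "{bot + top}" lborel] by auto
  then have "emeasure lborel A + emeasure lborel B = emeasure lborel (?A \<union> ?B)"
    using emeasure_Un_Int[of ?A lborel ?B] by (simp add: emeasure_lborel_translation)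
  also have "\<dots> \<le> emeasure lborel (msum A B)"
  proof (rule emeasure_mono)
    show "?A \<union> ?B \<subseteq> msum A B"
      using top(1) bot(1) by (auto simp: msum_def add.commute[of bot])
  qed simp
  finally show ?thesis .
qed

lemma brunn_minkowski_real:
  fixes A B C :: "real set"
  assumes A: "A \<in> sets borel" "bounded A" "A \<noteq> {}" and B: "B \<in> sets borel" "bounded B" "B \<noteq> {}"
    and C: "C \<in> sets borel" "msum A B \<subseteq> C"
  shows "emeasure lborel A + emeasure lborel B \<le> emeasure lborel C"
proof (rule ennreal_le_epsilon)
  fix e :: real assume "e > 0"
  obtain S where S: "compact S" "S \<subseteq> A" "S \<noteq> {}" "emeasure lborel A \<le> emeasure lborel S + ennreal (e/2)"
    using compact_inner_approx[OF A, of "e/2"] \<open>e > 0\<close> by auto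
  obtain T where T: "compact T" "T \<subseteq> B" "T \<noteq> {}" "emeasure lborel B \<le> emeasure lborel T + ennreal (e/2)"
    using compact_inner_approx[OF B, of "e/2"] \<open>e > 0\<close> by auto
  have "emeasure lborel A + emeasure lborel B
      \<le> (emeasure lborel S + ennreal (e/2)) + (emeasure lborel T + ennreal (e/2))"
    by (intro add_mono S T)
  also have "\<dots> = (emeasure lborel S + emeasure lborel T) + ennreal e"
    using \<open>e > 0\<close> by (simp add: ac_simps flip: ennreal_plus)
  also have "emeasure lborel S + emeasure lborel T \<le> emeasure lborel (msum S T)"
    using S T by (intro brunn_minkowski_real_compact)
  also have "\<dots> \<le> emeasure lborel C"
  proof (rule emeasure_mono)
    have "msum S T \<subseteq> msum A B" using S(2) T(2) unfolding msum_def by blast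
    with C show "msum S T \<subseteq> C" by blast
  qed (use C in simp)
  finally show "emeasure lborel A + emeasure lborel B \<le> emeasure lborel C + ennreal e"
    by (simp add: add_right_mono)
qed

lemma brunn_minkowski_real_combination:
  fixes A B C :: "real set"
  assumes "A \<in> sets borel" "bounded A" "A \<noteq> {}" and "B \<in> sets borel" "bounded B" "B \<noteq> {}"
    and "C \<in> sets borel" "msum (sdil (1 - l) A) (sdil l B) \<subseteq> C" and l: "0 < l" "l < 1"
  shows "ennreal (1 - l) * emeasure lborel A + ennreal l * emeasure lborel B \<le> emeasure lborel C"
proof -
  have "emeasure lborel (sdil (1 - l) A) + emeasure lborel (sdil l B) \<le> emeasure lborel C"
    using assms by (intro brunn_minkowski_real sets_sdil bounded_sdil) (auto simp: sdil_def)
  then show ?thesis using assms by (simp add: emeasure_lborel_sdil)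
qed

lemma layer_cake_unit_interval:
  fixes u :: "'a \<Rightarrow> ennreal"
  assumes [measurable]: "u \<in> borel_measurable M" and "sigma_finite_measure M"
  shows "(\<integral>\<^sup>+t\<in>{0<..<1}. emeasure M {x\<in>space M. ennreal t < u x} \<partial>lborel) = (\<integral>\<^sup>+x. min 1 (u x) \<partial>M)"
proof -
  let ?I = "\<lambda>t x. if ennreal t < u x \<and> 0 < t \<and> t < 1 then 1 else (0::ennreal)"
  interpret sigma_finite_measure M by fact
  interpret pair_sigma_finite lborel M ..
  have "(\<integral>\<^sup>+t\<in>{0<..<1}. emeasure M {x\<in>space M. ennreal t < u x} \<partial>lborel)
     = (\<integral>\<^sup>+t. \<integral>\<^sup>+x. indicator {x\<in>space M. ennreal t < u x} x * indicator {0<..<1} t \<partial>M \<partial>lborel)"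
    by (intro nn_integral_cong) (simp add: nn_integral_multc)
  also have "\<dots> = (\<integral>\<^sup>+t. \<integral>\<^sup>+x. ?I t x \<partial>M \<partial>lborel)"
    by (intro nn_integral_cong) (auto simp: indicator_def)
  also have "\<dots> = (\<integral>\<^sup>+x. \<integral>\<^sup>+t. ?I t x \<partial>lborel \<partial>M)"
    by (rule Fubini'[symmetric]) measurable
  also have "\<dots> = (\<integral>\<^sup>+x. min 1 (u x) \<partial>M)"
  proof (rule nn_integral_cong)
    fix x
    obtain r where r: "min 1 (u x) = ennreal r" "0 \<le> r" "r \<le> 1"
      by (cases "min 1 (u x)") (auto simp: min_def split: if_splits simp flip: ennreal_1)
    have "?I t x = indicator {0<..<r} t" for t
    proof (cases "0 < t \<and> t < 1")
      case True
      then have "ennreal t < u x \<longleftrightarrow> ennreal t < min 1 (u x)" by (simp add: ennreal_less_one_iff)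
      with True show ?thesis unfolding r(1) by (simp add: ennreal_less_iff indicator_def)
    next
      case False
      with r(3) show ?thesis by (auto simp: indicator_def)
    qed
    then show "(\<integral>\<^sup>+t. ?I t x \<partial>lborel) = min 1 (u x)" using r by simp
  qed
  finally show ?thesis .
qed

lemma layer_cake_le_one:
  fixes u :: "'a::euclidean_space \<Rightarrow> real"
  assumes [measurable]: "u \<in> borel_measurable borel" and u: "\<And>x. 0 \<le> u x" "\<And>x. u x \<le> 1"
  shows "(\<integral>\<^sup>+x. u x \<partial>lborel) = (\<integral>\<^sup>+t\<in>{0<..<1}. emeasure lborel {x. t < u x} \<partial>lborel)"
proof -
  have "(\<integral>\<^sup>+x. u x \<partial>lborel) = (\<integral>\<^sup>+x. min 1 (ennreal (u x)) \<partial>lborel)"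
    using u by (intro nn_integral_cong) (simp add: min_absorb2 ennreal_le_1)
  also have "\<dots> = (\<integral>\<^sup>+t\<in>{0<..<1}. emeasure lborel {x. ennreal t < ennreal (u x)} \<partial>lborel)"
    by (subst layer_cake_unit_interval[symmetric]) (auto intro: sigma_finite_lborel)
  also have "\<dots> = (\<integral>\<^sup>+t\<in>{0<..<1}. emeasure lborel {x. t < u x} \<partial>lborel)"
    by (intro nn_integral_cong) (auto simp: ennreal_less_iff indicator_def)
  finally show ?thesis .
qed

lemma brunn_minkowski_superlevel_sets:
  fixes f g :: "real \<Rightarrow> real" and h :: "real \<Rightarrow> ennreal"
  assumes [measurable]: "f \<in> borel_measurable borel" "g \<in> borel_measurable borel" "h \<in> borel_measurable borel"
    and nonempty: "\<exists>x. t < f x" "\<exists>x. t < g x" and bounded: "bounded {x. t < f x}" "bounded {x. t < g x}"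
    and t: "0 < t" and l: "0 < l" "l < 1"
    and h: "\<And>x y. ennreal (f x powr (1 - l) * g y powr l) \<le> h ((1 - l) * x + l * y)"
  shows "ennreal (1 - l) * emeasure lborel {x. t < f x} + ennreal l * emeasure lborel {x. t < g x}
    \<le> emeasure lborel {x. ennreal t < h x}"
proof -
  have "ennreal t < h ((1 - l) * x + l * y)" if "t < f x" "t < g y" for x y
  proof -
    have "t = t powr (1 - l) * t powr l" using t by (simp flip: powr_add)
    also have "\<dots> < f x powr (1 - l) * g y powr l"
      using that t l by (intro mult_strict_mono powr_less_mono2) auto
    finally have "ennreal t < ennreal (f x powr (1 - l) * g y powr l)" using t by (simp add: ennreal_less_iff)
    then show ?thesis using h[of x y] by (rule less_le_trans)
  qed
  then have "msum (sdil (1 - l) {x. t < f x}) (sdil l {x. t < g x}) \<subseteq> {x. ennreal t < h x}"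
    by (auto simp: msum_def sdil_def)
  then show ?thesis
    using nonempty bounded l by (intro brunn_minkowski_real_combination) auto
qed

lemma prekopa_leindler_real_normalized:
  fixes f g :: "real \<Rightarrow> real" and h :: "real \<Rightarrow> ennreal"
  assumes [measurable]: "f \<in> borel_measurable borel" "g \<in> borel_measurable borel" "h \<in> borel_measurable borel"
    and S: "bounded S"
    and f: "\<And>x. 0 \<le> f x" "\<And>x. f x \<le> indicator S x" "\<And>t. t < 1 \<Longrightarrow> \<exists>x. t < f x"
    and g: "\<And>x. 0 \<le> g x" "\<And>x. g x \<le> indicator S x" "\<And>t. t < 1 \<Longrightarrow> \<exists>x. t < g x"
    and l: "0 < l" "l < 1"
    and h: "\<And>x y. ennreal (f x powr (1 - l) * g y powr l) \<le> h ((1 - l) * x + l * y)"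
  shows "ennreal (1 - l) * (\<integral>\<^sup>+x. f x \<partial>lborel) + ennreal l * (\<integral>\<^sup>+x. g x \<partial>lborel) \<le> (\<integral>\<^sup>+x. h x \<partial>lborel)"
proof -
  have "f x \<le> 1" "g x \<le> 1" for x
    by (rule order_trans[OF f(2)] order_trans[OF g(2)], simp add: indicator_def)+
  note layers = layer_cake_le_one[of f, OF _ f(1) this(1)] layer_cake_le_one[of g, OF _ g(1) this(2)]
  have bounded_superlevel: "bounded {x. t < u x}"
    if "0 < t" "\<And>x. u x \<le> indicator S x" for t and u :: "real \<Rightarrow> real"
  proof -
    have "x \<in> S" if "t < u x" for x
      using order_less_le_trans[OF that \<open>u x \<le> indicator S x\<close>] \<open>0 < t\<close> by (cases "x \<in> S") auto
    then show ?thesis by (intro bounded_subset[OF S]) auto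
  qed
  have measurable_superlevel: "(\<lambda>t. emeasure lborel {x. t < u x}) \<in> borel_measurable lborel"
    if [measurable]: "u \<in> borel_measurable borel" for u :: "real \<Rightarrow> real"
    by (rule lborel.measurable_emeasure) (simp, measurable)
  note [measurable] = measurable_superlevel[of f, simplified] measurable_superlevel[of g, simplified]
  have "ennreal (1 - l) * (\<integral>\<^sup>+x. f x \<partial>lborel) + ennreal l * (\<integral>\<^sup>+x. g x \<partial>lborel)
      = (\<integral>\<^sup>+t\<in>{0<..<1}. (ennreal (1 - l) * emeasure lborel {x. t < f x}
          + ennreal l * emeasure lborel {x. t < g x}) \<partial>lborel)"
    by (simp add: layers distrib_right mult.assoc nn_integral_add nn_integral_cmult)
  also have "\<dots> \<le> (\<integral>\<^sup>+t\<in>{0<..<1}. emeasure lborel {x. ennreal t < h x} \<partial>lborel)"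
  proof (rule nn_integral_mono)
    fix t :: real
    have "ennreal (1 - l) * emeasure lborel {x. t < f x} + ennreal l * emeasure lborel {x. t < g x}
        \<le> emeasure lborel {x. ennreal t < h x}" if "0 < t" "t < 1"
      using that l f g h by (intro brunn_minkowski_superlevel_sets bounded_superlevel) auto
    then show "(ennreal (1 - l) * emeasure lborel {x. t < f x}
          + ennreal l * emeasure lborel {x. t < g x}) * indicator {0<..<1} t
        \<le> emeasure lborel {x. ennreal t < h x} * indicator {0<..<1} t"
      by (simp add: indicator_def)
  qed
  also have "\<dots> = (\<integral>\<^sup>+x. min 1 (h x) \<partial>lborel)"
    using layer_cake_unit_interval[of h lborel] sigma_finite_lborel by simp
  also have "\<dots> \<le> (\<integral>\<^sup>+x. h x \<partial>lborel)" by (intro nn_integral_mono) auto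
  finally show ?thesis .
qed

lemma nn_integral_bounded_support_finite:
  fixes f :: "'a::euclidean_space \<Rightarrow> real"
  assumes "bounded S" "\<And>x. f x \<le> C * indicator S x"
  shows "(\<integral>\<^sup>+x. ennreal (f x) \<partial>lborel) < \<infinity>"
proof -
  obtain r where r: "S \<subseteq> cball 0 r" using assms(1) by (auto simp: bounded_iff subset_iff)
  have "(\<integral>\<^sup>+x. ennreal (f x) \<partial>lborel) \<le> (\<integral>\<^sup>+x. ennreal C * indicator (cball (0::'a) r) x \<partial>lborel)"
  proof (rule nn_integral_mono)
    fix x
    have "ennreal (f x) \<le> ennreal (C * indicator S x)" by (intro ennreal_leI assms)
    also have "\<dots> \<le> ennreal C * indicator (cball 0 r) x" using r by (auto simp: indicator_def)
    finally show "ennreal (f x) \<le> ennreal C * indicator (cball 0 r) x" .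
  qed
  also have "\<dots> < \<infinity>"
    using emeasure_bounded_finite[of "cball (0::'a) r"] by (simp add: nn_integral_cmult ennreal_mult_less_top)
  finally show ?thesis .
qed

lemma normalize_by_supremum:
  fixes u :: "'a \<Rightarrow> real"
  assumes "\<And>x. 0 \<le> u x" "\<And>x. u x \<le> C * indicator S x" "\<exists>x. u x \<noteq> 0"
  obtains U where "0 < U" "\<And>x. u x / U \<le> indicator S x" "\<And>t. t < 1 \<Longrightarrow> \<exists>x. t < u x / U"
proof
  have "u x \<le> \<bar>C\<bar>" for x
    by (rule order_trans[OF assms(2)]) (simp add: indicator_def abs_ge_self)
  then have bdd: "bdd_above (range u)" by (rule bdd_aboveI2)
  then have le_Sup: "u x \<le> Sup (range u)" for x by (intro cSup_upper) auto
  show pos: "0 < Sup (range u)" using assms(1,3) le_Sup by (metis less_eq_real_def less_le_trans)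
  show "u x / Sup (range u) \<le> indicator S x" for x
    using assms(1,2)[of x] le_Sup[of x] pos by (cases "x \<in> S") (auto simp: divide_le_eq_1)
  show "\<exists>x. t < u x / Sup (range u)" if "t < 1" for t
  proof -
    have "t * Sup (range u) < Sup (range u)" using that pos by simp
    then obtain x where "t * Sup (range u) < u x" using less_cSup_iff[OF _ bdd] by auto
    then show ?thesis using pos by (auto simp: less_divide_eq)
  qed
qed

lemma prekopa_leindler_real:
  fixes f g :: "real \<Rightarrow> real" and h :: "real \<Rightarrow> ennreal"
  assumes [measurable]: "f \<in> borel_measurable borel" "g \<in> borel_measurable borel" "h \<in> borel_measurable borel"
    and S: "bounded S"
    and f: "\<And>x. 0 \<le> f x" "\<And>x. f x \<le> C * indicator S x"
    and g: "\<And>x. 0 \<le> g x" "\<And>x. g x \<le> C * indicator S x"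
    and l: "0 < l" "l < 1"
    and h: "\<And>x y. ennreal (f x powr (1 - l) * g y powr l) \<le> h ((1 - l) * x + l * y)"
  shows "ennreal (enn2real (\<integral>\<^sup>+x. f x \<partial>lborel) powr (1 - l) * enn2real (\<integral>\<^sup>+x. g x \<partial>lborel) powr l)
          \<le> (\<integral>\<^sup>+x. h x \<partial>lborel)"
proof (cases "(\<forall>x. f x = 0) \<or> (\<forall>x. g x = 0)")
  case False
  obtain F where F: "0 < F" "\<And>x. f x / F \<le> indicator S x" "\<And>t. t < 1 \<Longrightarrow> \<exists>x. t < f x / F"
    using normalize_by_supremum[of f C S] f False by metis
  obtain G where G: "0 < G" "\<And>x. g x / G \<le> indicator S x" "\<And>t. t < 1 \<Longrightarrow> \<exists>x. t < g x / G"
    using normalize_by_supremum[of g C S] g False by metis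
  define m where "m = F powr (1 - l) * G powr l"
  have "m > 0" unfolding m_def using F G by simp
  define a b where "a = enn2real (\<integral>\<^sup>+x. f x \<partial>lborel)" and "b = enn2real (\<integral>\<^sup>+x. g x \<partial>lborel)"
  have a: "(\<integral>\<^sup>+x. f x \<partial>lborel) = ennreal a" "0 \<le> a" and b: "(\<integral>\<^sup>+x. g x \<partial>lborel) = ennreal b" "0 \<le> b"
    unfolding a_def b_def
    using nn_integral_bounded_support_finite[OF S f(2)] nn_integral_bounded_support_finite[OF S g(2)] by auto
  have "ennreal ((a / F) powr (1 - l) * (b / G) powr l) \<le> ennreal ((1 - l) * (a / F) + l * (b / G))"
    using a b l F(1) G(1) Youngs_inequality_0[of "1 - l" l "a / F" "b / G"]
    by (intro ennreal_leI, cases "a = 0 \<or> b = 0") auto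
  also have "\<dots> = ennreal (1 - l) * ennreal (a / F) + ennreal l * ennreal (b / G)"
    using F(1) G(1) a b l by (simp flip: ennreal_mult')
  also have "ennreal (a / F) = (\<integral>\<^sup>+x. ennreal (f x / F) \<partial>lborel)"
    using a f F(1) by (simp add: nn_integral_divide flip: divide_ennreal)
  also have "ennreal (b / G) = (\<integral>\<^sup>+x. ennreal (g x / G) \<partial>lborel)"
    using b g G(1) by (simp add: nn_integral_divide flip: divide_ennreal)
  also have "ennreal (1 - l) * (\<integral>\<^sup>+x. ennreal (f x / F) \<partial>lborel) + ennreal l * (\<integral>\<^sup>+x. ennreal (g x / G) \<partial>lborel)
      \<le> (\<integral>\<^sup>+x. h x / ennreal m \<partial>lborel)"
  proof (intro prekopa_leindler_real_normalized[OF _ _ _ S])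
    fix x y
    have "ennreal ((f x / F) powr (1 - l) * (g y / G) powr l)
        = ennreal (f x powr (1 - l) * g y powr l) / ennreal m"
      using \<open>m > 0\<close> f g F(1) G(1) by (simp add: divide_ennreal m_def powr_divide)
    then show "ennreal ((f x / F) powr (1 - l) * (g y / G) powr l) \<le> h ((1 - l) * x + l * y) / ennreal m"
      using h[of x y] by (simp add: divide_right_mono_ennreal)
  qed (use l f g F G in auto)
  also have "\<dots> = (\<integral>\<^sup>+x. h x \<partial>lborel) / ennreal m" by (simp add: nn_integral_divide)
  finally have "ennreal ((a / F) powr (1 - l) * (b / G) powr l) * ennreal m
      \<le> (\<integral>\<^sup>+x. h x \<partial>lborel) / ennreal m * ennreal m"
    by (rule mult_right_mono) simp
  also have "\<dots> = (\<integral>\<^sup>+x. h x \<partial>lborel)" using \<open>m > 0\<close> by (simp add: ennreal_divide_times)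
  finally have "ennreal ((a / F) powr (1 - l) * (b / G) powr l) * ennreal m \<le> (\<integral>\<^sup>+x. h x \<partial>lborel)" .
  moreover have "(a / F) powr (1 - l) * (b / G) powr l * m = a powr (1 - l) * b powr l"
    using F(1) G(1) by (simp add: m_def powr_divide)
  ultimately show ?thesis using \<open>m > 0\<close> by (simp add: a_def b_def flip: ennreal_mult'')
qed auto

definition box_bounded :: "'i set \<Rightarrow> real \<Rightarrow> real \<Rightarrow> (('i \<Rightarrow> real) \<Rightarrow> real) \<Rightarrow> bool" where
  "box_bounded I C R f \<longleftrightarrow> f \<in> borel_measurable (Pi\<^sub>M I (\<lambda>_. lborel)) \<and>
     (\<forall>x. 0 \<le> f x \<and> f x \<le> C * (\<Prod>i\<in>I. indicator {-R..R} (x i)))"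

lemma box_bounded_measurable: "box_bounded I C R f \<Longrightarrow> f \<in> borel_measurable (Pi\<^sub>M I (\<lambda>_. lborel))"
  by (simp add: box_bounded_def)

lemma nn_integral_box_bounded_le:
  assumes "finite I" "0 \<le> C" "0 \<le> R" and f: "box_bounded I C R f"
  shows "(\<integral>\<^sup>+x. f x \<partial>Pi\<^sub>M I (\<lambda>_. lborel)) \<le> ennreal (C * (2 * R) ^ card I)"
proof -
  interpret product_sigma_finite "\<lambda>_::'a. lborel :: real measure" ..
  have "ennreal (f x) \<le> ennreal C * (\<Prod>i\<in>I. indicator {-R..R} (x i))" for x
  proof -
    have "ennreal (f x) \<le> ennreal (C * (\<Prod>i\<in>I. indicator {-R..R} (x i)))"
      using f by (intro ennreal_leI) (simp add: box_bounded_def)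
    also have "\<dots> = ennreal C * (\<Prod>i\<in>I. indicator {-R..R} (x i))"
      using \<open>0 \<le> C\<close> by (simp add: ennreal_mult' flip: prod_ennreal ennreal_indicator)
    finally show ?thesis .
  qed
  then have "(\<integral>\<^sup>+x. f x \<partial>Pi\<^sub>M I (\<lambda>_. lborel))
      \<le> (\<integral>\<^sup>+x. ennreal C * (\<Prod>i\<in>I. indicator {-R..R} (x i)) \<partial>Pi\<^sub>M I (\<lambda>_. lborel))"
    by (intro nn_integral_mono)
  also have "\<dots> = ennreal C * ennreal (2 * R) ^ card I"
    using \<open>finite I\<close> product_nn_integral_prod[of I "\<lambda>_. indicator {-R..R}"] \<open>0 \<le> R\<close>
    by (simp add: nn_integral_cmult)
  also have "\<dots> = ennreal (C * (2 * R) ^ card I)"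
    using \<open>0 \<le> C\<close> \<open>0 \<le> R\<close> by (simp add: ennreal_mult' flip: ennreal_power)
  finally show ?thesis .
qed

lemma measurable_fun_upd_curried:
  assumes "u \<in> Pi\<^sub>M (insert i I) (\<lambda>_. lborel :: real measure) \<rightarrow>\<^sub>M N"
  shows "(\<lambda>(t, x). u (x(i := t))) \<in> lborel \<Otimes>\<^sub>M Pi\<^sub>M I (\<lambda>_. lborel) \<rightarrow>\<^sub>M N"
    and "(\<lambda>x. u (x(i := t))) \<in> Pi\<^sub>M I (\<lambda>_. lborel) \<rightarrow>\<^sub>M N"
proof -
  have "(\<lambda>(t, x). x(i := t)) \<in> lborel \<Otimes>\<^sub>M Pi\<^sub>M I (\<lambda>_. lborel)
      \<rightarrow>\<^sub>M Pi\<^sub>M (insert i I) (\<lambda>_. lborel :: real measure)"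
    using measurable_compose[OF measurable_pair_swap' measurable_add_dim[of i I "\<lambda>_. lborel :: real measure"]]
    by (simp add: split_beta')
  from measurable_compose[OF this assms]
  show curried: "(\<lambda>(t, x). u (x(i := t))) \<in> lborel \<Otimes>\<^sub>M Pi\<^sub>M I (\<lambda>_. lborel) \<rightarrow>\<^sub>M N"
    by (simp add: split_beta')
  show "(\<lambda>x. u (x(i := t))) \<in> Pi\<^sub>M I (\<lambda>_. lborel) \<rightarrow>\<^sub>M N"
    using measurable_compose[OF measurable_Pair1'[of t lborel] curried] by simp
qed

lemma box_bounded_slice:
  assumes I: "finite I" "i \<notin> I" and f: "box_bounded (insert i I) C R f"
  shows "box_bounded I (C * indicator {-R..R} t) R (\<lambda>x. f (x(i := t)))"
  unfolding box_bounded_def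
proof (intro conjI allI)
  show "(\<lambda>x. f (x(i := t))) \<in> borel_measurable (Pi\<^sub>M I (\<lambda>_. lborel))"
    using f by (intro measurable_fun_upd_curried box_bounded_measurable)
  fix x
  have "(\<Prod>j\<in>insert i I. indicator {-R..R} ((x(i := t)) j))
      = indicator {-R..R} t * (\<Prod>j\<in>I. indicator {-R..R} (x j) :: real)"
    using I by (auto intro!: prod.cong)
  then show "0 \<le> f (x(i := t))" "f (x(i := t)) \<le> C * indicator {-R..R} t * (\<Prod>j\<in>I. indicator {-R..R} (x j))"
    using f unfolding box_bounded_def by (metis mult.assoc)+
qed

lemma box_bounded_mono:
  assumes "box_bounded I C R f" "C \<le> D"
  shows "box_bounded I D R f"
proof -
  have "C * (\<Prod>i\<in>I. indicator {-R..R} (x i)) \<le> D * (\<Prod>i\<in>I. indicator {-R..R} (x i))" for x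
    using assms(2) by (intro mult_right_mono prod_nonneg) auto
  then show ?thesis using assms(1) unfolding box_bounded_def by (meson order_trans)
qed

definition marginal :: "'i set \<Rightarrow> 'i \<Rightarrow> (('i \<Rightarrow> real) \<Rightarrow> real) \<Rightarrow> real \<Rightarrow> real" where
  "marginal I i f t = enn2real (\<integral>\<^sup>+x. f (x(i := t)) \<partial>Pi\<^sub>M I (\<lambda>_. lborel))"

context
  fixes I :: "'i set" and i :: 'i and C R :: real and f :: "('i \<Rightarrow> real) \<Rightarrow> real"
  assumes I: "finite I" "i \<notin> I" and bounds: "0 \<le> C" "0 \<le> R" and f: "box_bounded (insert i I) C R f"
begin

lemma nn_integral_slice_le:
  "(\<integral>\<^sup>+x. f (x(i := t)) \<partial>Pi\<^sub>M I (\<lambda>_. lborel)) \<le> ennreal (C * (2 * R) ^ card I * indicator {-R..R} t)"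
  using nn_integral_box_bounded_le[OF I(1) _ bounds(2) box_bounded_slice[OF I f, of t]] bounds
  by (simp add: mult_ac)

lemma box_bounded_slice_uniform: "box_bounded I C R (\<lambda>x. f (x(i := t)))"
  using bounds by (intro box_bounded_mono[OF box_bounded_slice[OF I f]]) (simp add: indicator_def)

lemma ennreal_marginal: "ennreal (marginal I i f t) = (\<integral>\<^sup>+x. f (x(i := t)) \<partial>Pi\<^sub>M I (\<lambda>_. lborel))"
  unfolding marginal_def
  using nn_integral_slice_le[of t] by (intro ennreal_enn2real) (auto intro: le_less_trans)

lemma marginal_bounds: "0 \<le> marginal I i f t" "marginal I i f t \<le> C * (2 * R) ^ card I * indicator {-R..R} t"
  using nn_integral_slice_le[of t] bounds unfolding ennreal_marginal[symmetric]
  by (simp_all add: marginal_def[of I i f t] ennreal_le_iff)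

lemma borel_measurable_marginal: "marginal I i f \<in> borel_measurable borel"
proof -
  interpret product_sigma_finite "\<lambda>_::'i. lborel :: real measure" ..
  interpret PI: sigma_finite_measure "Pi\<^sub>M I (\<lambda>_. lborel :: real measure)" by (rule sigma_finite) fact
  have "(\<lambda>t. \<integral>\<^sup>+x. f (x(i := t)) \<partial>Pi\<^sub>M I (\<lambda>_. lborel)) \<in> borel_measurable lborel"
    using box_bounded_measurable[OF f] measurable_fun_upd_curried(1)[of "\<lambda>x. ennreal (f x)" i I borel]
    by (intro PI.borel_measurable_nn_integral) auto
  then show ?thesis unfolding marginal_def[abs_def] by simp
qed

lemma nn_integral_marginal: "(\<integral>\<^sup>+t. marginal I i f t \<partial>lborel) = (\<integral>\<^sup>+x. f x \<partial>Pi\<^sub>M (insert i I) (\<lambda>_. lborel))"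
proof -
  interpret product_sigma_finite "\<lambda>_::'i. lborel :: real measure" ..
  show ?thesis
    using box_bounded_measurable[OF f] I
    by (subst product_nn_integral_insert_rev) (auto simp: ennreal_marginal)
qed

end

lemma restrict_combination_fun_upd:
  "i \<notin> I \<Longrightarrow> (\<lambda>j\<in>insert i I. a * (x(i := s)) j + b * (y(i := t)) j)
      = (\<lambda>j\<in>I. a * x j + b * y j :: real)(i := a * s + b * t)"
  by (rule ext) (auto simp: restrict_apply)

lemma prekopa_leindler_PiM:
  fixes f g :: "('i \<Rightarrow> real) \<Rightarrow> real" and h :: "('i \<Rightarrow> real) \<Rightarrow> ennreal"
  assumes "finite I" and l: "0 < l" "l < 1" and "0 \<le> C" and R: "0 \<le> R"
    and "box_bounded I C R f" "box_bounded I C R g" "h \<in> borel_measurable (Pi\<^sub>M I (\<lambda>_. lborel))"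
    and "\<And>x y. x \<in> extensional I \<Longrightarrow> y \<in> extensional I \<Longrightarrow>
           ennreal (f x powr (1 - l) * g y powr l) \<le> h (\<lambda>i\<in>I. (1 - l) * x i + l * y i)"
  shows "ennreal (enn2real (\<integral>\<^sup>+x. f x \<partial>Pi\<^sub>M I (\<lambda>_. lborel)) powr (1 - l)
            * enn2real (\<integral>\<^sup>+x. g x \<partial>Pi\<^sub>M I (\<lambda>_. lborel)) powr l)
          \<le> (\<integral>\<^sup>+x. h x \<partial>Pi\<^sub>M I (\<lambda>_. lborel))"
  using assms(1,4,6-)
proof (induction I arbitrary: f g h C rule: finite_induct)
  case empty
  then have "ennreal (f (\<lambda>_. undefined) powr (1 - l) * g (\<lambda>_. undefined) powr l) \<le> h (\<lambda>_. undefined)"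
    using empty.prems(5)[of "\<lambda>_. undefined" "\<lambda>_. undefined"] by simp
  then show ?case
    using empty.prems by (simp add: PiM_empty nn_integral_count_space_finite box_bounded_def)
next
  case (insert i I)
  interpret product_sigma_finite "\<lambda>_::'i. lborel :: real measure" ..
  interpret PI: sigma_finite_measure "Pi\<^sub>M I (\<lambda>_. lborel :: real measure)" by (rule sigma_finite) fact
  let ?P = "Pi\<^sub>M I (\<lambda>_. lborel :: real measure)"
  note marginal_facts = marginal_bounds borel_measurable_marginal
    nn_integral_marginal box_bounded_slice_uniform
  note f = marginal_facts[OF insert.hyps insert.prems(1) R insert.prems(2)]
  note g = marginal_facts[OF insert.hyps insert.prems(1) R insert.prems(3)]
  have "ennreal (enn2real (\<integral>\<^sup>+t. marginal I i f t \<partial>lborel) powr (1 - l)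
      * enn2real (\<integral>\<^sup>+t. marginal I i g t \<partial>lborel) powr l)
       \<le> (\<integral>\<^sup>+t. \<integral>\<^sup>+x. h (x(i := t)) \<partial>?P \<partial>lborel)"
  proof (rule prekopa_leindler_real[OF f(3) g(3) _ bounded_closed_interval f(1,2) g(1,2) l])
    show "(\<lambda>t. \<integral>\<^sup>+x. h (x(i := t)) \<partial>?P) \<in> borel_measurable borel"
      using PI.borel_measurable_nn_integral[OF measurable_fun_upd_curried(1)[OF insert.prems(4)]] by (simp only: measurable_lborel2)
    show "ennreal (marginal I i f s powr (1 - l) * marginal I i g t powr l)
        \<le> (\<integral>\<^sup>+x. h (x(i := (1 - l) * s + l * t)) \<partial>?P)" for s t
      unfolding marginal_def
    proof (rule insert.IH[OF insert.prems(1)])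
      show "box_bounded I C R (\<lambda>x. f (x(i := s)))" "box_bounded I C R (\<lambda>x. g (x(i := t)))"
        by (rule f(5) g(5))+
      show "(\<lambda>x. h (x(i := (1 - l) * s + l * t))) \<in> borel_measurable ?P"
        using insert.prems(4) by (rule measurable_fun_upd_curried)
      fix x y :: "'i \<Rightarrow> real" assume xy: "x \<in> extensional I" "y \<in> extensional I"
      have "x(i := s) \<in> extensional (insert i I)" "y(i := t) \<in> extensional (insert i I)"
        using xy by (auto simp: extensional_def)
      then show "ennreal (f (x(i := s)) powr (1 - l) * g (y(i := t)) powr l)
         \<le> h ((\<lambda>j\<in>I. (1 - l) * x j + l * y j)(i := (1 - l) * s + l * t))"
        using insert.prems(5) unfolding restrict_combination_fun_upd[OF insert.hyps(2), symmetric] by blast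
    qed
  qed
  then show ?case
    unfolding f(4) g(4) using insert.hyps insert.prems(4) by (simp add: product_nn_integral_insert_rev)
qed

lemma box_bounded_coordinates:
  fixes u :: "'a::euclidean_space \<Rightarrow> real"
  assumes [measurable]: "u \<in> borel_measurable borel"
    and u: "\<And>x. 0 \<le> u x" "\<And>x. u x \<le> C * indicator S x" and S: "\<And>x. x \<in> S \<Longrightarrow> norm x \<le> R"
  shows "box_bounded Basis \<bar>C\<bar> R (\<lambda>v. u (\<Sum>b\<in>Basis. v b *\<^sub>R b))"
  unfolding box_bounded_def
proof (intro conjI allI)
  fix v :: "'a \<Rightarrow> real"
  let ?x = "\<Sum>b\<in>Basis. v b *\<^sub>R b"
  have "u ?x \<le> \<bar>C\<bar> * indicator S ?x"
    using u(2)[of ?x] by (auto simp: indicator_def split: if_splits)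
  also have "indicator S ?x \<le> (\<Prod>b\<in>Basis. indicator {-R..R} (v b) :: real)"
  proof (cases "?x \<in> S")
    case True
    have "v b \<in> {-R..R}" if "b \<in> Basis" for b
      using Basis_le_norm[OF that, of ?x] S[OF True] that by (auto simp: abs_le_iff)
    then have "(\<Prod>b\<in>Basis. indicator {-R..R} (v b) :: real) = 1"
      by (intro prod.neutral) simp
    then show ?thesis by simp
  qed (simp add: prod_nonneg)
  finally show "u ?x \<le> \<bar>C\<bar> * (\<Prod>b\<in>Basis. indicator {-R..R} (v b))" by (simp add: mult_left_mono)
qed (use u(1) in auto)

lemma prekopa_leindler:
  fixes f g :: "'a::euclidean_space \<Rightarrow> real" and h :: "'a \<Rightarrow> ennreal"
  assumes l: "0 < l" "l < 1" and S: "bounded S"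
    and [measurable]: "f \<in> borel_measurable borel" "g \<in> borel_measurable borel" "h \<in> borel_measurable borel"
    and f: "\<And>x. 0 \<le> f x" "\<And>x. f x \<le> C * indicator S x"
    and g: "\<And>x. 0 \<le> g x" "\<And>x. g x \<le> C * indicator S x"
    and h: "\<And>x y. ennreal (f x powr (1 - l) * g y powr l) \<le> h ((1 - l) *\<^sub>R x + l *\<^sub>R y)"
  shows "ennreal (enn2real (\<integral>\<^sup>+x. f x \<partial>lborel) powr (1 - l) * enn2real (\<integral>\<^sup>+x. g x \<partial>lborel) powr l)
          \<le> (\<integral>\<^sup>+x. h x \<partial>lborel)"
proof -
  let ?T = "\<lambda>v :: 'a \<Rightarrow> real. \<Sum>b\<in>Basis. v b *\<^sub>R b"
  have coordinates: "(\<integral>\<^sup>+x. u x \<partial>lborel) = (\<integral>\<^sup>+v. u (?T v) \<partial>Pi\<^sub>M Basis (\<lambda>_. lborel))"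
    if [measurable]: "u \<in> borel_measurable borel" for u :: "'a \<Rightarrow> ennreal"
    by (subst lborel_eq) (simp add: nn_integral_distr)
  obtain R where R: "0 < R" "\<And>x. x \<in> S \<Longrightarrow> norm x \<le> R" using S by (auto simp: bounded_pos)
  have box: "box_bounded Basis \<bar>C\<bar> R (\<lambda>v. f (?T v))" "box_bounded Basis \<bar>C\<bar> R (\<lambda>v. g (?T v))"
    by (rule box_bounded_coordinates[where S=S], simp, fact+)+
  have "ennreal (enn2real (\<integral>\<^sup>+v. f (?T v) \<partial>Pi\<^sub>M Basis (\<lambda>_. lborel)) powr (1 - l)
        * enn2real (\<integral>\<^sup>+v. g (?T v) \<partial>Pi\<^sub>M Basis (\<lambda>_. lborel)) powr l)
      \<le> (\<integral>\<^sup>+v. h (?T v) \<partial>Pi\<^sub>M Basis (\<lambda>_. lborel))"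
  proof (rule prekopa_leindler_PiM[where C="\<bar>C\<bar>" and R=R])
    fix v w :: "'a \<Rightarrow> real"
    have "?T (\<lambda>i\<in>Basis. (1 - l) * v i + l * w i) = (1 - l) *\<^sub>R ?T v + l *\<^sub>R ?T w"
      by (simp add: scaleR_right.sum sum.distrib[symmetric] scaleR_add_left)
    then show "ennreal (f (?T v) powr (1 - l) * g (?T w) powr l) \<le> h (?T (\<lambda>i\<in>Basis. (1 - l) * v i + l * w i))"
      using h by simp
  qed (use l R(1) box in simp_all)
  then show ?thesis by (subst (1 2 3) coordinates) auto
qed

section \<open>Integrals of homogeneous functions\<close>

lemma nn_integral_FTC_interior:
  fixes f F :: "real \<Rightarrow> real"
  assumes [measurable]: "f \<in> borel_measurable borel" and "a \<le> b" and F: "continuous_on {a..b} F"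
    and nonneg: "\<And>x. a \<le> x \<Longrightarrow> x \<le> b \<Longrightarrow> 0 \<le> f x"
    and deriv: "\<And>x. a < x \<Longrightarrow> x < b \<Longrightarrow> (F has_real_derivative f x) (at x)"
  shows "(\<integral>\<^sup>+x\<in>{a..b}. f x \<partial>lborel) = ennreal (F b - F a)"
proof -
  have "(f has_integral F b - F a) {a..b}"
    using assms
    by (intro fundamental_theorem_of_calculus_interior)
       (auto simp: has_real_derivative_iff_has_vector_derivative)
  then have "((\<lambda>x. if x \<in> {a..b} then f x else 0) has_integral F b - F a) UNIV"
    by (simp only: has_integral_restrict_UNIV)
  then have "(\<integral>\<^sup>+x. ennreal (if x \<in> {a..b} then f x else 0) \<partial>lborel) = ennreal (F b - F a)"
    using nonneg by (intro nn_integral_has_integral_lborel) auto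
  also have "(\<integral>\<^sup>+x. ennreal (if x \<in> {a..b} then f x else 0) \<partial>lborel) = (\<integral>\<^sup>+x\<in>{a..b}. f x \<partial>lborel)"
    by (intro nn_integral_cong) auto
  finally show ?thesis .
qed

lemma nn_integral_deriv_powr:
  assumes "0 < d" "0 \<le> a" "a \<le> 1"
  shows "(\<integral>\<^sup>+t\<in>{a..1}. ennreal (d * t powr (d - 1)) \<partial>lborel) = ennreal (1 - a powr d)"
proof -
  have "(\<integral>\<^sup>+t\<in>{a..1}. ennreal (d * t powr (d - 1)) \<partial>lborel) = ennreal (1 powr d - a powr d)"
  proof (rule nn_integral_FTC_interior)
    show "continuous_on {a..1} (\<lambda>t. t powr d)"
      using assms by (intro continuous_on_powr') (auto intro: continuous_intros)
    show "((\<lambda>t. t powr d) has_real_derivative d * t powr (d - 1)) (at t)" if "a < t" for t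
      using that assms by (intro has_real_derivative_powr) auto
  qed (use assms in auto)
  then show ?thesis by simp
qed

lemma nn_integral_powr_mult_deriv_powr:
  assumes "0 < d" "0 < d + s"
  shows "(\<integral>\<^sup>+t\<in>{0..1}. ennreal (t powr s) * ennreal (d * t powr (d - 1)) \<partial>lborel) = ennreal (d / (d + s))"
proof -
  have "t powr s * (d * t powr (d - 1)) = d / (d + s) * ((d + s) * t powr (d + s - 1))" for t
    using assms by (simp add: mult.left_commute[of "t powr s"] add_diff_eq add.commute[of s] flip: powr_add)
  then have "(\<integral>\<^sup>+t\<in>{0..1}. ennreal (t powr s) * ennreal (d * t powr (d - 1)) \<partial>lborel)
      = (\<integral>\<^sup>+t. ennreal (d / (d + s)) * (ennreal ((d + s) * t powr (d + s - 1)) * indicator {0..1} t) \<partial>lborel)"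
    using assms by (simp add: mult.assoc[symmetric] flip: ennreal_mult' del: times_divide_eq_left)
  also have "\<dots> = ennreal (d / (d + s)) * ennreal (1 - 0 powr (d + s))"
    using assms by (subst nn_integral_cmult) (auto simp: nn_integral_deriv_powr)
  finally show ?thesis using assms by simp
qed

lemma nn_integral_one_minus_powr_mult_deriv_powr:
  assumes "0 < d" "0 < k"
  shows "(\<integral>\<^sup>+t\<in>{0..1}. ennreal (1 - t powr k) * ennreal (d * t powr (d - 1)) \<partial>lborel) = ennreal (k / (d + k))"
proof -
  let ?F = "\<lambda>t. t powr d - d / (d + k) * t powr (d + k)"
  have "(\<integral>\<^sup>+t\<in>{0..1}. ennreal ((1 - t powr k) * (d * t powr (d - 1))) \<partial>lborel) = ennreal (?F 1 - ?F 0)"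
  proof (rule nn_integral_FTC_interior)
    show "continuous_on {0..1} ?F"
      using assms by (intro continuous_intros continuous_on_powr') auto
    show "0 \<le> (1 - t powr k) * (d * t powr (d - 1))" if "0 \<le> t" "t \<le> 1" for t
      using that assms by (simp add: powr_le1)
    show "(?F has_real_derivative (1 - t powr k) * (d * t powr (d - 1))) (at t)" if "0 < t" for t
    proof -
      have "(?F has_real_derivative d * t powr (d - 1) - d / (d + k) * ((d + k) * t powr (d + k - 1))) (at t)"
        using that by (intro DERIV_diff DERIV_cmult has_real_derivative_powr)
      also have "d / (d + k) * ((d + k) * t powr (d + k - 1)) = t powr k * (d * t powr (d - 1))"
        using assms
        by (simp add: mult.left_commute[of "t powr k"] add_diff_eq add.commute[of k] flip: powr_add)
      finally show ?thesis by (simp only: left_diff_distrib mult_1)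
    qed
  qed auto
  also have "?F 1 - ?F 0 = k / (d + k)" using assms by (simp add: field_simps)
  finally show ?thesis using assms by (simp add: ennreal_mult'')
qed

lemma nn_integral_sdil_homogeneous:
  fixes f :: "'a::euclidean_space \<Rightarrow> ennreal" and a :: real
  assumes [measurable]: "f \<in> borel_measurable borel" "A \<in> sets borel" and c: "c > 0"
    and hom: "\<And>x. f (c *\<^sub>R x) = ennreal (c powr a) * f x"
  shows "(\<integral>\<^sup>+x\<in>sdil c A. f x \<partial>lborel) = ennreal (c powr (DIM('a) + a)) * (\<integral>\<^sup>+x\<in>A. f x \<partial>lborel)"
proof -
  have [measurable]: "sdil c A \<in> sets borel" using c by (intro sets_sdil) auto
  have "(\<integral>\<^sup>+x\<in>sdil c A. f x \<partial>lborel)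
      = ennreal (c ^ DIM('a)) * (\<integral>\<^sup>+x. f (c *\<^sub>R x) * indicator (sdil c A) (c *\<^sub>R x) \<partial>lborel)"
    using c by (intro nn_integral_lborel_scaleR) auto
  also have "(\<integral>\<^sup>+x. f (c *\<^sub>R x) * indicator (sdil c A) (c *\<^sub>R x) \<partial>lborel)
      = (\<integral>\<^sup>+x. ennreal (c powr a) * (f x * indicator A x) \<partial>lborel)"
    using c by (intro nn_integral_cong) (simp add: hom indicator_def mem_sdil_iff)
  also have "\<dots> = ennreal (c powr a) * (\<integral>\<^sup>+x\<in>A. f x \<partial>lborel)"
    by (simp add: nn_integral_cmult)
  finally show ?thesis
    using c by (simp add: powr_add powr_realpow ennreal_mult' mult.assoc)
qed

locale homogeneous_function_on_star_set =
  fixes f :: "'a::euclidean_space \<Rightarrow> ennreal" and a d :: real and A :: "'a set" and \<psi> :: "'a \<Rightarrow> real"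
  assumes f_measurable [measurable]: "f \<in> borel_measurable borel"
    and A_measurable [measurable]: "A \<in> sets borel"
    and \<psi>_measurable [measurable]: "\<psi> \<in> borel_measurable borel"
    and homogeneous: "\<And>c x. c > 0 \<Longrightarrow> f (c *\<^sub>R x) = ennreal (c powr a) * f x"
    and d_eq: "d = DIM('a) + a" and d_pos: "0 < d"
    and finite_integral: "(\<integral>\<^sup>+x\<in>A. f x \<partial>lborel) < \<infinity>"
    and sdil_eq_sublevel: "\<And>t. 0 < t \<Longrightarrow> t \<le> 1 \<Longrightarrow> sdil t A = {x. \<psi> x \<le> t}"
    and \<psi>_pos: "\<And>x. x \<noteq> 0 \<Longrightarrow> 0 < \<psi> x"
begin

lemma nn_integral_superlevel:
  assumes "t < 1"
  shows "(\<integral>\<^sup>+x\<in>A. f x * indicator {t<..} (\<psi> x) \<partial>lborel)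
      = (\<integral>\<^sup>+x\<in>A. f x \<partial>lborel) * ennreal (1 - max 0 t powr d)"
proof (cases "0 < t")
  case True
  let ?c = "\<integral>\<^sup>+x\<in>A. f x \<partial>lborel" and ?I = "\<integral>\<^sup>+x\<in>A. f x * indicator {t<..} (\<psi> x) \<partial>lborel"
  have levels: "A = {x. \<psi> x \<le> 1}" "sdil t A = {x. \<psi> x \<le> t}"
    using sdil_eq_sublevel[of 1] sdil_eq_sublevel[of t] True assms by auto
  have [measurable]: "sdil t A \<in> sets borel" using True by (intro sets_sdil) auto
  have c: "?c = ennreal (enn2real ?c)" using finite_integral by simp
  have "?I + (\<integral>\<^sup>+x\<in>sdil t A. f x \<partial>lborel)
      = (\<integral>\<^sup>+x. f x * indicator {t<..} (\<psi> x) * indicator A x + f x * indicator (sdil t A) x \<partial>lborel)"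
    by (rule nn_integral_add[symmetric]) measurable
  also have "\<dots> = ?c"
    using assms unfolding levels(2) by (intro nn_integral_cong) (auto simp: levels(1) indicator_def)
  also have "\<dots> = ?c * ennreal (1 - t powr d) + ?c * ennreal (t powr d)"
    using True assms d_pos by (simp add: powr_le1 flip: distrib_left ennreal_plus)
  finally have "?I + ?c * ennreal (t powr d) = ?c * ennreal (1 - t powr d) + ?c * ennreal (t powr d)"
    using True homogeneous by (simp add: nn_integral_sdil_homogeneous d_eq mult.commute)
  moreover have "?c * ennreal (t powr d) \<noteq> top" using finite_integral by (simp add: ennreal_mult_eq_top_iff)
  ultimately show ?thesis using True by (simp add: max_def ennreal_add_left_cancel add.commute)
next
  case False
  have "AE x in lborel. f x * indicator {t<..} (\<psi> x) * indicator A x = f x * indicator A x"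
    using AE_lborel_singleton[of "0::'a"]
  proof eventually_elim
    case (elim x)
    then have "t < \<psi> x" using \<psi>_pos[of x] False by simp
    then show ?case by simp
  qed
  then have "(\<integral>\<^sup>+x\<in>A. f x * indicator {t<..} (\<psi> x) \<partial>lborel) = (\<integral>\<^sup>+x\<in>A. f x \<partial>lborel)"
    by (rule nn_integral_cong_AE)
  then show ?thesis using False d_pos by (simp add: max_def)
qed

definition radial_law :: "real measure" where
  "radial_law = distr (density lborel (\<lambda>x. f x * indicator A x)) borel \<psi>"

lemma nn_integral_radial_law:
  assumes [measurable]: "w \<in> borel_measurable borel"
  shows "(\<integral>\<^sup>+t. w t \<partial>radial_law) = (\<integral>\<^sup>+x\<in>A. f x * w (\<psi> x) \<partial>lborel)"
  unfolding radial_law_def by (subst nn_integral_distr, simp, simp, subst nn_integral_density)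
    (auto intro!: nn_integral_cong simp: ac_simps)

lemma radial_law_eq:
  "radial_law
      = density lborel (\<lambda>t. (\<integral>\<^sup>+x\<in>A. f x \<partial>lborel) * (ennreal (d * t powr (d - 1)) * indicator {0..1} t))"
    (is "_ = ?N")
proof (rule measure_eqI_lessThan)
  show sets_law: "sets radial_law = sets borel" by (simp add: radial_law_def)
  show "sets ?N = sets borel" by simp
  let ?c = "\<integral>\<^sup>+x\<in>A. f x \<partial>lborel"
  fix t :: real
  have law: "emeasure radial_law {t<..} = (\<integral>\<^sup>+x\<in>A. f x * indicator {t<..} (\<psi> x) \<partial>lborel)"
    by (subst nn_integral_radial_law[symmetric]) (simp_all add: sets_law)
  also have "\<dots> \<le> ?c" by (intro nn_integral_mono) (auto simp: indicator_def)
  finally show "emeasure radial_law {t<..} < \<infinity>" using finite_integral by (rule le_less_trans)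
  have N: "emeasure ?N {t<..} = ?c * (\<integral>\<^sup>+s\<in>{max 0 t..1}. ennreal (d * s powr (d - 1)) \<partial>lborel)"
  proof -
    have "emeasure ?N {t<..}
        = (\<integral>\<^sup>+s. ?c * (ennreal (d * s powr (d - 1)) * indicator {0..1} s) * indicator {t<..} s \<partial>lborel)"
      by (subst emeasure_density) auto
    also have "\<dots> = (\<integral>\<^sup>+s. ?c * (ennreal (d * s powr (d - 1)) * indicator {max 0 t..1} s) \<partial>lborel)"
      using AE_lborel_singleton[of t]
      by (intro nn_integral_cong_AE) (auto elim!: eventually_mono simp: indicator_def)
    finally show ?thesis by (simp add: nn_integral_cmult)
  qed
  show "emeasure radial_law {t<..} = emeasure ?N {t<..}"
  proof (cases "t < 1")
    case True
    then have "(\<integral>\<^sup>+s\<in>{max 0 t..1}. ennreal (d * s powr (d - 1)) \<partial>lborel) = ennreal (1 - max 0 t powr d)"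
      using d_pos by (intro nn_integral_deriv_powr) auto
    then show ?thesis unfolding law N nn_integral_superlevel[OF True] by simp
  next
    case False
    have "(\<integral>\<^sup>+x\<in>A. f x * indicator {t<..} (\<psi> x) \<partial>lborel) = (\<integral>\<^sup>+x. 0 \<partial>(lborel :: 'a measure))"
      using False sdil_eq_sublevel[of 1] by (intro nn_integral_cong) (auto simp: indicator_def)
    moreover have "(\<integral>\<^sup>+s\<in>{max 0 t..1}. ennreal (d * s powr (d - 1)) \<partial>lborel)
        = (\<integral>\<^sup>+s. 0 \<partial>(lborel :: real measure))"
      using AE_lborel_singleton[of "1::real"] False
      by (intro nn_integral_cong_AE) (auto elim!: eventually_mono simp: indicator_def)
    ultimately show ?thesis unfolding law N by simp
  qed
qed

lemma nn_integral_polar: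
  assumes [measurable]: "w \<in> borel_measurable borel"
  shows "(\<integral>\<^sup>+x\<in>A. f x * w (\<psi> x) \<partial>lborel)
    = (\<integral>\<^sup>+x\<in>A. f x \<partial>lborel) * (\<integral>\<^sup>+t\<in>{0..1}. w t * ennreal (d * t powr (d - 1)) \<partial>lborel)"
proof -
  let ?c = "\<integral>\<^sup>+x\<in>A. f x \<partial>lborel"
  have "(\<integral>\<^sup>+x\<in>A. f x * w (\<psi> x) \<partial>lborel) = (\<integral>\<^sup>+t. w t \<partial>radial_law)"
    by (simp add: nn_integral_radial_law)
  also have "\<dots> = (\<integral>\<^sup>+t. ?c * (w t * ennreal (d * t powr (d - 1)) * indicator {0..1} t) \<partial>lborel)"
    unfolding radial_law_eq by (subst nn_integral_density) (auto intro!: nn_integral_cong simp: ac_simps)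
  also have "\<dots> = ?c * (\<integral>\<^sup>+t\<in>{0..1}. w t * ennreal (d * t powr (d - 1)) \<partial>lborel)"
    by (rule nn_integral_cmult) measurable
  finally show ?thesis .
qed

corollary nn_integral_mult_powr:
  assumes "0 < d + s"
  shows "(\<integral>\<^sup>+x\<in>A. f x * ennreal (\<psi> x powr s) \<partial>lborel) = (\<integral>\<^sup>+x\<in>A. f x \<partial>lborel) * ennreal (d / (d + s))"
  using nn_integral_polar[of "\<lambda>t. ennreal (t powr s)"] nn_integral_powr_mult_deriv_powr[OF d_pos assms]
  by simp

corollary nn_integral_mult_one_minus_powr:
  assumes "0 < k"
  shows "(\<integral>\<^sup>+x\<in>A. f x * ennreal (1 - \<psi> x powr k) \<partial>lborel) = (\<integral>\<^sup>+x\<in>A. f x \<partial>lborel) * ennreal (k / (d + k))"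
  using nn_integral_polar[of "\<lambda>t. ennreal (1 - t powr k)"]
    nn_integral_one_minus_powr_mult_deriv_powr[OF d_pos assms]
  by simp

end

section \<open>Brunn--Minkowski for measures with a homogeneous concave density\<close>

lemma bernoulli_powr:
  fixes x s :: real
  assumes "x \<ge> 0" "s \<ge> 1"
  shows "1 + s * x \<le> (1 + x) powr s"
proof -
  have "((1 + x) powr s) powr (1 / s) * 1 powr (1 - 1 / s) \<le> 1 / s * (1 + x) powr s + (1 - 1 / s) * 1"
    using assms by (intro Youngs_inequality_0) auto
  then have "s * (1 + x) \<le> s * (1 / s * (1 + x) powr s + (1 - 1 / s))"
    using assms by (intro mult_left_mono) (auto simp: powr_powr)
  then show ?thesis using assms by (simp add: algebra_simps)
qed

lemma powr_tangent_le:
  fixes a b s :: real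
  assumes "a > 0" "b \<ge> 0" "s \<ge> 1"
  shows "a powr s + s * a powr (s - 1) * b \<le> (a + b) powr s"
proof -
  have "a powr s * (1 + s * (b / a)) \<le> a powr s * (1 + b / a) powr s"
    using assms by (intro mult_left_mono bernoulli_powr) auto
  also have "\<dots> = (a * (1 + b / a)) powr s" using assms by (simp add: powr_mult)
  also have "a * (1 + b / a) = a + b" using assms by (simp add: distrib_left)
  finally show ?thesis using assms by (simp add: powr_diff field_simps)
qed

locale homogeneous_density =
  fixes g :: "'a::euclidean_space \<Rightarrow> real" and p :: real
  assumes p_pos: "p > 0" and g_continuous: "continuous_on UNIV g"
    and g_concave: "p_concave p g" and g_homogeneous: "homogeneous (1 / p) g"
begin

definition hom_deg :: real where "hom_deg = real DIM('a) + 1 / p"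

lemma hom_deg_gt_1: "hom_deg > 1"
proof -
  have "real DIM('a) \<ge> 1" using DIM_positive[where 'a='a] by linarith
  moreover have "1 / p > 0" using p_pos by simp
  ultimately show ?thesis unfolding hom_deg_def by linarith
qed

lemma g_nonneg: "0 \<le> g x"
  using g_concave by (simp add: p_concave_def)

lemma g_measurable [measurable]: "g \<in> borel_measurable borel"
  using g_continuous by (rule borel_measurable_continuous_onI)

lemma g_scaleR: "c > 0 \<Longrightarrow> g (c *\<^sub>R x) = c powr (1 / p) * g x"
  using g_homogeneous by (simp add: homogeneous_def)

lemma g_bounded_on_bounded:
  assumes "bounded A" obtains C where "C \<ge> 0" "\<And>x. x \<in> A \<Longrightarrow> g x \<le> C"
proof -
  have "compact (closure A)" using assms by (simp add: compact_closure)
  then have "bounded (g ` closure A)"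
    by (intro compact_imp_bounded compact_continuous_image continuous_on_subset[OF g_continuous]) auto
  then obtain C where "\<And>x. x \<in> closure A \<Longrightarrow> norm (g x) \<le> C" by (auto simp: bounded_iff)
  then show ?thesis using closure_subset[of A] by (intro that[of "max C 0"]) (force simp: le_max_iff_disj)+
qed

lemma nn_integral_g_finite:
  assumes "bounded A"
  shows "(\<integral>\<^sup>+x\<in>A. g x \<partial>lborel) < \<infinity>"
proof -
  obtain C where "\<And>x. x \<in> A \<Longrightarrow> g x \<le> C" using g_bounded_on_bounded[OF assms] by metis
  then have "(\<integral>\<^sup>+x. g x * indicator A x \<partial>lborel) < \<infinity>"
    using assms by (intro nn_integral_bounded_support_finite[where C=C]) (auto simp: indicator_def)
  then show ?thesis by (simp add: ennreal_mult'' ennreal_indicator)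
qed

lemma mu_conv_nn_integral: "A \<in> sets borel \<Longrightarrow> mu g A = enn2real (\<integral>\<^sup>+x\<in>A. g x \<partial>lborel)"
  unfolding mu_def measure_def by (subst emeasure_density) auto

lemma ennreal_mu:
  assumes "A \<in> sets borel" "bounded A"
  shows "ennreal (mu g A) = (\<integral>\<^sup>+x\<in>A. g x \<partial>lborel)"
  using nn_integral_g_finite assms by (simp add: mu_conv_nn_integral)

lemma mu_nonneg: "0 \<le> mu g A"
  by (simp add: mu_def)

lemma mu_mono:
  assumes "A \<in> sets borel" "B \<in> sets borel" "bounded B" "A \<subseteq> B"
  shows "mu g A \<le> mu g B"
proof -
  have "ennreal (mu g A) \<le> ennreal (mu g B)"
    unfolding ennreal_mu[OF assms(2,3)] ennreal_mu[OF assms(1) bounded_subset[OF assms(3,4)]]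
    using assms by (intro nn_integral_mono) (auto simp: indicator_def)
  then show ?thesis by (simp add: mu_nonneg)
qed

lemma mu_sdil:
  assumes "A \<in> sets borel" "c > 0"
  shows "mu g (sdil c A) = c powr hom_deg * mu g A"
proof -
  have "mu g (sdil c A) = enn2real (\<integral>\<^sup>+x\<in>sdil c A. g x \<partial>lborel)"
    using assms by (intro mu_conv_nn_integral sets_sdil) auto
  also have "\<dots> = enn2real (ennreal (c powr hom_deg) * (\<integral>\<^sup>+x\<in>A. g x \<partial>lborel))"
    unfolding hom_deg_def using assms
    by (subst nn_integral_sdil_homogeneous[where a="1/p"]) (auto simp: g_scaleR ennreal_mult')
  also have "\<dots> = c powr hom_deg * mu g A"
    using assms by (simp add: mu_conv_nn_integral enn2real_mult)
  finally show ?thesis .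
qed

lemma mu_pos_imp_ball_pos:
  assumes "A \<in> sets borel" "bounded A" "mu g A > 0"
  shows "mu g (cball 0 1) > 0"
proof -
  obtain R where R: "R > 0" "A \<subseteq> cball 0 R" using \<open>bounded A\<close> by (auto simp: bounded_pos subset_iff)
  have "0 < mu g (cball 0 R)"
    using assms R by (intro less_le_trans[OF _ mu_mono[of A "cball 0 R"]]) auto
  also have "\<dots> = R powr hom_deg * mu g (cball 0 1)"
    using R mu_sdil[of "cball 0 1" R] by (simp add: sdil_cball)
  finally show ?thesis using R by (simp add: zero_less_mult_iff)
qed

lemma g_log_concave:
  assumes "0 < l" "l < 1"
  shows "g x powr (1 - l) * g y powr l \<le> g ((1 - l) *\<^sub>R x + l *\<^sub>R y)"
proof (cases "g x = 0 \<or> g y = 0")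
  case True then show ?thesis using g_nonneg by auto
next
  case False
  then have pos: "g x > 0" "g y > 0" using g_nonneg by (simp_all add: less_le)
  have "g x powr (1 - l) * g y powr l = ((g x powr p) powr (1 - l) * (g y powr p) powr l) powr (1 / p)"
    using p_pos pos by (simp add: powr_mult powr_powr)
  also have "\<dots> \<le> ((1 - l) * g x powr p + l * g y powr p) powr (1 / p)"
    using p_pos pos assms by (intro powr_mono2 Youngs_inequality_0) auto
  also have "\<dots> \<le> g ((1 - l) *\<^sub>R x + l *\<^sub>R y)"
    using g_concave[unfolded p_concave_def, THEN conjunct2, rule_format, of x y "1 - l"] pos assms by simp
  finally show ?thesis .
qed

lemma mu_log_concave:
  assumes A: "compact A" and B: "compact B" and l: "0 < l" "l < 1"
  shows "mu g A powr (1 - l) * mu g B powr l \<le> mu g (msum (sdil (1 - l) A) (sdil l B))"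
proof -
  let ?C = "msum (sdil (1 - l) A) (sdil l B)"
  have C: "compact ?C" using A B by (intro compact_msum compact_sdil)
  note borel[measurable] = borel_compact[OF A] borel_compact[OF B] borel_compact[OF C]
  have bdd: "bounded (A \<union> B)" using A B by (simp add: compact_imp_bounded)
  obtain k where k: "k \<ge> 0" "\<And>x. x \<in> A \<union> B \<Longrightarrow> g x \<le> k" using g_bounded_on_bounded[OF bdd] by metis
  have "ennreal (enn2real (\<integral>\<^sup>+x. ennreal (g x * indicator A x) \<partial>lborel) powr (1 - l)
        * enn2real (\<integral>\<^sup>+x. ennreal (g x * indicator B x) \<partial>lborel) powr l)
      \<le> (\<integral>\<^sup>+x\<in>?C. g x \<partial>lborel)"
  proof (rule prekopa_leindler[OF l bdd, where C=k])
    fix x y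
    show "ennreal ((g x * indicator A x) powr (1 - l) * (g y * indicator B y) powr l)
      \<le> ennreal (g ((1 - l) *\<^sub>R x + l *\<^sub>R y)) * indicator ?C ((1 - l) *\<^sub>R x + l *\<^sub>R y)"
    proof (cases "x \<in> A \<and> y \<in> B")
      case True
      then have "(1 - l) *\<^sub>R x + l *\<^sub>R y \<in> ?C" by (auto simp: msum_def sdil_def)
      then show ?thesis using True g_log_concave[OF l, of x y] by (simp add: ennreal_leI)
    qed auto
  qed (use k g_nonneg in \<open>auto simp: indicator_def\<close>)
  then have "ennreal (mu g A powr (1 - l) * mu g B powr l) \<le> ennreal (mu g ?C)"
    using borel A B C
    by (simp add: mu_conv_nn_integral[of A] mu_conv_nn_integral[of B] ennreal_mu[of ?C] compact_imp_bounded
      ennreal_mult'' ennreal_indicator)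
  then show ?thesis by (simp add: mu_nonneg)
qed

lemma mu_brunn_minkowski:
  assumes A: "compact A" "mu g A > 0" and B: "compact B" "mu g B > 0"
  shows "(mu g A powr (1 / hom_deg) + mu g B powr (1 / hom_deg)) powr hom_deg \<le> mu g (msum A B)"
proof -
  define a b where "a = mu g A powr (1 / hom_deg)" and "b = mu g B powr (1 / hom_deg)"
  have ab: "a > 0" "b > 0" using A B by (auto simp: a_def b_def)
  have normalized: "mu g (sdil (1 / a) A) = 1" "mu g (sdil (1 / b) B) = 1"
    using A B ab hom_deg_gt_1 by (auto simp: mu_sdil borel_compact powr_divide a_def b_def powr_powr)
  define l where "l = b / (a + b)"
  have l: "0 < l" "l < 1" "1 - l = a / (a + b)" using ab by (auto simp: l_def field_simps)
  have "msum (sdil (1 - l) (sdil (1 / a) A)) (sdil l (sdil (1 / b) B)) = sdil (1 / (a + b)) (msum A B)"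
    using ab unfolding sdil_sdil sdil_msum l(3) by (simp add: l_def)
  then have "1 \<le> mu g (sdil (1 / (a + b)) (msum A B))"
    using mu_log_concave[OF compact_sdil[OF A(1), of "1/a"] compact_sdil[OF B(1), of "1/b"] l(1,2)] normalized
    by simp
  also have "\<dots> = (1 / (a + b)) powr hom_deg * mu g (msum A B)"
    using A B ab by (intro mu_sdil) (auto simp: borel_compact compact_msum)
  finally show ?thesis
    using ab unfolding a_def[symmetric] b_def[symmetric] by (simp add: powr_divide le_divide_eq)
qed

definition mixed_mean :: "'a set \<Rightarrow> 'a set \<Rightarrow> real" where
  "mixed_mean A B = mu g A powr (1 - 1 / hom_deg) * mu g B powr (1 / hom_deg)"

lemma mu_minkowski_first:
  assumes A: "compact A" "mu g A > 0" and B: "compact B" "mu g B > 0" and "\<eta> > 0"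
  shows "\<eta> * hom_deg * mixed_mean A B \<le> mu g (msum A (sdil \<eta> B)) - mu g A"
proof -
  define a b where "a = mu g A powr (1 / hom_deg)" and "b = mu g B powr (1 / hom_deg)"
  have ab: "a > 0" "b > 0" using A B by (auto simp: a_def b_def)
  have sdil_B: "mu g (sdil \<eta> B) = \<eta> powr hom_deg * mu g B"
    using B \<open>\<eta> > 0\<close> by (intro mu_sdil) (auto simp: borel_compact)
  then have "mu g (sdil \<eta> B) powr (1 / hom_deg) = \<eta> * b"
    using \<open>\<eta> > 0\<close> hom_deg_gt_1 B by (simp add: powr_mult powr_powr b_def)
  then have "(a + \<eta> * b) powr hom_deg \<le> mu g (msum A (sdil \<eta> B))"
    using mu_brunn_minkowski[OF A compact_sdil[OF B(1), of \<eta>]] sdil_B B \<open>\<eta> > 0\<close> unfolding a_def by simp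
  moreover have "a powr hom_deg + hom_deg * a powr (hom_deg - 1) * (\<eta> * b) \<le> (a + \<eta> * b) powr hom_deg"
    using ab \<open>\<eta> > 0\<close> hom_deg_gt_1 by (intro powr_tangent_le) auto
  moreover have "a powr hom_deg = mu g A" "a powr (hom_deg - 1) = mu g A powr (1 - 1 / hom_deg)"
    using hom_deg_gt_1 A by (simp_all add: a_def powr_powr diff_divide_distrib)
  ultimately show ?thesis by (simp add: b_def mixed_mean_def algebra_simps)
qed

end

section \<open>Lower limits of integrals\<close>

lemma Liminf_le_Liminf_compose:
  fixes u :: "'a \<Rightarrow> 'b::complete_linorder"
  assumes "filterlim f F G"
  shows "Liminf F u \<le> Liminf G (\<lambda>x. u (f x))"
  unfolding le_Liminf_iff using assms less_LiminfD eventually_compose_filterlim by blast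

lemma le_Liminf_at_within_sequentially:
  fixes u :: "'a::first_countable_topology \<Rightarrow> 'b::complete_linorder"
  assumes "\<And>s. filterlim s (at a within S) sequentially \<Longrightarrow> c \<le> liminf (\<lambda>n. u (s n))"
  shows "c \<le> Liminf (at a within S) u"
  unfolding le_Liminf_iff
proof (intro allI impI sequentially_imp_eventually_within)
  fix y s assume "y < c" and s: "(\<forall>n. s n \<in> S \<and> s n \<noteq> a) \<and> s \<longlonglongrightarrow> a"
  have "filterlim s (at a within S) sequentially" using s by (auto simp: filterlim_at)
  from less_le_trans[OF \<open>y < c\<close> assms[OF this]] show "\<forall>\<^sub>F n in sequentially. y < u (s n)"
    by (rule less_LiminfD)
qed

lemma fatou_at_within:
  fixes u :: "'b::first_countable_topology \<Rightarrow> 'a \<Rightarrow> ennreal"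
  assumes [measurable]: "\<And>h. u h \<in> borel_measurable M"
    and v_le: "AE x in M. v x \<le> Liminf (at a within S) (\<lambda>h. u h x)"
  shows "(\<integral>\<^sup>+x. v x \<partial>M) \<le> Liminf (at a within S) (\<lambda>h. \<integral>\<^sup>+x. u h x \<partial>M)"
proof (rule le_Liminf_at_within_sequentially)
  fix s assume s: "filterlim s (at a within S) sequentially"
  have "(\<integral>\<^sup>+x. v x \<partial>M) \<le> (\<integral>\<^sup>+x. liminf (\<lambda>n. u (s n) x) \<partial>M)"
    using v_le
    by (intro nn_integral_mono_AE)
       (auto elim!: eventually_mono intro: order_trans Liminf_le_Liminf_compose[OF s])
  also have "\<dots> \<le> liminf (\<lambda>n. \<integral>\<^sup>+x. u (s n) x \<partial>M)"
    by (intro nn_integral_liminf) measurable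
  finally show "(\<integral>\<^sup>+x. v x \<partial>M) \<le> liminf (\<lambda>n. \<integral>\<^sup>+x. u (s n) x \<partial>M)" .
qed

lemma Liminf_at_right_0_scale:
  fixes u :: "real \<Rightarrow> 'b::complete_lattice"
  assumes "c > 0"
  shows "Liminf (at_right 0) (\<lambda>h. u (c * h)) = Liminf (at_right 0) u"
proof -
  have "inj (times c)" using assms by (auto intro: injI)
  then have "Liminf (filtermap (times c) (at_right 0)) u = Liminf (at_right 0) (\<lambda>h. u (c * h))"
    by (rule Liminf_filtermap_eq)
  then show ?thesis using filtermap_times_pos_at_right[OF assms, of 0] by simp
qed

lemma Liminf_ennreal_cmult:
  fixes c :: ennreal
  assumes "F \<noteq> bot" "c < top"
  shows "Liminf F (\<lambda>x. c * u x) = c * Liminf F u"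
  using assms by (intro Liminf_compose_continuous_mono ennreal_continuous_on_cmult continuous_on_id)
    (auto simp: mono_def mult_left_mono)

lemma le_Liminf_symmetric_average:
  fixes u :: "real \<Rightarrow> ennreal"
  assumes [measurable]: "u \<in> borel_measurable borel" and lsc: "u 0 \<le> Liminf (at 0) u"
  shows "u 0 \<le> Liminf (at_right 0) (\<lambda>h. ennreal (1 / (2 * h)) * (\<integral>\<^sup>+s\<in>{-h<..<h}. u s \<partial>lborel))"
  unfolding le_Liminf_iff
proof (intro allI impI)
  fix y assume "y < u 0"
  then obtain z where z: "y < z" "z < u 0" using dense by blast
  then have "\<forall>\<^sub>F s in at 0. z < u s" using lsc by (intro less_LiminfD) (rule less_le_trans)
  then obtain \<delta> where \<delta>: "\<delta> > 0" "\<And>s. s \<noteq> 0 \<Longrightarrow> \<bar>s\<bar> < \<delta> \<Longrightarrow> z < u s"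
    by (auto simp: eventually_at dist_real_def)
  have "y < ennreal (1 / (2 * h)) * (\<integral>\<^sup>+s\<in>{-h<..<h}. u s \<partial>lborel)" if h: "0 < h" "h < \<delta>" for h
  proof -
    have "z * ennreal (2 * h) = (\<integral>\<^sup>+s. z * indicator {-h<..<h} s \<partial>lborel)"
      using h by (simp add: nn_integral_cmult)
    also have "\<dots> \<le> (\<integral>\<^sup>+s\<in>{-h<..<h}. u s \<partial>lborel)"
      using AE_lborel_singleton[of "0::real"]
      by (intro nn_integral_mono_AE, eventually_elim)
         (use \<delta>(2) h in \<open>force simp: indicator_def abs_less_iff intro: less_imp_le\<close>)
    finally have "ennreal (1 / (2 * h)) * (z * ennreal (2 * h))
        \<le> ennreal (1 / (2 * h)) * (\<integral>\<^sup>+s\<in>{-h<..<h}. u s \<partial>lborel)"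
      by (rule mult_left_mono) simp
    moreover have "ennreal (1 / (2 * h)) * (z * ennreal (2 * h)) = z"
      using h by (simp add: mult.left_commute[of _ z] flip: ennreal_mult')
    ultimately show ?thesis using z(1) by simp
  qed
  then show "\<forall>\<^sub>F h in at_right 0. y < ennreal (1 / (2 * h)) * (\<integral>\<^sup>+s\<in>{-h<..<h}. u s \<partial>lborel)"
    using \<delta>(1) by (auto simp: eventually_at_right)
qed

section \<open>Hyperplane coordinates\<close>

text \<open>Shifting twice in \<open>\<integral>\<integral> 1\<^sub>A(x) 1\<^sub>E(y) dM(x) dy\<close>, with \<open>E\<close> the unit ball, exchanges the roles of \<open>M\<close>
  and of Lebesgue measure.\<close>

lemma translation_invariant_eq_lborel:
  fixes M :: "'a::euclidean_space measure"
  assumes sets_M [measurable_cong]: "sets M = sets borel" and "sigma_finite_measure M"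
    and invariant: "\<And>c. distr M borel ((+) c) = M"
    and unit_ball: "emeasure M (cball 0 1) = emeasure lborel (cball (0::'a) 1)"
  shows "M = lborel"
proof (rule measure_eqI)
  interpret M: sigma_finite_measure M by fact
  interpret pair_sigma_finite M lborel ..
  let ?E = "cball (0::'a) 1"
  fix A assume "A \<in> sets M"
  then have [measurable]: "A \<in> sets borel" using sets_M by simp
  have shift: "(\<integral>\<^sup>+x. f (c + x) \<partial>M) = (\<integral>\<^sup>+x. f x \<partial>M)" if [measurable]: "f \<in> borel_measurable borel" for f c
    by (subst (2) invariant[of c, symmetric]) (simp add: nn_integral_distr)
  have "emeasure M A * emeasure lborel ?E = (\<integral>\<^sup>+y. \<integral>\<^sup>+x. indicator A (y + x) * indicator ?E y \<partial>M \<partial>lborel)"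
    using shift[of "indicator A"] by (simp add: nn_integral_multc nn_integral_cmult sets_M)
  also have "\<dots> = (\<integral>\<^sup>+x. \<integral>\<^sup>+y. indicator A (y + x) * indicator ?E y \<partial>lborel \<partial>M)"
    by (rule Fubini') measurable
  also have "\<dots> = (\<integral>\<^sup>+x. \<integral>\<^sup>+y. indicator A y * indicator ?E (y - x) \<partial>lborel \<partial>M)"
  proof (rule nn_integral_cong)
    fix x :: 'a
    show "(\<integral>\<^sup>+y. indicator A (y + x) * indicator ?E y \<partial>lborel)
        = (\<integral>\<^sup>+y. indicator A y * indicator ?E (y - x) \<partial>lborel)"
      by (subst nn_integral_lborel_shift[of _ x, symmetric]) (auto simp: add.commute)
  qed
  also have "\<dots> = (\<integral>\<^sup>+y. \<integral>\<^sup>+x. indicator A y * indicator ?E (y - x) \<partial>M \<partial>lborel)"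
    by (rule Fubini'[symmetric]) measurable
  also have "\<dots> = (\<integral>\<^sup>+y. indicator A y * emeasure M ?E \<partial>lborel)"
  proof (rule nn_integral_cong)
    fix y
    have "indicator ?E (y - x) = (indicator ?E (- y + x) :: ennreal)" for x
      by (simp add: indicator_def dist_norm norm_minus_commute)
    then show "(\<integral>\<^sup>+x. indicator A y * indicator ?E (y - x) \<partial>M) = indicator A y * emeasure M ?E"
      using shift[of "indicator ?E" "- y"] by (simp add: nn_integral_cmult sets_M)
  qed
  also have "\<dots> = emeasure lborel A * emeasure M ?E" by (simp add: nn_integral_multc)
  finally have "emeasure lborel ?E * emeasure M A = emeasure lborel ?E * emeasure lborel A"
    by (simp add: unit_ball mult.commute)
  moreover have "0 < unit_ball_vol (real DIM('a))" by simp
  ultimately show "emeasure M A = emeasure lborel A"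
    by (simp add: emeasure_unit_cball ennreal_mult_cancel_left)
qed (simp add: sets_M)

lemma borel_measurable_linear [measurable_dest]:
  fixes T :: "'a::euclidean_space \<Rightarrow> 'b::real_normed_vector"
  shows "linear T \<Longrightarrow> T \<in> borel_measurable borel"
  by (intro borel_measurable_continuous_onI linear_continuous_on) (simp add: linear_conv_bounded_linear)

lemma distr_lborel_linear_isometry:
  fixes T :: "'a::euclidean_space \<Rightarrow> 'b::euclidean_space"
  assumes lin: "linear T" and iso: "\<And>x. norm (T x) = norm x" and surj: "surj T" and dim: "DIM('a) = DIM('b)"
  shows "distr lborel borel T = lborel"
proof (rule translation_invariant_eq_lborel)
  note [measurable] = borel_measurable_linear[OF lin]
  have cball: "emeasure (distr lborel borel T) (cball 0 r) = emeasure lborel (cball (0::'a) r)" for r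
    by (subst emeasure_distr) (auto simp: iso intro!: arg_cong[where f="emeasure lborel"])
  then show "emeasure (distr lborel borel T) (cball 0 1) = emeasure lborel (cball (0::'b) 1)"
    using dim by (simp add: emeasure_unit_cball)
  have "(\<Union>n. cball (0::'b) (real n)) = UNIV" using real_arch_simple by auto
  then show "sigma_finite_measure (distr lborel borel T)"
    using cball emeasure_bounded_finite[OF bounded_cball]
    by unfold_locales (auto intro!: exI[of _ "range (\<lambda>n. cball 0 (real n))"] simp: less_top)
  fix c :: 'b
  obtain z where z: "c = T z" using surj by (metis surjD)
  have "distr (distr lborel borel T) borel ((+) c) = distr (distr lborel borel ((+) z)) borel T"
    by (simp add: distr_distr comp_def z linear_add[OF lin])
  then show "distr (distr lborel borel T) borel ((+) c) = distr lborel borel T"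
    by (simp add: lborel_distr_plus)
qed simp

locale hyperplane_frame =
  fixes u :: "'a::euclidean_space" and f :: "'m::euclidean_space \<Rightarrow> 'a"
  assumes unit: "norm u = 1" and lin: "linear f" and iso: "\<And>y. norm (f y) = norm y"
    and range_f: "range f = {x. x \<bullet> u = 0}" and dim: "DIM('m) + 1 = DIM('a)"
begin

lemma f_measurable [measurable]: "f \<in> borel_measurable borel"
  using lin by (rule borel_measurable_linear)

lemma inner_unit: "u \<bullet> u = 1"
  using unit by (simp add: norm_eq_1)

lemma f_orthogonal: "f y \<bullet> u = 0" "u \<bullet> f y = 0"
  using range_f by (auto simp: inner_commute)

lemma inner_split: "(s *\<^sub>R u + f y) \<bullet> u = s"
  by (simp add: inner_simps inner_unit f_orthogonal)

lemma norm_split: "(norm (s *\<^sub>R u + f y))\<^sup>2 = s\<^sup>2 + (norm y)\<^sup>2"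
proof -
  have "f y \<bullet> f y = (norm y)\<^sup>2" by (simp add: iso flip: power2_norm_eq_inner)
  then show ?thesis
    by (simp add: power2_norm_eq_inner[of "s *\<^sub>R u + f y"] inner_simps inner_unit f_orthogonal
      power2_eq_square[of s])
qed

lemma mem_unit_ball_split: "s *\<^sub>R u + f y \<in> cball 0 1 \<longleftrightarrow> s\<^sup>2 \<le> 1 - (norm y)\<^sup>2"
  using norm_split[of s y] abs_le_square_iff[of "norm (s *\<^sub>R u + f y)" 1] by auto

lemma distr_split: "distr lborel borel (\<lambda>(s, y). s *\<^sub>R u + f y) = lborel"
proof (rule distr_lborel_linear_isometry)
  show "linear (\<lambda>(s, y). s *\<^sub>R u + f y)"
    by (rule linearI) (auto simp: linear_add[OF lin] linear_scale[OF lin] algebra_simps)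
  show "norm (case z of (s, y) \<Rightarrow> s *\<^sub>R u + f y) = norm z" for z
    by (cases z) (simp add: norm_Pair flip: norm_split)
  show "surj (\<lambda>(s, y). s *\<^sub>R u + f y)"
    unfolding surj_def
  proof
    fix x
    have "x - (x \<bullet> u) *\<^sub>R u \<in> range f" unfolding range_f by (simp add: inner_simps inner_unit)
    then obtain y where "x - (x \<bullet> u) *\<^sub>R u = f y" by auto
    then show "\<exists>z. x = (case z of (s, y) \<Rightarrow> s *\<^sub>R u + f y)"
      by (intro exI[of _ "(x \<bullet> u, y)"]) (simp add: algebra_simps)
  qed
  show "DIM(real \<times> 'm) = DIM('a)" using dim by simp
qed

lemma nn_integral_split:
  assumes [measurable]: "F \<in> borel_measurable borel"
  shows "(\<integral>\<^sup>+x. F x \<partial>lborel) = (\<integral>\<^sup>+s. \<integral>\<^sup>+y. F (s *\<^sub>R u + f y) \<partial>lborel \<partial>lborel)"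
proof -
  have "(\<lambda>(s, y). s *\<^sub>R u + f y) \<in> borel_measurable (borel \<Otimes>\<^sub>M borel)" by measurable
  then have [measurable]: "(\<lambda>(s, y). s *\<^sub>R u + f y) \<in> borel_measurable borel" by (simp add: borel_prod)
  have "(\<integral>\<^sup>+x. F x \<partial>lborel) = (\<integral>\<^sup>+z. F (case z of (s, y) \<Rightarrow> s *\<^sub>R u + f y) \<partial>(lborel \<Otimes>\<^sub>M lborel))"
    by (subst distr_split[symmetric], subst nn_integral_distr) (auto simp: lborel_prod)
  also have "\<dots> = (\<integral>\<^sup>+s. \<integral>\<^sup>+y. F (s *\<^sub>R u + f y) \<partial>lborel \<partial>lborel)"
    by (subst lborel.nn_integral_fst[symmetric]) auto
  finally show ?thesis .
qed

lemma emeasure_unit_ball_slab_le_unit: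
  assumes "s > 0"
  shows "emeasure lborel ({x. \<bar>x \<bullet> u\<bar> < s} \<inter> cball 0 1) \<le> ennreal (2 * s * unit_ball_vol (DIM('m)))"
proof -
  let ?S = "{x. \<bar>x \<bullet> u\<bar> < s} \<inter> cball 0 1"
  have "emeasure lborel ?S = (\<integral>\<^sup>+x. indicator ?S x \<partial>lborel)" by simp
  also have "\<dots> = (\<integral>\<^sup>+t. \<integral>\<^sup>+y. indicator ?S (t *\<^sub>R u + f y) \<partial>lborel \<partial>lborel)"
    by (rule nn_integral_split) simp
  also have "\<dots> \<le> (\<integral>\<^sup>+t. \<integral>\<^sup>+y. indicator {-s<..<s} t * indicator (cball 0 1) (y::'m) \<partial>lborel \<partial>lborel)"
  proof (intro nn_integral_mono)
    fix t and y :: 'm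
    have "norm y \<le> 1" if "t\<^sup>2 \<le> 1 - (norm y)\<^sup>2"
    proof (rule power2_le_imp_le)
      have "(norm y)\<^sup>2 \<le> 1" using that zero_le_power2[of t] by linarith
      then show "(norm y)\<^sup>2 \<le> 1\<^sup>2" by simp
    qed simp
    then show "indicator ?S (t *\<^sub>R u + f y) \<le> (indicator {-s<..<s} t * indicator (cball 0 1) y :: ennreal)"
      using mem_unit_ball_split[of t y]
      by (auto simp: indicator_def inner_split abs_less_iff simp del: mem_cball)
  qed
  also have "\<dots> = (\<integral>\<^sup>+t. indicator {-s<..<s} t * ennreal (unit_ball_vol (DIM('m))) \<partial>lborel)"
    by (simp add: nn_integral_cmult emeasure_unit_cball)
  also have "\<dots> = ennreal (2 * s * unit_ball_vol (DIM('m)))"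
    using assms by (simp add: nn_integral_multc flip: ennreal_mult')
  finally show ?thesis .
qed

end

lemma homogeneous_function_on_unit_ball:
  fixes f :: "'a::euclidean_space \<Rightarrow> ennreal" and a d :: real
  assumes "f \<in> borel_measurable borel" "\<And>c x. c > 0 \<Longrightarrow> f (c *\<^sub>R x) = ennreal (c powr a) * f x"
    and "d = DIM('a) + a" "0 < d" "(\<integral>\<^sup>+x\<in>cball 0 1. f x \<partial>lborel) < \<infinity>"
  shows "homogeneous_function_on_star_set f a d (cball 0 1) norm"
  using assms by unfold_locales (auto simp: sdil_cball)

lemma nn_integral_abs_ball:
  fixes a :: real
  assumes "a > 0"
  shows "(\<integral>\<^sup>+t\<in>cball 0 a. ennreal \<bar>t\<bar> \<partial>lborel) = ennreal (a\<^sup>2)"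
proof -
  interpret homogeneous_function_on_star_set "\<lambda>_::real. 1" 0 1 "cball 0 1" norm
    by (rule homogeneous_function_on_unit_ball) (auto simp: cball_eq_atLeastAtMost)
  have "(\<integral>\<^sup>+t\<in>cball 0 1. ennreal \<bar>t\<bar> \<partial>(lborel :: real measure)) = 1"
    using nn_integral_mult_powr[of 1]
    by (simp add: cball_eq_atLeastAtMost flip: ennreal_mult' divide_ennreal_def)
  moreover have "(\<integral>\<^sup>+t\<in>sdil a (cball 0 1). ennreal \<bar>t\<bar> \<partial>lborel)
      = ennreal (a powr (real DIM(real) + 1)) * (\<integral>\<^sup>+t\<in>cball 0 1. ennreal \<bar>t\<bar> \<partial>lborel)"
    using assms by (intro nn_integral_sdil_homogeneous) (auto simp: abs_mult ennreal_mult')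
  ultimately show ?thesis using assms by (simp add: sdil_cball powr_numeral)
qed

lemma nn_integral_unit_ball_one_minus_norm_square:
  "(\<integral>\<^sup>+y\<in>cball 0 1. ennreal (1 - (norm y)\<^sup>2) \<partial>(lborel :: 'm::euclidean_space measure))
     = ennreal (2 / (DIM('m) + 2) * unit_ball_vol (DIM('m)))"
proof -
  interpret homogeneous_function_on_star_set "\<lambda>_::'m. 1" 0 "DIM('m)" "cball 0 1" norm
    by (rule homogeneous_function_on_unit_ball) (auto simp: emeasure_unit_cball)
  show ?thesis
    using nn_integral_mult_one_minus_powr[of 2]
    by (simp add: emeasure_unit_cball powr_numeral mult.commute flip: ennreal_mult')
qed

lemma (in hyperplane_frame) nn_integral_unit_ball_abs_inner_unit:
  "(\<integral>\<^sup>+x\<in>cball 0 1. ennreal \<bar>x \<bullet> u\<bar> \<partial>lborel) = ennreal (2 / (DIM('m) + 2) * unit_ball_vol (DIM('m)))"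
proof -
  have "(\<integral>\<^sup>+x\<in>cball 0 1. ennreal \<bar>x \<bullet> u\<bar> \<partial>lborel)
      = (\<integral>\<^sup>+s. \<integral>\<^sup>+y. ennreal \<bar>s\<bar> * indicator (cball 0 1) (s *\<^sub>R u + f y) \<partial>lborel \<partial>lborel)"
    by (subst nn_integral_split) (simp_all add: inner_split)
  also have "\<dots> = (\<integral>\<^sup>+y. \<integral>\<^sup>+s. ennreal \<bar>s\<bar> * indicator (cball 0 1) (s *\<^sub>R u + f y) \<partial>lborel \<partial>lborel)"
    by (rule lborel_pair.Fubini') measurable
  also have "\<dots> = (\<integral>\<^sup>+y\<in>cball 0 1. ennreal (1 - (norm y)\<^sup>2) \<partial>(lborel :: 'm measure))"
  proof (rule nn_integral_cong)
    fix y :: 'm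
    define b where "b = 1 - (norm y)\<^sup>2"
    have ball: "indicator (cball 0 1) (s *\<^sub>R u + f y) = (indicator {s. s\<^sup>2 \<le> b} s :: ennreal)" for s
      unfolding b_def indicator_def mem_unit_ball_split by simp
    have b: "ennreal b * indicator (cball 0 1) y = ennreal b"
      using power2_le_imp_le[of "norm y" 1] by (auto simp: b_def indicator_def ennreal_neg)
    have "(\<integral>\<^sup>+s\<in>{s. s\<^sup>2 \<le> b}. ennreal \<bar>s\<bar> \<partial>lborel) = ennreal b"
    proof (cases "0 < b")
      case True
      then have "s\<^sup>2 \<le> b \<longleftrightarrow> \<bar>s\<bar> \<le> sqrt b" for s
        using abs_le_square_iff[of s "sqrt b"] by simp
      then have "{s. s\<^sup>2 \<le> b} = cball 0 (sqrt b)"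
        by (simp only: set_eq_iff mem_Collect_eq mem_cball dist_0_norm real_norm_def simp_thms)
      then show ?thesis using nn_integral_abs_ball[of "sqrt b"] True by simp
    next
      case False
      then have "s = 0" if "s\<^sup>2 \<le> b" for s using order_trans[OF that, of 0] by simp
      then have "(\<integral>\<^sup>+s\<in>{s. s\<^sup>2 \<le> b}. ennreal \<bar>s\<bar> \<partial>lborel) = (\<integral>\<^sup>+s. 0 \<partial>(lborel :: real measure))"
        by (intro nn_integral_cong) (auto simp: indicator_def)
      with False show ?thesis by (simp add: ennreal_neg)
    qed
    then show "(\<integral>\<^sup>+s. ennreal \<bar>s\<bar> * indicator (cball 0 1) (s *\<^sub>R u + f y) \<partial>lborel)
      = ennreal (1 - (norm y)\<^sup>2) * indicator (cball 0 1) y"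
      unfolding ball b_def[symmetric] b .
  qed
  also have "\<dots> = ennreal (2 / (DIM('m) + 2) * unit_ball_vol (DIM('m)))"
    by (rule nn_integral_unit_ball_one_minus_norm_square)
  finally show ?thesis .
qed

lemma hyperplane_frame_exists:
  fixes u :: "'a::euclidean_space"
  assumes "norm u = 1" and dim: "DIM('m::euclidean_space) + 1 = DIM('a)"
  obtains f :: "'m::euclidean_space \<Rightarrow> 'a" where "hyperplane_frame u f"
proof -
  have "u \<noteq> 0" using assms by auto
  have "dim (UNIV :: 'm set) = dim {x. u \<bullet> x = 0}"
    using dim dim_hyperplane[OF \<open>u \<noteq> 0\<close>] by simp
  then obtain f :: "'m \<Rightarrow> 'a" where "linear f" "f ` UNIV = {x. u \<bullet> x = 0}" "\<And>x. x \<in> UNIV \<Longrightarrow> norm (f x) = norm x"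
    using isometry_subspaces[OF subspace_UNIV subspace_hyperplane] by metis
  then have "hyperplane_frame u f"
    using assms by (intro hyperplane_frame.intro) (auto simp: inner_commute)
  then show ?thesis by (rule that)
qed

lemma hyperplane_frame_hyp_iso:
  fixes \<theta> :: "real^'n" and M :: "'m::euclidean_space itself"
  assumes "norm \<theta> = 1" "DIM('m) + 1 = CARD('n)"
  shows "hyperplane_frame \<theta> (hyp_iso M \<theta>)"
proof -
  obtain f :: "'m \<Rightarrow> real^'n" where "hyperplane_frame \<theta> f"
    using hyperplane_frame_exists[of \<theta>, where 'm='m] assms by auto
  then have "\<exists>f :: 'm \<Rightarrow> real^'n. linear f \<and> (\<forall>y. norm (f y) = norm y) \<and> range f = {x. x \<bullet> \<theta> = 0}"
    unfolding hyperplane_frame_def by blast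
  then have "linear (hyp_iso M \<theta>) \<and> (\<forall>y. norm (hyp_iso M \<theta> y) = norm y)
      \<and> range (hyp_iso M \<theta>) = {x. x \<bullet> \<theta> = 0}"
    unfolding hyp_iso_def by (rule someI_ex)
  then show ?thesis using assms unfolding hyperplane_frame_def by simp
qed

context
  fixes w :: "'a::euclidean_space" and M :: "'m::euclidean_space itself"
  assumes dim: "DIM('m) + 1 = DIM('a)"
begin

lemma emeasure_unit_ball_slab_le:
  assumes "w \<noteq> 0" "s > 0"
  shows "emeasure lborel ({v. \<bar>w \<bullet> v\<bar> < s} \<inter> cball 0 1) \<le> ennreal (2 * s * unit_ball_vol (DIM('m)) / norm w)"
proof -
  define u where "u = (1 / norm w) *\<^sub>R w"
  have u: "norm u = 1" "w = norm w *\<^sub>R u" using \<open>w \<noteq> 0\<close> by (auto simp: u_def)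
  obtain f :: "'m \<Rightarrow> 'a" where "hyperplane_frame u f" by (rule hyperplane_frame_exists[OF u(1) dim])
  then interpret hyperplane_frame u f .
  have "\<bar>w \<bullet> v\<bar> < s \<longleftrightarrow> \<bar>v \<bullet> u\<bar> < s / norm w" for v
    using \<open>w \<noteq> 0\<close> by (subst u(2)) (simp add: abs_mult inner_commute less_divide_eq mult.commute)
  then show ?thesis
    using emeasure_unit_ball_slab_le_unit[of "s / norm w"] assms by simp
qed

lemma nn_integral_unit_ball_abs_inner:
  "(\<integral>\<^sup>+v\<in>cball 0 1. ennreal \<bar>w \<bullet> v\<bar> \<partial>lborel) = ennreal (2 / (DIM('m) + 2) * unit_ball_vol (DIM('m)) * norm w)"
proof (cases "w = 0")
  case False
  define u where "u = (1 / norm w) *\<^sub>R w"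
  have u: "norm u = 1" "w = norm w *\<^sub>R u" using False by (auto simp: u_def)
  obtain f :: "'m \<Rightarrow> 'a" where "hyperplane_frame u f" by (rule hyperplane_frame_exists[OF u(1) dim])
  then interpret hyperplane_frame u f .
  have "ennreal \<bar>w \<bullet> v\<bar> = ennreal (norm w) * ennreal \<bar>v \<bullet> u\<bar>" for v
    by (subst u(2)) (simp add: abs_mult inner_commute ennreal_mult')
  then have "(\<integral>\<^sup>+v\<in>cball 0 1. ennreal \<bar>w \<bullet> v\<bar> \<partial>lborel)
      = ennreal (norm w) * (\<integral>\<^sup>+v\<in>cball 0 1. ennreal \<bar>v \<bullet> u\<bar> \<partial>lborel)"
    by (simp add: mult.assoc nn_integral_cmult)
  then show ?thesis
    unfolding nn_integral_unit_ball_abs_inner_unit by (simp add: mult.commute flip: ennreal_mult')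
qed simp

lemma nn_integral_unit_ball_abs_inner_over_norm_square:
  "(\<integral>\<^sup>+v\<in>cball 0 1. ennreal (\<bar>w \<bullet> v\<bar> / (norm v)\<^sup>2) \<partial>lborel)
      = ennreal (2 / DIM('m) * unit_ball_vol (DIM('m)) * norm w)"
proof -
  interpret homogeneous_function_on_star_set "\<lambda>v. ennreal \<bar>w \<bullet> v\<bar>" 1 "DIM('a) + 1" "cball 0 1" norm
    by (rule homogeneous_function_on_unit_ball)
       (auto simp: abs_mult ennreal_mult' nn_integral_unit_ball_abs_inner)
  have "DIM('m) > 0" by simp
  then have powr: "(DIM('a) + 1) / (DIM('a) + 1 + - 2) = (DIM('m) + 2) / DIM('m)"
    "0 < real (DIM('a) + 1) + - 2"
    by (simp_all flip: dim add: add_ac)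
  have "ennreal (\<bar>w \<bullet> v\<bar> / (norm v)\<^sup>2) = ennreal \<bar>w \<bullet> v\<bar> * ennreal (norm v powr - 2)" for v
    by (cases "v = 0") (simp_all add: powr_minus_divide powr_numeral flip: ennreal_mult')
  then have "(\<integral>\<^sup>+v\<in>cball 0 1. ennreal (\<bar>w \<bullet> v\<bar> / (norm v)\<^sup>2) \<partial>lborel)
      = ennreal (2 / (DIM('m) + 2) * unit_ball_vol (DIM('m)) * norm w) * ennreal ((DIM('m) + 2) / DIM('m))"
    using nn_integral_mult_powr[of "- 2"] powr by (simp add: nn_integral_unit_ball_abs_inner)
  also have "\<dots> = ennreal (2 / (DIM('m) + 2) * unit_ball_vol (DIM('m)) * norm w * ((DIM('m) + 2) / DIM('m)))"
    by (rule ennreal_mult''[symmetric]) simp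
  also have "2 / (DIM('m) + 2) * unit_ball_vol (DIM('m)) * norm w * ((DIM('m) + 2) / DIM('m))
      = 2 / DIM('m) * unit_ball_vol (DIM('m)) * norm w"
    by (simp add: divide_simps)
  finally show ?thesis .
qed

end

lemma nn_integral_unit_ball_inverse_norm:
  assumes "DIM('a::euclidean_space) \<ge> 2"
  shows "(\<integral>\<^sup>+v\<in>cball 0 1. ennreal (1 / norm v) \<partial>(lborel :: 'a measure))
    = ennreal (DIM('a) / (DIM('a) - 1) * unit_ball_vol (DIM('a)))"
proof -
  interpret homogeneous_function_on_star_set "\<lambda>_::'a. 1" 0 "DIM('a)" "cball 0 1" norm
    by (rule homogeneous_function_on_unit_ball) (auto simp: emeasure_unit_cball)
  have "1 / norm v = norm v powr - 1" for v :: 'a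
    by (cases "v = 0") (simp_all add: powr_minus_divide)
  then show ?thesis
    using nn_integral_mult_powr[of "- 1"] assms
    by (simp add: emeasure_unit_cball mult.commute of_nat_diff flip: ennreal_mult'')
qed

definition slab_average :: "('a::euclidean_space \<Rightarrow> ennreal) \<Rightarrow> 'a \<Rightarrow> real \<Rightarrow> ennreal" where
  "slab_average F v h = ennreal (1 / (2 * h)) * (\<integral>\<^sup>+x\<in>{x. \<bar>x \<bullet> v\<bar> < h}. F x \<partial>lborel)"

lemma slab_average_scaleR:
  assumes "c > 0" "h > 0"
  shows "slab_average F (c *\<^sub>R v) (c * h) = ennreal (1 / c) * slab_average F v h"
proof -
  have "{x. \<bar>x \<bullet> (c *\<^sub>R v)\<bar> < c * h} = {x. \<bar>x \<bullet> v\<bar> < h}" using assms by (simp add: abs_mult)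
  moreover have "ennreal (1 / (2 * (c * h))) = ennreal (1 / c) * ennreal (1 / (2 * h))"
    using assms by (simp flip: ennreal_mult')
  ultimately show ?thesis by (simp add: slab_average_def mult.assoc)
qed

lemma slab_measurable [measurable]:
  "{z :: ('a::euclidean_space) \<times> 'a. \<bar>fst z \<bullet> snd z\<bar> < h} \<in> sets (borel \<Otimes>\<^sub>M borel)"
proof -
  have "{z \<in> space (borel \<Otimes>\<^sub>M (borel :: 'a measure)). \<bar>fst z \<bullet> snd z\<bar> < h} \<in> sets (borel \<Otimes>\<^sub>M borel)"
    by measurable
  then show ?thesis by (simp add: space_pair_measure)
qed

lemma slab_average_measurable [measurable]:
  fixes F :: "'a::euclidean_space \<Rightarrow> ennreal"
  assumes [measurable]: "F \<in> borel_measurable borel"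
  shows "(\<lambda>v. slab_average F v h) \<in> borel_measurable borel"
proof -
  have "indicator {x. \<bar>x \<bullet> v\<bar> < h} x = (indicator {z. \<bar>fst z \<bullet> snd z\<bar> < h} (x, v) :: ennreal)" for x v :: 'a
    by (simp add: indicator_def)
  then show ?thesis unfolding slab_average_def by simp
qed

lemma nn_integral_unit_ball_slab_average_le:
  fixes F :: "'a::euclidean_space \<Rightarrow> ennreal" and M :: "'m::euclidean_space itself"
  assumes [measurable]: "F \<in> borel_measurable borel" and dim: "DIM('m) + 1 = DIM('a)" and "h > 0"
  shows "(\<integral>\<^sup>+v\<in>cball 0 1. slab_average F v h \<partial>lborel)
    \<le> ennreal (unit_ball_vol (DIM('m))) * (\<integral>\<^sup>+x. F x * ennreal (1 / norm x) \<partial>lborel)"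
proof -
  let ?c = "ennreal (1 / (2 * h))" and ?Z = "{z :: 'a \<times> 'a. \<bar>fst z \<bullet> snd z\<bar> < h}" and ?B = "cball (0::'a) 1"
  have slab: "indicator {x. \<bar>x \<bullet> v\<bar> < h} x = (indicator ?Z (x, v) :: ennreal)" for x v :: 'a
    by (simp add: indicator_def)
  have "(\<integral>\<^sup>+v\<in>?B. slab_average F v h \<partial>lborel)
      = (\<integral>\<^sup>+v. \<integral>\<^sup>+x. ?c * (F x * indicator ?Z (x, v)) * indicator ?B v \<partial>lborel \<partial>lborel)"
    unfolding slab_average_def slab by (simp add: nn_integral_cmult nn_integral_multc)
  also have "\<dots> = (\<integral>\<^sup>+x. \<integral>\<^sup>+v. ?c * (F x * indicator ?Z (x, v)) * indicator ?B v \<partial>lborel \<partial>lborel)"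
    by (rule lborel_pair.Fubini') measurable
  also have "\<dots> \<le> (\<integral>\<^sup>+x. ennreal (unit_ball_vol (DIM('m))) * (F x * ennreal (1 / norm x)) \<partial>lborel)"
  proof (intro nn_integral_mono_AE, use AE_lborel_singleton[of "0::'a"] in eventually_elim)
    case (elim x)
    have [measurable]: "{v. \<bar>x \<bullet> v\<bar> < h} \<in> sets borel" by measurable
    have "(\<integral>\<^sup>+v. ?c * (F x * indicator ?Z (x, v)) * indicator ?B v \<partial>lborel)
        = (\<integral>\<^sup>+v. ?c * F x * indicator ({v. \<bar>x \<bullet> v\<bar> < h} \<inter> ?B) v \<partial>lborel)"
      by (intro nn_integral_cong) (simp add: indicator_def)
    also have "\<dots> = ?c * F x * emeasure lborel ({v. \<bar>x \<bullet> v\<bar> < h} \<inter> ?B)"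
      by (rule nn_integral_cmult_indicator) simp
    also have "\<dots> \<le> ?c * F x * ennreal (2 * h * unit_ball_vol (DIM('m)) / norm x)"
      by (intro mult_left_mono emeasure_unit_ball_slab_le dim elim \<open>h > 0\<close>) simp
    also have "\<dots> = F x * (?c * ennreal (2 * h * unit_ball_vol (DIM('m)) / norm x))" by (simp only: ac_simps)
    also have "?c * ennreal (2 * h * unit_ball_vol (DIM('m)) / norm x)
        = ennreal (unit_ball_vol (DIM('m))) * ennreal (1 / norm x)"
      using \<open>h > 0\<close> by (simp flip: ennreal_mult')
    finally show ?case by (simp only: ac_simps)
  qed
  also have "\<dots> = ennreal (unit_ball_vol (DIM('m))) * (\<integral>\<^sup>+x. F x * ennreal (1 / norm x) \<partial>lborel)"
    by (rule nn_integral_cmult) measurable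
  finally show ?thesis .
qed

lemma (in hyperplane_frame) hyperplane_integral_le_Liminf_slab_average:
  assumes [measurable]: "F \<in> borel_measurable borel" and lsc: "\<And>x. F x \<le> Liminf (at x) F"
  shows "(\<integral>\<^sup>+y. F (f y) \<partial>lborel) \<le> Liminf (at_right 0) (slab_average F u)"
proof -
  define section_integral where "section_integral s = (\<integral>\<^sup>+y. F (s *\<^sub>R u + f y) \<partial>lborel)" for s
  have [measurable]: "section_integral \<in> borel_measurable borel"
    unfolding section_integral_def[abs_def] by measurable
  have "section_integral 0 \<le> Liminf (at 0) section_integral"
    unfolding section_integral_def
  proof (rule fatou_at_within)
    have "filterlim (\<lambda>s. s *\<^sub>R u + f y) (at (f y)) (at 0)" for y
    proof (unfold filterlim_at, intro conjI)
      show "\<forall>\<^sub>F s in at 0. s *\<^sub>R u + f y \<in> UNIV \<and> s *\<^sub>R u + f y \<noteq> f y"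
        using unit by (auto simp: eventually_at_filter)
      have "((\<lambda>s. s *\<^sub>R u + f y) \<longlongrightarrow> 0 *\<^sub>R u + f y) (at 0)" by (intro tendsto_intros)
      then show "((\<lambda>s. s *\<^sub>R u + f y) \<longlongrightarrow> f y) (at 0)" by simp
    qed
    then have "F (f y) \<le> Liminf (at 0) (\<lambda>s. F (s *\<^sub>R u + f y))" for y
      by (rule order_trans[OF lsc Liminf_le_Liminf_compose])
    then show "AE y in lborel. F (0 *\<^sub>R u + f y) \<le> Liminf (at 0) (\<lambda>s. F (s *\<^sub>R u + f y))"
      by simp
  qed measurable
  then have le_average: "section_integral 0
      \<le> Liminf (at_right 0) (\<lambda>h. ennreal (1 / (2 * h)) * (\<integral>\<^sup>+s\<in>{-h<..<h}. section_integral s \<partial>lborel))"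
    by (rule le_Liminf_symmetric_average[rotated]) measurable
  have slab: "(\<integral>\<^sup>+s\<in>{-h<..<h}. section_integral s \<partial>lborel) = (\<integral>\<^sup>+x\<in>{x. \<bar>x \<bullet> u\<bar> < h}. F x \<partial>lborel)" for h
  proof -
    have "indicator {x. \<bar>x \<bullet> u\<bar> < h} (s *\<^sub>R u + f y) = (indicator {-h<..<h} s :: ennreal)" for s y
      by (auto simp: indicator_def inner_split)
    then show ?thesis
      by (subst nn_integral_split) (simp_all add: section_integral_def nn_integral_multc)
  qed
  show ?thesis using le_average unfolding slab slab_average_def[abs_def] by (simp add: section_integral_def)
qed

lemma lower_semicontinuous_indicator_open:
  fixes g :: "'a::topological_space \<Rightarrow> real"
  assumes "continuous_on UNIV g" "open U"
  shows "ennreal (g x) * indicator U x \<le> Liminf (at x) (\<lambda>x. ennreal (g x) * indicator U x)"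
proof (cases "x \<in> U")
  case True
  then have "\<forall>\<^sub>F y in at x. y \<in> U" using \<open>open U\<close> by (rule eventually_at_in_open'[rotated])
  then have "\<forall>\<^sub>F y in at x. ennreal (g y) = ennreal (g y) * indicator U y" by eventually_elim simp
  moreover have "((\<lambda>y. ennreal (g y)) \<longlongrightarrow> ennreal (g x)) (at x)"
    using assms(1) by (intro tendsto_ennrealI) (simp add: continuous_on_def)
  ultimately have "((\<lambda>y. ennreal (g y) * indicator U y) \<longlongrightarrow> ennreal (g x)) (at x)"
    by (rule Lim_transform_eventually[rotated])
  then show ?thesis
    using True by (cases "at x = bot") (simp_all add: lim_imp_Liminf)
qed simp

lemma AE_star_body_interior:
  fixes f :: "'m::euclidean_space \<Rightarrow> 'a::euclidean_space"
  assumes L: "star_body L" and f: "linear f" and inj: "\<And>y. f y = 0 \<Longrightarrow> y = 0"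
  shows "AE y in lborel. f y \<in> L \<longrightarrow> f y \<in> interior L"
proof -
  have cl: "closed L" using L by (auto simp: star_body_def compact_imp_closed)
  let ?S = "f -` (L - interior L)"
  have closed_S: "closed ?S"
    using f cl
    by (intro continuous_closed_vimage closed_Diff open_interior linear_continuous_at
      linear_conv_bounded_linear[THEN iffD1])
  have shrink: "c *\<^sub>R x \<in> interior L" if "x \<in> L" "0 \<le> c" "c < 1" "x \<noteq> 0" for c and x :: 'a
  proof -
    have "c *\<^sub>R x \<noteq> x" using that by (metis less_irrefl scaleR_cancel_right scaleR_one)
    then have "c *\<^sub>R x \<in> closed_segment 0 x - {x}"
      using that by (auto simp: closed_segment_def intro!: exI[of _ c])
    then show ?thesis using L that by (auto simp: star_body_def)
  qed
  have "negligible ?S"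
  proof (cases "\<exists>x\<in>L. x \<noteq> 0")
    case True
    then have "0 \<in> interior L" using shrink[of _ 0] by auto
    show ?thesis
    proof (rule starlike_negligible_strong[OF closed_S, of 0])
      fix c :: real and x :: 'm assume "0 \<le> c" "c < 1" "0 + x \<in> ?S"
      moreover from this have "f x \<noteq> 0" using \<open>0 \<in> interior L\<close> by auto
      ultimately have "c *\<^sub>R f x \<in> interior L" using shrink[of "f x" c] by auto
      then show "0 + c *\<^sub>R x \<notin> ?S" by (simp add: linear_scale[OF f])
    qed
  next
    case False
    then have "?S \<subseteq> {0}" using inj by auto
    then show ?thesis using negligible_subset negligible_sing by blast
  qed
  then have "emeasure lebesgue ?S = 0" by (simp add: negligible_iff_null_sets null_sets_def)
  then have "?S \<in> null_sets lborel" using closed_S by (auto simp: null_sets_def borel_closed)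
  then show ?thesis by (rule AE_I') auto
qed

lemma mu_hyp_le_Liminf_slab_average:
  fixes \<theta> :: "real^'n" and M :: "'m::euclidean_space itself"
  assumes \<theta>: "norm \<theta> = 1" and dim: "DIM('m) + 1 = CARD('n)"
    and g: "continuous_on UNIV g" and L: "star_body L"
  shows "mu_hyp M g \<theta> (L \<inter> {x. x \<bullet> \<theta> = 0})
    \<le> Liminf (at_right 0) (slab_average (\<lambda>x. ennreal (g x) * indicator (interior L) x) \<theta>)"
proof -
  interpret hyperplane_frame \<theta> "hyp_iso M \<theta>" using \<theta> dim by (rule hyperplane_frame_hyp_iso)
  have [measurable]: "g \<in> borel_measurable borel" using g by (rule borel_measurable_continuous_onI)
  have "AE y in lborel. hyp_iso M \<theta> y \<in> L \<longrightarrow> hyp_iso M \<theta> y \<in> interior L"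
    by (rule AE_star_body_interior[OF L lin]) (use iso in \<open>metis norm_eq_zero\<close>)
  then have "mu_hyp M g \<theta> (L \<inter> {x. x \<bullet> \<theta> = 0})
      \<le> (\<integral>\<^sup>+y. ennreal (g (hyp_iso M \<theta> y)) * indicator (interior L) (hyp_iso M \<theta> y) \<partial>lborel)"
    unfolding mu_hyp_def by (intro nn_integral_mono_AE, eventually_elim) (auto simp: indicator_def)
  also have "\<dots> \<le> Liminf (at_right 0) (slab_average (\<lambda>x. ennreal (g x) * indicator (interior L) x) \<theta>)"
    by (intro hyperplane_integral_le_Liminf_slab_average lower_semicontinuous_indicator_open g
      open_interior) measurable
  finally show ?thesis .
qed

lemma mu_hyp_over_norm_le_Liminf_slab_average:
  fixes v :: "real^'n" and M :: "'m::euclidean_space itself"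
  assumes v: "v \<noteq> 0" and dim: "DIM('m) + 1 = CARD('n)"
    and g: "continuous_on UNIV g" and L: "star_body L"
  defines "\<theta> \<equiv> (1 / norm v) *\<^sub>R v"
  shows "ennreal (1 / norm v) * mu_hyp M g \<theta> (L \<inter> {x. x \<bullet> \<theta> = 0})
    \<le> Liminf (at_right 0) (slab_average (\<lambda>x. ennreal (g x) * indicator (interior L) x) v)"
proof -
  let ?A = "slab_average (\<lambda>x. ennreal (g x) * indicator (interior L) x)"
  have "norm \<theta> = 1" "v = norm v *\<^sub>R \<theta>" using v by (simp_all add: \<theta>_def)
  have "ennreal (1 / norm v) * mu_hyp M g \<theta> (L \<inter> {x. x \<bullet> \<theta> = 0})
      \<le> ennreal (1 / norm v) * Liminf (at_right 0) (?A \<theta>)"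
    by (intro mult_left_mono mu_hyp_le_Liminf_slab_average[OF \<open>norm \<theta> = 1\<close> dim g L]) simp
  also have "\<dots> = Liminf (at_right 0) (\<lambda>h. ennreal (1 / norm v) * ?A \<theta> h)"
    by (rule Liminf_ennreal_cmult[symmetric]) (simp_all add: trivial_limit_at_right_real)
  also have "\<dots> = Liminf (at_right 0) (\<lambda>h. ?A v (norm v * h))"
  proof (rule Liminf_eq)
    show "\<forall>\<^sub>F h in at_right 0. ennreal (1 / norm v) * ?A \<theta> h = ?A v (norm v * h)"
      using eventually_at_right_less
      by eventually_elim (use slab_average_scaleR[of "norm v" _ _ \<theta>] v \<open>v = norm v *\<^sub>R \<theta>\<close> in simp)
  qed
  also have "\<dots> = Liminf (at_right 0) (?A v)"
    using v by (intro Liminf_at_right_0_scale) simp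
  finally show ?thesis .
qed

section \<open>Almost everywhere differentiability of convex functions\<close>

definition right_slope :: "(real \<Rightarrow> real) \<Rightarrow> real \<Rightarrow> real" where
  "right_slope c s = Inf ((\<lambda>t. (c t - c s) / (t - s)) ` {s<..})"

lemma slope_commute: "(c a - c b) / (a - b) = (c b - c a) / (b - a)" for c :: "real \<Rightarrow> real"
  by (metis minus_diff_eq minus_divide_divide)

context
  fixes c :: "real \<Rightarrow> real"
  assumes convex: "convex_on UNIV c"
begin

lemma slope_left_mono:
  assumes "r < q" "q < s"
  shows "(c s - c r) / (s - r) \<le> (c s - c q) / (s - q)"
  using convex_on_slope_le(2)[OF convex _ _ assms] slope_commute[of c r s] slope_commute[of c q s] by simp

lemma slope_right_mono:
  assumes "s < t" "t < u"
  shows "(c t - c s) / (t - s) \<le> (c u - c s) / (u - s)"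
  using convex_on_slope_le(1)[OF convex _ _ assms] slope_commute[of c s t] slope_commute[of c s u] by simp

lemma slope_mono:
  assumes "r < s" "s < t"
  shows "(c s - c r) / (s - r) \<le> (c t - c s) / (t - s)"
  using slope_right_mono[OF assms] slope_left_mono[OF assms] by (rule order_trans)

lemma right_slope_le: "s < t \<Longrightarrow> right_slope c s \<le> (c t - c s) / (t - s)"
  unfolding right_slope_def
  by (intro cInf_lower bdd_belowI2[of _ "(c s - c (s - 1)) / (s - (s - 1))"] slope_mono) auto

lemma le_right_slope: "r < s \<Longrightarrow> (c s - c r) / (s - r) \<le> right_slope c s"
  unfolding right_slope_def by (intro cInf_greatest) (auto intro: slope_mono)

lemma mono_right_slope: "mono (right_slope c)"
proof (rule monoI)
  fix r s :: real assume "r \<le> s"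
  then show "right_slope c r \<le> right_slope c s"
    using right_slope_le[of r s] le_right_slope[of r s] by (cases "r = s") auto
qed

lemma has_derivative_right_slopeI:
  assumes "\<And>e. e > 0 \<Longrightarrow> \<exists>h>0. (c (s + h) - c s) / h - (c s - c (s - h)) / h < e"
  shows "(c has_real_derivative right_slope c s) (at s)"
  unfolding has_field_derivative_iff
proof (rule LIM_I)
  fix e :: real assume "e > 0"
  then obtain h where h: "h > 0" "(c (s + h) - c s) / h - (c s - c (s - h)) / h < e" using assms by blast
  have "\<bar>(c t - c s) / (t - s) - right_slope c s\<bar> < e" if t: "t \<noteq> s" "\<bar>t - s\<bar> < h" for t
  proof (cases "s < t")
    case True
    then have "right_slope c s \<le> (c t - c s) / (t - s)" "(c t - c s) / (t - s) \<le> (c (s + h) - c s) / h"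
      "(c s - c (s - h)) / h \<le> right_slope c s"
      using right_slope_le slope_right_mono[of s t "s + h"] le_right_slope[of "s - h" s] t h(1) by auto
    with h(2) show ?thesis by linarith
  next
    case False
    then have "(c s - c t) / (s - t) \<le> right_slope c s" "(c s - c (s - h)) / h \<le> (c s - c t) / (s - t)"
      "right_slope c s \<le> (c (s + h) - c s) / h"
      using le_right_slope slope_left_mono[of "s - h" t s] right_slope_le[of s "s + h"] t h(1) by auto
    with h(2) show ?thesis unfolding slope_commute[of c s t] by linarith
  qed
  then show "\<exists>d>0. \<forall>t. t \<noteq> s \<and> norm (t - s) < d \<longrightarrow> norm ((c t - c s) / (t - s) - right_slope c s) < e"
    using h(1) by auto
qed

text \<open>The slopes on either side of \<open>s\<close> lie between \<open>right_slope c s\<close> and the right slope at the other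
  endpoint, so \<open>c\<close> is differentiable wherever the monotone function \<open>right_slope c\<close> is continuous.\<close>

lemma countable_not_differentiable: "countable {s. \<not> (\<exists>D. (c has_real_derivative D) (at s))}"
proof (rule countable_subset)
  show "countable {s. \<not> isCont (right_slope c) s}" by (rule mono_ctble_discont[OF mono_right_slope])
  have "(c has_real_derivative right_slope c s) (at s)" if "isCont (right_slope c) s" for s
  proof (rule has_derivative_right_slopeI)
    fix e :: real assume "e > 0"
    obtain d where d: "d > 0" "\<And>t. \<bar>t - s\<bar> < d \<Longrightarrow> \<bar>right_slope c t - right_slope c s\<bar> < e / 2"
      using \<open>isCont (right_slope c) s\<close>[unfolded continuous_at_eps_delta dist_real_def] \<open>e > 0\<close> half_gt_zero
      by metis
    have "(c (s + d / 2) - c s) / (d / 2) \<le> right_slope c (s + d / 2)"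
      "right_slope c (s - d / 2) \<le> (c s - c (s - d / 2)) / (d / 2)"
      using le_right_slope[of s "s + d / 2"] right_slope_le[of "s - d / 2" s] d(1) by simp_all
    moreover have "\<bar>right_slope c (s + d / 2) - right_slope c s\<bar> < e / 2"
      "\<bar>right_slope c (s - d / 2) - right_slope c s\<bar> < e / 2"
      using d by simp_all
    ultimately have "(c (s + d / 2) - c s) / (d / 2) - (c s - c (s - d / 2)) / (d / 2) < e" by linarith
    with d(1) show "\<exists>h>0. (c (s + h) - c s) / h - (c s - c (s - h)) / h < e"
      by (intro exI[of _ "d / 2"]) simp
  qed
  then show "{s. \<not> (\<exists>D. (c has_real_derivative D) (at s))} \<subseteq> {s. \<not> isCont (right_slope c) s}" by blast
qed

end

lemma has_real_derivative_imp_second_difference_small: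
  fixes c :: "real \<Rightarrow> real"
  assumes "(c has_real_derivative D) (at s)" "e > 0"
  shows "\<forall>\<^sub>F h in at_right 0. (c (s + h) - c s) / h - (c s - c (s - h)) / h < e"
proof -
  have deriv: "((\<lambda>h. (c (s + h) - c s) / h) \<longlongrightarrow> D) (at 0)"
    using assms(1) by (simp add: DERIV_def)
  have "filterlim (\<lambda>h. h) (at 0) (at_right (0::real))" "filterlim uminus (at 0) (at_right (0::real))"
    by (auto simp: filterlim_at eventually_at_filter intro!: tendsto_eq_intros)
  from this[THEN filterlim_compose[OF deriv]]
  have "((\<lambda>h. (c (s + h) - c s) / h - (c (s + - h) - c s) / - h) \<longlongrightarrow> D - D) (at_right 0)"
    by (rule tendsto_diff)
  then have "\<forall>\<^sub>F h in at_right 0. (c (s + h) - c s) / h - (c (s + - h) - c s) / - h < e"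
    using \<open>e > 0\<close> by (intro order_tendstoD) auto
  then show ?thesis by eventually_elim (simp add: minus_divide_left)
qed

lemma null_sets_if_countable_on_lines:
  fixes N :: "'a::euclidean_space set"
  assumes [measurable]: "N \<in> sets borel" and countable: "\<And>x. countable {s::real. x + s *\<^sub>R v \<in> N}"
  shows "N \<in> null_sets lborel"
proof -
  have "emeasure lborel N = (\<integral>\<^sup>+t. (\<integral>\<^sup>+x. indicator N x \<partial>lborel) * indicator {0..1::real} t \<partial>lborel)"
    by (simp add: nn_integral_cmult)
  also have "\<dots> = (\<integral>\<^sup>+t. \<integral>\<^sup>+x. indicator N (t *\<^sub>R v + x) * indicator {0..1::real} t \<partial>lborel \<partial>lborel)"
  proof (intro nn_integral_cong)
    fix t :: real
    show "(\<integral>\<^sup>+x. indicator N x \<partial>lborel) * indicator {0..1} t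
        = (\<integral>\<^sup>+x. indicator N (t *\<^sub>R v + x) * indicator {0..1} t \<partial>lborel)"
      using nn_integral_lborel_shift[of "indicator N" "t *\<^sub>R v"] by (simp add: nn_integral_multc)
  qed
  also have "\<dots> = (\<integral>\<^sup>+x. \<integral>\<^sup>+t. indicator N (t *\<^sub>R v + x) * indicator {0..1::real} t \<partial>lborel \<partial>lborel)"
    by (rule lborel_pair.Fubini') measurable
  also have "\<dots> = (\<integral>\<^sup>+(x::'a). 0 \<partial>lborel)"
  proof (intro nn_integral_cong)
    fix x
    have "AE t in lborel. t \<notin> {s::real. x + s *\<^sub>R v \<in> N}"
      using countable_imp_null_set_lborel[OF countable] by (rule AE_not_in)
    then have "AE t in lborel. indicator N (t *\<^sub>R v + x) * indicator {0..1::real} t = (0::ennreal)"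
      by eventually_elim (simp add: add.commute)
    then show "(\<integral>\<^sup>+t. indicator N (t *\<^sub>R v + x) * indicator {0..1::real} t \<partial>lborel) = 0"
      by (subst nn_integral_0_iff_AE) measurable
  qed
  finally show ?thesis by (simp add: null_sets_def)
qed

definition subgradient :: "('a::real_inner \<Rightarrow> real) \<Rightarrow> 'a \<Rightarrow> 'a \<Rightarrow> bool" where
  "subgradient \<phi> x \<xi> \<longleftrightarrow> (\<forall>z. \<phi> x + \<xi> \<bullet> z \<le> \<phi> (x + z))"

definition gradient :: "('a::euclidean_space \<Rightarrow> real) \<Rightarrow> 'a \<Rightarrow> 'a" where
  "gradient \<phi> x = (\<Sum>i\<in>Basis. lim (\<lambda>k. real (Suc k) * (\<phi> (x + (1 / real (Suc k)) *\<^sub>R i) - \<phi> x)) *\<^sub>R i)"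

lemma directional_derivative_eq_subgradient:
  assumes "subgradient \<phi> x \<xi>" "((\<lambda>s. \<phi> (x + s *\<^sub>R v)) has_real_derivative D) (at 0)"
  shows "D = \<xi> \<bullet> v"
proof -
  have "((\<lambda>s. \<phi> (x + s *\<^sub>R v) - s * (\<xi> \<bullet> v)) has_real_derivative D - \<xi> \<bullet> v) (at 0)"
    by (auto intro!: derivative_eq_intros assms(2))
  moreover have "\<phi> (x + 0 *\<^sub>R v) - 0 * (\<xi> \<bullet> v) \<le> \<phi> (x + s *\<^sub>R v) - s * (\<xi> \<bullet> v)" for s
    using assms(1)[unfolded subgradient_def, rule_format, of "s *\<^sub>R v"] by simp
  ultimately have "D - \<xi> \<bullet> v = 0" by (intro DERIV_local_min[of _ _ 0 1]) auto
  then show ?thesis by simp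
qed

context
  fixes \<phi> :: "'a::euclidean_space \<Rightarrow> real"
  assumes convex: "convex_on UNIV \<phi>"
begin

lemma continuous_on_convex: "continuous_on S \<phi>"
  using convex_on_continuous[OF open_UNIV convex] by (rule continuous_on_subset) simp

lemma borel_measurable_convex [measurable]: "\<phi> \<in> borel_measurable borel"
  using continuous_on_convex by (rule borel_measurable_continuous_onI)

lemma convex_on_line: "convex_on UNIV (\<lambda>s. \<phi> (x + s *\<^sub>R v))"
proof (rule convex_onI)
  fix t a b :: real assume t: "0 < t" "t < 1"
  have "x + ((1 - t) *\<^sub>R a + t *\<^sub>R b) *\<^sub>R v = (1 - t) *\<^sub>R (x + a *\<^sub>R v) + t *\<^sub>R (x + b *\<^sub>R v)"
    by (simp add: algebra_simps)
  then show "\<phi> (x + ((1 - t) *\<^sub>R a + t *\<^sub>R b) *\<^sub>R v) \<le> (1 - t) * \<phi> (x + a *\<^sub>R v) + t * \<phi> (x + b *\<^sub>R v)"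
    using convex_onD[OF convex, of t "x + a *\<^sub>R v" "x + b *\<^sub>R v"] t by simp
qed auto

lemma AE_directional_derivative:
  "AE x in lborel. \<exists>D. ((\<lambda>s. \<phi> (x + s *\<^sub>R v)) has_real_derivative D) (at 0)"
proof -
  define second_diff where
    "second_diff h x = (\<phi> (x + h *\<^sub>R v) - \<phi> x) / h - (\<phi> x - \<phi> (x - h *\<^sub>R v)) / h" for h x
  define N where "N = {x. \<not> (\<forall>n. \<exists>k. second_diff (1 / real (Suc k)) x < 1 / real (Suc n))}"
  have "N \<in> null_sets lborel"
  proof (rule null_sets_if_countable_on_lines)
    show "N \<in> sets borel" unfolding N_def second_diff_def by measurable
    fix x
    have "x + s *\<^sub>R v \<notin> N" if "((\<lambda>s. \<phi> (x + s *\<^sub>R v)) has_real_derivative D) (at s)" for s D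
    proof -
      have "filterlim (\<lambda>k. 1 / real (Suc k)) (at_right 0) sequentially"
        using LIMSEQ_inverse_real_of_nat
        by (intro tendsto_imp_filterlim_at_right) (simp_all add: inverse_eq_divide)
      from eventually_compose_filterlim[OF has_real_derivative_imp_second_difference_small[OF that] this]
      have "\<forall>\<^sub>F k in sequentially. second_diff (1 / real (Suc k)) (x + s *\<^sub>R v) < 1 / real (Suc n)" for n
        unfolding second_diff_def
        by (simp add: scaleR_add_left scaleR_diff_left add.assoc add_diff_eq del: of_nat_Suc)
      then show ?thesis using eventually_happens'[OF sequentially_bot] unfolding N_def by blast
    qed
    then have "{s. x + s *\<^sub>R v \<in> N} \<subseteq> {s. \<not> (\<exists>D. ((\<lambda>s. \<phi> (x + s *\<^sub>R v)) has_real_derivative D) (at s))}"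
      by blast
    then show "countable {s. x + s *\<^sub>R v \<in> N}"
      using countable_not_differentiable[OF convex_on_line] by (rule countable_subset)
  qed
  then have "AE x in lborel. x \<notin> N" by (rule AE_not_in)
  then show ?thesis
  proof eventually_elim
    case (elim x)
    have "\<exists>h>0. second_diff h x < e" if e: "e > 0" for e
    proof -
      obtain n where "1 / real (Suc n) < e" using nat_approx_posE[OF e] by blast
      moreover obtain k where "second_diff (1 / real (Suc k)) x < 1 / real (Suc n)"
        using elim unfolding N_def by blast
      ultimately show ?thesis by (intro exI[of _ "1 / real (Suc k)"]) auto
    qed
    then show ?case
      using has_derivative_right_slopeI[OF convex_on_line[of x v], of 0] by (auto simp: second_diff_def)
  qed
qed

lemma convex_strict_epigraph: "convex {(y, t). \<phi> y < t}"
proof (rule convexI, clarsimp)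
  fix y z s t and a b :: real
  assume "\<phi> y < s" "\<phi> z < t" "0 \<le> a" "0 \<le> b" "a + b = 1"
  moreover from this have "\<phi> (a *\<^sub>R y + b *\<^sub>R z) \<le> a * \<phi> y + b * \<phi> z"
    using convex unfolding convex_on_def by blast
  moreover have "a * \<phi> y + b * \<phi> z < a * s + b * t"
    using calculation by (cases "a = 0") (auto intro!: add_less_le_mono mult_left_mono)
  ultimately show "\<phi> (a *\<^sub>R y + b *\<^sub>R z) < a * s + b * t" by linarith
qed

text \<open>A hyperplane separating the strict epigraph from \<open>(x, \<phi> x)\<close> is not vertical, so it is the graph of an
  affine minorant.\<close>

lemma subgradient_exists: "\<exists>\<xi>. subgradient \<phi> x \<xi>"
proof -
  let ?E = "{(y, t). \<phi> y < t}"
  have "(x, \<phi> x + 1) \<in> ?E" by simp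
  moreover have "?E \<inter> {(x, \<phi> x)} = {}" by simp
  ultimately obtain n \<beta> where n: "n \<noteq> 0" "\<And>z. z \<in> ?E \<Longrightarrow> n \<bullet> z \<le> \<beta>" "\<beta> \<le> n \<bullet> (x, \<phi> x)"
    using separating_hyperplane_sets[of ?E "{(x, \<phi> x)}"] convex_strict_epigraph
    by (metis convex_singleton empty_iff insertI1 insert_not_empty)
  obtain a b where ab: "n = (a, b)" by (cases n)
  have sep: "a \<bullet> y + b * t \<le> a \<bullet> x + b * \<phi> x" if "\<phi> y < t" for y t
    using n(2)[of "(y, t)"] n(3) that by (simp add: ab)
  have "b * (\<phi> x + 1) \<le> b * \<phi> x" using sep[of x "\<phi> x + 1"] by simp
  then have "b \<le> 0" by (simp add: distrib_left)
  moreover have "b \<noteq> 0"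
  proof
    assume "b = 0"
    then have "a \<bullet> a \<le> 0" using sep[of "x + a" "\<phi> (x + a) + 1"] by (simp add: inner_simps)
    then have "a = 0" by (metis inner_gt_zero_iff not_le)
    then show False using n(1) \<open>b = 0\<close> by (simp add: ab zero_prod_def)
  qed
  ultimately have b: "b < 0" by simp
  have "\<phi> x + (- (1 / b) *\<^sub>R a) \<bullet> z \<le> \<phi> (x + z)" for z
  proof (rule field_le_epsilon)
    fix e :: real assume "e > 0"
    then have "a \<bullet> z + b * (\<phi> (x + z) + e) \<le> b * \<phi> x"
      using sep[of "x + z" "\<phi> (x + z) + e"] by (simp add: inner_simps)
    then have "b * \<phi> x / b \<le> (a \<bullet> z + b * (\<phi> (x + z) + e)) / b"
      using b by (intro divide_right_mono_neg) auto
    then show "\<phi> x + (- (1 / b) *\<^sub>R a) \<bullet> z \<le> \<phi> (x + z) + e" using b by (simp add: add_divide_distrib)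
  qed
  then show ?thesis unfolding subgradient_def by blast
qed

lemma gradient_measurable [measurable]: "gradient \<phi> \<in> borel_measurable borel"
  unfolding gradient_def[abs_def]
  by (intro borel_measurable_sum borel_measurable_scaleR borel_measurable_lim_metric) measurable

lemma gradient_eq_subgradient:
  assumes "subgradient \<phi> x \<xi>" "\<And>i. i \<in> Basis \<Longrightarrow> \<exists>D. ((\<lambda>s. \<phi> (x + s *\<^sub>R i)) has_real_derivative D) (at 0)"
  shows "gradient \<phi> x = \<xi>"
proof -
  have "lim (\<lambda>k. real (Suc k) * (\<phi> (x + (1 / real (Suc k)) *\<^sub>R i) - \<phi> x)) = \<xi> \<bullet> i" if i: "i \<in> Basis" for i
  proof (rule limI)
    have "((\<lambda>s. \<phi> (x + s *\<^sub>R i)) has_real_derivative \<xi> \<bullet> i) (at 0)"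
      using assms(2)[OF i] directional_derivative_eq_subgradient[OF assms(1)] by blast
    then have "((\<lambda>h. (\<phi> (x + h *\<^sub>R i) - \<phi> x) / h) \<longlongrightarrow> \<xi> \<bullet> i) (at 0)"
      by (simp add: DERIV_def)
    moreover have "filterlim (\<lambda>k. 1 / real (Suc k)) (at 0) sequentially"
      using LIMSEQ_inverse_real_of_nat by (simp add: filterlim_at inverse_eq_divide)
    ultimately have "(\<lambda>k. (\<phi> (x + (1 / real (Suc k)) *\<^sub>R i) - \<phi> x) / (1 / real (Suc k))) \<longlonglongrightarrow> \<xi> \<bullet> i"
      by (rule filterlim_compose)
    then show "(\<lambda>k. real (Suc k) * (\<phi> (x + (1 / real (Suc k)) *\<^sub>R i) - \<phi> x)) \<longlonglongrightarrow> \<xi> \<bullet> i"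
      by (simp add: mult.commute)
  qed
  then show ?thesis unfolding gradient_def by (simp add: euclidean_representation)
qed

lemma AE_subgradient_gradient: "AE x in lborel. subgradient \<phi> x (gradient \<phi> x)"
proof -
  have "AE x in lborel. \<forall>i\<in>Basis. \<exists>D. ((\<lambda>s. \<phi> (x + s *\<^sub>R i)) has_real_derivative D) (at 0)"
    by (intro AE_finite_allI AE_directional_derivative) auto
  then show ?thesis
    by eventually_elim (use subgradient_exists gradient_eq_subgradient in metis)
qed

lemma AE_has_directional_derivative_gradient:
  "AE x in lborel. ((\<lambda>s. \<phi> (x + s *\<^sub>R v)) has_real_derivative gradient \<phi> x \<bullet> v) (at 0)"
  using AE_subgradient_gradient AE_directional_derivative[of v]
  by eventually_elim (use directional_derivative_eq_subgradient in blast)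

end

section \<open>Gauges of convex bodies\<close>

definition minkowski_gauge :: "'a::real_vector set \<Rightarrow> 'a \<Rightarrow> real" where
  "minkowski_gauge A x = Inf {t. 0 < t \<and> x \<in> sdil t A}"

lemma zero_in_symmetric_segment: "0 \<in> closed_segment (- \<theta>) (\<theta> :: 'a::real_vector)"
  by (auto simp: closed_segment_def intro!: exI[of _ "1/2"])

definition tent :: "'a::real_vector set \<Rightarrow> 'a \<Rightarrow> real" where
  "tent A x = max 0 (1 - minkowski_gauge A x)"

lemma tent_nonneg: "0 \<le> tent A x"
  by (simp add: tent_def)

locale convex_body_origin =
  fixes A :: "'a::euclidean_space set"
  assumes compact_A: "compact A" and convex_A: "convex A" and zero_interior: "0 \<in> interior A"
begin

lemma zero_in: "0 \<in> A"
  using zero_interior interior_subset by auto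

lemma A_borel [measurable]: "A \<in> sets borel"
  using compact_A by (rule borel_compact)

lemma A_bounded: "bounded A"
  using compact_A by (rule compact_imp_bounded)

lemma inner_ball: obtains r where "r > 0" "cball 0 r \<subseteq> A"
  using zero_interior mem_interior_cball by blast

lemma sdil_mono:
  assumes "0 < s" "s \<le> t"
  shows "sdil s A \<subseteq> sdil t A"
proof
  fix x assume "x \<in> sdil s A"
  then have "(1 / s) *\<^sub>R x \<in> A" using assms by (simp add: mem_sdil_iff)
  then have "(s / t) *\<^sub>R ((1 / s) *\<^sub>R x) \<in> A"
    using convexD_alt[OF convex_A zero_in, of "(1 / s) *\<^sub>R x" "s / t"] assms by simp
  then show "x \<in> sdil t A" using assms by (simp add: mem_sdil_iff)
qed

lemma absorbing: "\<exists>t>0. x \<in> sdil t A"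
proof -
  obtain r where r: "r > 0" "cball 0 r \<subseteq> A" by (rule inner_ball)
  define t where "t = (norm x + 1) / r"
  have t: "t > 0" using r by (auto simp: t_def intro!: divide_pos_pos add_nonneg_pos)
  have "norm ((1 / t) *\<^sub>R x) = r * (norm x / (norm x + 1))" using r t by (simp add: t_def)
  also have "\<dots> \<le> r * 1" using r by (intro mult_left_mono) (auto simp: divide_le_eq add_nonneg_pos)
  finally have "(1 / t) *\<^sub>R x \<in> A" using r by auto
  then show ?thesis using t by (auto simp: mem_sdil_iff)
qed

lemma gauge_nonneg: "0 \<le> minkowski_gauge A x"
  unfolding minkowski_gauge_def using absorbing by (intro cInf_greatest) auto

lemma gauge_le_iff:
  assumes "t > 0"
  shows "minkowski_gauge A x \<le> t \<longleftrightarrow> x \<in> sdil t A"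
proof
  assume "x \<in> sdil t A" then show "minkowski_gauge A x \<le> t"
    unfolding minkowski_gauge_def using assms by (intro cInf_lower bdd_belowI[of _ 0]) auto
next
  assume gauge_le: "minkowski_gauge A x \<le> t"
  have "(1 / s) *\<^sub>R x \<in> A" if "s > t" for s
  proof -
    have "minkowski_gauge A x < s" using gauge_le that by simp
    then obtain s' where "0 < s'" "x \<in> sdil s' A" "s' < s"
      unfolding minkowski_gauge_def using cInf_lessD[of "{t. 0 < t \<and> x \<in> sdil t A}" s] absorbing by blast
    then have "x \<in> sdil s A" using sdil_mono[of s' s] by auto
    then show ?thesis using that assms by (simp add: mem_sdil_iff)
  qed
  then have "\<forall>\<^sub>F s in at_right t. (1 / s) *\<^sub>R x \<in> A"
    using eventually_at_right_less by (rule eventually_mono[rotated])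
  moreover have "((\<lambda>s. (1 / s) *\<^sub>R x) \<longlongrightarrow> (1 / t) *\<^sub>R x) (at_right t)"
    using assms by (intro tendsto_intros) auto
  ultimately have "(1 / t) *\<^sub>R x \<in> A"
    by (rule Lim_in_closed_set[OF compact_imp_closed[OF compact_A] _ trivial_limit_at_right_real])
  then show "x \<in> sdil t A" using assms by (simp add: mem_sdil_iff)
qed

lemma sdil_eq_gauge: "t > 0 \<Longrightarrow> sdil t A = {x. minkowski_gauge A x \<le> t}"
  using gauge_le_iff by auto

lemma mem_iff_gauge: "x \<in> A \<longleftrightarrow> minkowski_gauge A x \<le> 1"
  using gauge_le_iff[of 1 x] by simp

lemma gauge_leI:
  assumes "b \<ge> 0" "\<And>t. t > 0 \<Longrightarrow> b \<le> t \<Longrightarrow> x \<in> sdil t A"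
  shows "minkowski_gauge A x \<le> b"
proof (rule field_le_epsilon)
  fix e :: real assume "e > 0"
  then have "b + e > 0" "b \<le> b + e" using assms(1) by auto
  then show "minkowski_gauge A x \<le> b + e" using assms(2) gauge_le_iff by blast
qed

lemma gauge_scaleR:
  assumes "c > 0"
  shows "minkowski_gauge A (c *\<^sub>R x) = c * minkowski_gauge A x"
proof (rule antisym)
  have scale_le: "minkowski_gauge A (c *\<^sub>R x) \<le> c * minkowski_gauge A x" if "c > 0" for c x
  proof (rule gauge_leI)
    fix t :: real assume t: "t > 0" "c * minkowski_gauge A x \<le> t"
    then have "x \<in> sdil (t / c) A" using that by (simp add: gauge_le_iff[symmetric] field_simps)
    then show "c *\<^sub>R x \<in> sdil t A" using t that by (simp add: mem_sdil_iff)
  qed (use that gauge_nonneg in auto)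
  show "minkowski_gauge A (c *\<^sub>R x) \<le> c * minkowski_gauge A x" using scale_le assms by auto
  have "c * minkowski_gauge A ((1 / c) *\<^sub>R (c *\<^sub>R x)) \<le> c * ((1 / c) * minkowski_gauge A (c *\<^sub>R x))"
    using scale_le[of "1 / c" "c *\<^sub>R x"] assms by (intro mult_left_mono) auto
  then show "c * minkowski_gauge A x \<le> minkowski_gauge A (c *\<^sub>R x)" using assms by simp
qed

lemma gauge_add: "minkowski_gauge A (x + y) \<le> minkowski_gauge A x + minkowski_gauge A y"
proof (rule field_le_epsilon)
  fix e :: real assume e: "e > 0"
  define s t where "s = minkowski_gauge A x + e / 2" and "t = minkowski_gauge A y + e / 2"
  have st: "s > 0" "t > 0" using e gauge_nonneg[of x] gauge_nonneg[of y] by (auto simp: s_def t_def)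
  have "x \<in> sdil s A" "y \<in> sdil t A" using st e by (auto simp: gauge_le_iff[symmetric] s_def t_def)
  then have "(1 / s) *\<^sub>R x \<in> A" "(1 / t) *\<^sub>R y \<in> A" using st by (auto simp: mem_sdil_iff)
  then have "(s / (s + t)) *\<^sub>R ((1 / s) *\<^sub>R x) + (t / (s + t)) *\<^sub>R ((1 / t) *\<^sub>R y) \<in> A"
    using st by (intro convexD[OF convex_A]) (auto simp: add_divide_distrib[symmetric])
  then have "(1 / (s + t)) *\<^sub>R (x + y) \<in> A" using st by (simp add: scaleR_add_right)
  then have "minkowski_gauge A (x + y) \<le> s + t" using st by (simp add: gauge_le_iff mem_sdil_iff)
  then show "minkowski_gauge A (x + y) \<le> minkowski_gauge A x + minkowski_gauge A y + e"
    by (simp add: s_def t_def)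
qed

lemma gauge_zero: "minkowski_gauge A 0 = 0"
  using gauge_scaleR[of 2 0] by simp

lemma gauge_pos:
  assumes "x \<noteq> 0"
  shows "minkowski_gauge A x > 0"
proof (rule ccontr)
  assume "\<not> minkowski_gauge A x > 0"
  then have small: "minkowski_gauge A x \<le> t" if "t > 0" for t using that by simp
  obtain R where R: "R > 0" "\<And>y. y \<in> A \<Longrightarrow> norm y \<le> R" using A_bounded by (auto simp: bounded_pos)
  have "(2 * R / norm x) *\<^sub>R x \<in> A"
    using small[of "norm x / (2 * R)"] assms R(1) by (simp add: gauge_le_iff mem_sdil_iff)
  from R(2)[OF this] show False using assms R(1) by simp
qed

lemma gauge_le_norm:
  assumes "r > 0" "cball 0 r \<subseteq> A"
  shows "minkowski_gauge A x \<le> norm x / r"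
proof (rule gauge_leI)
  fix t :: real assume t: "t > 0" "norm x / r \<le> t"
  have "norm x \<le> r * t" using t assms(1) by (simp add: pos_divide_le_eq mult.commute)
  then have "norm ((1 / t) *\<^sub>R x) \<le> r" using t(1) by (simp add: pos_divide_le_eq)
  then show "x \<in> sdil t A" using t assms(2) by (auto simp: mem_sdil_iff)
qed (use assms in auto)

lemma convex_gauge: "convex_on UNIV (minkowski_gauge A)"
proof (rule convex_onI)
  fix t x y assume t: "(0::real) < t" "t < 1"
  have "minkowski_gauge A ((1 - t) *\<^sub>R x + t *\<^sub>R y)
      \<le> minkowski_gauge A ((1 - t) *\<^sub>R x) + minkowski_gauge A (t *\<^sub>R y)"
    by (rule gauge_add)
  then show "minkowski_gauge A ((1 - t) *\<^sub>R x + t *\<^sub>R y)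
      \<le> (1 - t) * minkowski_gauge A x + t * minkowski_gauge A y"
    using t by (simp add: gauge_scaleR)
qed auto

lemmas gauge_measurable [measurable] = borel_measurable_convex[OF convex_gauge]
lemmas gauge_gradient_measurable [measurable] = gradient_measurable[OF convex_gauge]

lemma tent_measurable [measurable]: "tent A \<in> borel_measurable borel"
  unfolding tent_def[abs_def] by measurable

lemma subgradient_inner_le:
  assumes "subgradient (minkowski_gauge A) x \<xi>"
  shows "\<xi> \<bullet> z \<le> minkowski_gauge A z"
  using assms gauge_add[of x z] unfolding subgradient_def by (meson add_le_cancel_left order_trans)

lemma subgradient_inner_self:
  assumes "subgradient (minkowski_gauge A) x \<xi>"
  shows "\<xi> \<bullet> x = minkowski_gauge A x"
proof (rule antisym)
  show "\<xi> \<bullet> x \<le> minkowski_gauge A x" by (rule subgradient_inner_le[OF assms])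
  show "minkowski_gauge A x \<le> \<xi> \<bullet> x"
    using assms[unfolded subgradient_def, rule_format, of "- x"] by (simp add: gauge_zero)
qed

lemma subgradient_norm_le:
  assumes "subgradient (minkowski_gauge A) x \<xi>" "r > 0" "cball 0 r \<subseteq> A"
  shows "norm \<xi> \<le> 1 / r"
proof (cases "\<xi> = 0")
  case False
  have "norm \<xi> * norm \<xi> = \<xi> \<bullet> \<xi>" by (simp add: dot_square_norm power2_eq_square)
  also have "\<dots> \<le> norm \<xi> / r"
    using subgradient_inner_le[OF assms(1)] gauge_le_norm[OF assms(2,3)] by (rule order_trans)
  finally have "norm \<xi> * norm \<xi> \<le> norm \<xi> * (1 / r)" by simp
  then show ?thesis using False by (simp only: mult_le_cancel_left_pos zero_less_norm_iff not_False_eq_True)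
qed (use assms in auto)

lemma gauge_antimono:
  assumes "convex_body_origin B" "A \<subseteq> B"
  shows "minkowski_gauge B x \<le> minkowski_gauge A x"
proof -
  interpret B: convex_body_origin B by fact
  have "sdil t A \<subseteq> sdil t B" for t using assms(2) by (auto simp: sdil_def)
  then show ?thesis by (intro B.gauge_leI gauge_nonneg) (auto simp: gauge_le_iff)
qed

lemma tent_mono: "convex_body_origin B \<Longrightarrow> A \<subseteq> B \<Longrightarrow> tent A x \<le> tent B x"
  using gauge_antimono[of B x] by (auto simp: tent_def)

lemma subset_msum: "0 \<in> C \<Longrightarrow> A \<subseteq> msum A (sdil h C)"
  by (force simp: msum_def sdil_def)

lemma convex_body_origin_msum:
  assumes "compact C" "convex C" "0 \<in> C"
  shows "convex_body_origin (msum A (sdil h C))"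
proof
  show "compact (msum A (sdil h C))" "convex (msum A (sdil h C))"
    using assms compact_A convex_A by (auto intro: compact_msum compact_sdil convex_msum convex_sdil)
  show "0 \<in> interior (msum A (sdil h C))"
    using zero_interior interior_mono[OF subset_msum[OF assms(3)]] by blast
qed

lemma gauge_msum_le:
  assumes "compact C" "convex C" "0 \<in> C"
  shows "minkowski_gauge (msum A (sdil h C)) x \<le> minkowski_gauge A x"
  using assms by (intro gauge_antimono convex_body_origin_msum subset_msum)

text \<open>Moving \<open>x\<close> along \<open>- v\<close> by \<open>\<tau>\<close> is absorbed by the summand \<open>h C\<close> of every dilate by at least \<open>\<tau> / h\<close>.\<close>

lemma gauge_msum_le_max:
  assumes C: "compact C" "convex C" "0 \<in> C" and "v \<in> C" and "h > 0" "\<tau> \<ge> 0"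
  shows "minkowski_gauge (msum A (sdil h C)) x \<le> max (minkowski_gauge A (x - \<tau> *\<^sub>R v)) (\<tau> / h)"
proof -
  interpret S: convex_body_origin "msum A (sdil h C)" using C by (rule convex_body_origin_msum)
  show ?thesis
  proof (rule S.gauge_leI)
    fix t :: real assume t: "t > 0" "max (minkowski_gauge A (x - \<tau> *\<^sub>R v)) (\<tau> / h) \<le> t"
    then have "(1 / t) *\<^sub>R (x - \<tau> *\<^sub>R v) \<in> A" by (simp add: gauge_le_iff mem_sdil_iff)
    moreover have "(\<tau> / (t * h)) *\<^sub>R v \<in> C"
      using convexD_alt[OF C(2,3) \<open>v \<in> C\<close>, of "\<tau> / (t * h)"] t assms by (simp add: divide_le_eq)
    moreover have "(1 / t) *\<^sub>R x = (1 / t) *\<^sub>R (x - \<tau> *\<^sub>R v) + h *\<^sub>R ((\<tau> / (t * h)) *\<^sub>R v)"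
      using \<open>h > 0\<close> t by (simp add: scaleR_diff_right)
    ultimately have "(1 / t) *\<^sub>R x \<in> msum A (sdil h C)" unfolding msum_def sdil_def by blast
    then show "x \<in> sdil t (msum A (sdil h C))" using t by (simp add: mem_sdil_iff)
  qed (use assms gauge_nonneg in \<open>auto simp: le_max_iff_disj\<close>)
qed

lemma gauge_decrement_ge:
  fixes M h :: real and x :: 'a
  defines "\<tau> \<equiv> h * (minkowski_gauge A x - M * h)"
  assumes C: "compact C" "convex C" "0 \<in> C" and "v \<in> C" and h: "h > 0" "M * h < minkowski_gauge A x"
  shows "min ((minkowski_gauge A x - minkowski_gauge A (x - \<tau> *\<^sub>R v)) / \<tau> * (minkowski_gauge A x - M * h)) M
    \<le> (minkowski_gauge A x - minkowski_gauge (msum A (sdil h C)) x) / h"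
proof -
  let ?\<phi> = "minkowski_gauge A" and ?\<psi> = "minkowski_gauge (msum A (sdil h C))"
  have "?\<psi> x \<le> max (?\<phi> (x - \<tau> *\<^sub>R v)) (\<tau> / h)"
    using C \<open>v \<in> C\<close> h by (intro gauge_msum_le_max) (auto simp: \<tau>_def)
  then have "min (?\<phi> x - ?\<phi> (x - \<tau> *\<^sub>R v)) (?\<phi> x - \<tau> / h) / h \<le> (?\<phi> x - ?\<psi> x) / h"
    using h by (intro divide_right_mono) auto
  then have "min ((?\<phi> x - ?\<phi> (x - \<tau> *\<^sub>R v)) / h) ((?\<phi> x - \<tau> / h) / h) \<le> (?\<phi> x - ?\<psi> x) / h"
    using h by (simp add: min_divide_distrib_right)
  moreover have "(?\<phi> x - ?\<phi> (x - \<tau> *\<^sub>R v)) / h = (?\<phi> x - ?\<phi> (x - \<tau> *\<^sub>R v)) / \<tau> * (?\<phi> x - M * h)"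
    "(?\<phi> x - \<tau> / h) / h = M"
    using h by (simp_all add: \<tau>_def)
  ultimately show ?thesis by simp
qed

text \<open>Any \<open>M\<close> larger than the claimed limit makes the minimum above tend to that limit.\<close>

lemma le_Liminf_gauge_decrement:
  assumes C: "compact C" "convex C" "0 \<in> C" and "v \<in> C" and "x \<noteq> 0"
    and deriv: "((\<lambda>s. minkowski_gauge A (x + s *\<^sub>R v)) has_real_derivative b) (at 0)"
  shows "ennreal (minkowski_gauge A x * b)
    \<le> Liminf (at_right 0) (\<lambda>h. ennreal ((minkowski_gauge A x - minkowski_gauge (msum A (sdil h C)) x) / h))"
proof -
  let ?\<phi> = "minkowski_gauge A" and ?\<psi> = "\<lambda>h. minkowski_gauge (msum A (sdil h C)) x"
  define M where "M = ?\<phi> x * b + 1"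
  define \<tau> where "\<tau> h = h * (?\<phi> x - M * h)" for h
  let ?q = "\<lambda>h. (?\<phi> x - ?\<phi> (x - \<tau> h *\<^sub>R v)) / \<tau> h"
  have factor: "((\<lambda>h. ?\<phi> x - M * h) \<longlongrightarrow> ?\<phi> x) (at_right 0)"
    by (auto intro!: tendsto_eq_intros)
  then have factor_pos: "\<forall>\<^sub>F h in at_right 0. 0 < ?\<phi> x - M * h"
    using gauge_pos[OF \<open>x \<noteq> 0\<close>] by (rule order_tendstoD)
  have h_pos: "\<forall>\<^sub>F h in at_right (0::real). 0 < h" by (rule eventually_at_right_less)
  have "\<forall>\<^sub>F h in at_right 0. - \<tau> h \<in> UNIV \<and> - \<tau> h \<noteq> 0"
    using factor_pos h_pos by eventually_elim (simp add: \<tau>_def)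
  moreover have "((\<lambda>h. - \<tau> h) \<longlongrightarrow> 0) (at_right 0)"
    unfolding \<tau>_def by (auto intro!: tendsto_eq_intros)
  ultimately have "filterlim (\<lambda>h. - \<tau> h) (at 0) (at_right 0)" unfolding filterlim_at by blast
  moreover have "((\<lambda>s. (?\<phi> (x + s *\<^sub>R v) - ?\<phi> x) / s) \<longlongrightarrow> b) (at 0)"
    using deriv by (simp add: DERIV_def)
  ultimately have "((\<lambda>h. (?\<phi> (x + - \<tau> h *\<^sub>R v) - ?\<phi> x) / - \<tau> h) \<longlongrightarrow> b) (at_right 0)"
    by (rule filterlim_compose[rotated])
  then have "(?q \<longlongrightarrow> b) (at_right 0)" by (simp add: minus_divide_left)
  then have "((\<lambda>h. min (?q h * (?\<phi> x - M * h)) M) \<longlongrightarrow> min (b * ?\<phi> x) M) (at_right 0)"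
    by (intro tendsto_min tendsto_mult factor tendsto_const)
  then have "((\<lambda>h. ennreal (min (?q h * (?\<phi> x - M * h)) M)) \<longlongrightarrow> ennreal (?\<phi> x * b)) (at_right 0)"
    by (intro tendsto_ennrealI) (simp add: M_def mult.commute)
  then have "ennreal (?\<phi> x * b) = Liminf (at_right 0) (\<lambda>h. ennreal (min (?q h * (?\<phi> x - M * h)) M))"
    by (intro lim_imp_Liminf[symmetric] trivial_limit_at_right_real)
  also have "\<dots> \<le> Liminf (at_right 0) (\<lambda>h. ennreal ((?\<phi> x - ?\<psi> h) / h))"
    by (rule Liminf_mono, use factor_pos h_pos in eventually_elim)
       (use gauge_decrement_ge[OF C \<open>v \<in> C\<close>] in \<open>simp add: \<tau>_def ennreal_leI\<close>)
  finally show ?thesis .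
qed

lemma AE_le_Liminf_gauge_decrement:
  fixes \<theta> :: 'a
  defines "C \<equiv> closed_segment (- \<theta>) \<theta>"
  shows "AE x in lborel. ennreal (minkowski_gauge A x * \<bar>gradient (minkowski_gauge A) x \<bullet> \<theta>\<bar>)
    \<le> Liminf (at_right 0) (\<lambda>h. ennreal ((minkowski_gauge A x - minkowski_gauge (msum A (sdil h C)) x) / h))"
proof -
  have C: "compact C" "convex C" "0 \<in> C" "\<theta> \<in> C" "- \<theta> \<in> C"
    by (simp_all add: C_def zero_in_symmetric_segment)
  show ?thesis
    using AE_has_directional_derivative_gradient[OF convex_gauge, of \<theta>]
      AE_has_directional_derivative_gradient[OF convex_gauge, of "- \<theta>"] AE_lborel_singleton[of "0::'a"]
  proof eventually_elim
    case (elim x)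
    then show ?case
      using le_Liminf_gauge_decrement[OF C(1-3) C(4) elim(3,1)]
        le_Liminf_gauge_decrement[OF C(1-3) C(5) elim(3,2)]
      by (cases "gradient (minkowski_gauge A) x \<bullet> \<theta> \<ge> 0") (simp_all add: abs_if)
  qed
qed

lemma gauge_le_gauge_msum_ball:
  assumes sub: "subgradient (minkowski_gauge A) x \<xi>" and \<eta>: "\<eta> > 0"
  shows "minkowski_gauge A x \<le> minkowski_gauge (msum A (sdil \<eta> (cball 0 1))) x * (1 + \<eta> * norm \<xi>)"
proof -
  interpret S: convex_body_origin "msum A (sdil \<eta> (cball 0 1))" by (intro convex_body_origin_msum) auto
  show ?thesis
  proof (cases "x = 0")
    case False
    define t where "t = minkowski_gauge (msum A (sdil \<eta> (cball 0 1))) x"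
    have t: "t > 0" unfolding t_def by (rule S.gauge_pos[OF False])
    then have "x \<in> sdil t (msum A (sdil \<eta> (cball 0 1)))" using S.gauge_le_iff[of t x] by (simp add: t_def)
    then obtain k b where kb: "k \<in> A" "norm b \<le> 1" "x = t *\<^sub>R (k + \<eta> *\<^sub>R b)"
      by (auto simp: sdil_def msum_def)
    have "minkowski_gauge A x = t * (\<xi> \<bullet> k + \<eta> * (\<xi> \<bullet> b))"
      unfolding subgradient_inner_self[OF sub, symmetric] by (simp add: kb(3) inner_simps)
    also have "\<dots> \<le> t * (1 + \<eta> * norm \<xi>)"
    proof (intro mult_left_mono add_mono)
      show "\<xi> \<bullet> k \<le> 1" using subgradient_inner_le[OF sub, of k] kb(1) by (simp add: mem_iff_gauge)
      have "\<xi> \<bullet> b \<le> norm \<xi> * norm b" by (rule norm_cauchy_schwarz)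
      also have "\<dots> \<le> norm \<xi> * 1" using kb by (intro mult_left_mono) auto
      finally show "\<xi> \<bullet> b \<le> norm \<xi>" by simp
    qed (use t \<eta> in auto)
    finally show ?thesis by (simp add: t_def)
  qed (simp add: gauge_zero S.gauge_zero)
qed

lemma msum_ball_subset:
  assumes "r > 0" "cball 0 r \<subseteq> A" "\<eta> > 0"
  shows "msum A (sdil \<eta> (cball 0 1)) \<subseteq> sdil (1 + \<eta> / r) A"
proof
  fix x assume "x \<in> msum A (sdil \<eta> (cball 0 1))"
  then obtain k b where kb: "k \<in> A" "norm b \<le> 1" "x = k + \<eta> *\<^sub>R b" by (auto simp: sdil_def msum_def)
  have "minkowski_gauge A x \<le> minkowski_gauge A k + minkowski_gauge A (\<eta> *\<^sub>R b)"
    unfolding kb(3) by (rule gauge_add)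
  also have "\<dots> \<le> 1 + norm (\<eta> *\<^sub>R b) / r"
    using kb(1) by (intro add_mono gauge_le_norm[OF assms(1,2)]) (simp add: mem_iff_gauge)
  also have "\<dots> \<le> 1 + \<eta> / r" using kb(2) assms by (simp add: divide_right_mono mult_left_le)
  finally show "x \<in> sdil (1 + \<eta> / r) A"
    using assms by (subst gauge_le_iff[symmetric]) (auto intro: add_pos_pos)
qed

lemma tent_msum_ball_le:
  assumes r: "r > 0" "cball 0 r \<subseteq> A" and \<eta>: "\<eta> > 0" and sub: "subgradient (minkowski_gauge A) x \<xi>"
  shows "tent (msum A (sdil \<eta> (cball 0 1))) x - tent A x
    \<le> \<eta> * (minkowski_gauge A x * norm \<xi>) * indicator (sdil (1 + \<eta> / r) A) x"
proof -
  let ?S = "msum A (sdil \<eta> (cball 0 1))"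
  interpret S: convex_body_origin ?S by (intro convex_body_origin_msum) auto
  show ?thesis
  proof (cases "x \<in> ?S")
    case True
    then have "x \<in> sdil (1 + \<eta> / r) A" using msum_ball_subset[OF r \<eta>] by auto
    have "minkowski_gauge ?S x \<le> minkowski_gauge A x" by (intro gauge_msum_le) auto
    then have "minkowski_gauge ?S x * (\<eta> * norm \<xi>) \<le> minkowski_gauge A x * (\<eta> * norm \<xi>)"
      using \<eta> by (intro mult_right_mono) auto
    then have "minkowski_gauge A x - minkowski_gauge ?S x \<le> \<eta> * (minkowski_gauge A x * norm \<xi>)"
      using gauge_le_gauge_msum_ball[OF sub \<eta>] by (simp add: algebra_simps)
    then show ?thesis
      using True \<open>x \<in> sdil (1 + \<eta> / r) A\<close> by (simp add: tent_def S.mem_iff_gauge max_def)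
  next
    case False
    then have "tent ?S x = 0" by (simp add: tent_def S.mem_iff_gauge)
    moreover have "0 \<le> \<eta> * (minkowski_gauge A x * norm \<xi>) * indicator (sdil (1 + \<eta> / r) A) x"
      using \<eta> gauge_nonneg by simp
    ultimately show ?thesis using tent_nonneg[of A x] by linarith
  qed
qed

end

section \<open>Lower bounds for mixed measures\<close>

lemma (in homogeneous_density) ennreal_mu_tent:
  assumes "convex_body_origin A"
  shows "ennreal (mu g A) = ennreal (hom_deg + 1) * (\<integral>\<^sup>+x. ennreal (g x) * ennreal (tent A x) \<partial>lborel)"
proof -
  interpret A: convex_body_origin A by fact
  interpret homogeneous_function_on_star_set "\<lambda>x. ennreal (g x)" "1 / p" hom_deg A "minkowski_gauge A"
    using hom_deg_gt_1 A.sdil_eq_gauge A.gauge_pos nn_integral_g_finite[OF A.A_bounded]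
    by unfold_locales (auto simp: g_scaleR ennreal_mult' hom_deg_def)
  let ?I = "\<integral>\<^sup>+x\<in>A. g x \<partial>lborel"
  have "(\<integral>\<^sup>+x. ennreal (g x) * ennreal (tent A x) \<partial>lborel)
      = (\<integral>\<^sup>+x\<in>A. ennreal (g x) * ennreal (1 - minkowski_gauge A x powr 1) \<partial>lborel)"
    by (intro nn_integral_cong) (simp add: tent_def indicator_def A.mem_iff_gauge A.gauge_nonneg)
  also have "\<dots> = ?I * ennreal (1 / (hom_deg + 1))"
    by (rule nn_integral_mult_one_minus_powr) simp
  finally have "ennreal (hom_deg + 1) * (\<integral>\<^sup>+x. ennreal (g x) * ennreal (tent A x) \<partial>lborel)
      = ?I * (ennreal (1 / (hom_deg + 1)) * ennreal (hom_deg + 1))"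
    by (simp add: ac_simps)
  also have "ennreal (1 / (hom_deg + 1)) * ennreal (hom_deg + 1) = 1"
    using hom_deg_gt_1 by (subst ennreal_mult''[symmetric]) auto
  finally show ?thesis using ennreal_mu[OF A.A_borel A.A_bounded] by simp
qed

locale measure_and_body = homogeneous_density g p + convex_body_origin K
  for g :: "'a::euclidean_space \<Rightarrow> real" and p :: real and K :: "'a set"
begin

abbreviation \<phi> :: "'a \<Rightarrow> real" where "\<phi> \<equiv> minkowski_gauge K"

abbreviation \<xi> :: "'a \<Rightarrow> 'a" where "\<xi> \<equiv> gradient (minkowski_gauge K)"

lemma mu_increment_tent:
  assumes A: "convex_body_origin A" "K \<subseteq> A"
  shows "ennreal (mu g A - mu g K)
    = ennreal (hom_deg + 1) * (\<integral>\<^sup>+x. ennreal (g x) * ennreal (tent A x - tent K x) \<partial>lborel)"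
proof -
  interpret A: convex_body_origin A by fact
  have "ennreal (tent A x) = ennreal (tent K x) + ennreal (tent A x - tent K x)" for x
    using tent_mono[OF A] by (subst ennreal_plus[symmetric]) (auto simp: tent_nonneg)
  then have "ennreal (mu g A) = ennreal (mu g K)
      + ennreal (hom_deg + 1) * (\<integral>\<^sup>+x. ennreal (g x) * ennreal (tent A x - tent K x) \<partial>lborel)"
    unfolding ennreal_mu_tent[OF A(1)] ennreal_mu_tent[OF convex_body_origin_axioms]
    by (simp add: distrib_left nn_integral_add)
  then show ?thesis by (simp add: ennreal_minus[symmetric] mu_nonneg ennreal_add_diff_cancel_left)
qed

lemma mu_increment_quotient_ge:
  assumes A: "convex_body_origin A" "K \<subseteq> A" and "h > 0"
  shows "ennreal (hom_deg + 1) * (\<integral>\<^sup>+x\<in>K. ennreal (g x) * ennreal ((\<phi> x - minkowski_gauge A x) / h) \<partial>lborel)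
    \<le> ennreal ((mu g A - mu g K) / h)"
proof -
  interpret A: convex_body_origin A by fact
  have "ennreal (g x) * ennreal ((\<phi> x - minkowski_gauge A x) / h) * indicator K x
      \<le> ennreal (1 / h) * (ennreal (g x) * ennreal (tent A x - tent K x))" for x
  proof (cases "x \<in> K")
    case True
    then have "tent A x - tent K x = \<phi> x - minkowski_gauge A x"
      using gauge_antimono[OF A, of x] by (simp add: tent_def mem_iff_gauge)
    then show ?thesis
      using True \<open>h > 0\<close> by (simp add: mult.left_commute[of "ennreal (1 / h)"] flip: ennreal_mult')
  qed simp
  then have "ennreal (hom_deg + 1) * (\<integral>\<^sup>+x\<in>K. ennreal (g x) * ennreal ((\<phi> x - minkowski_gauge A x) / h) \<partial>lborel)
      \<le> ennreal (hom_deg + 1)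
        * (\<integral>\<^sup>+x. ennreal (1 / h) * (ennreal (g x) * ennreal (tent A x - tent K x)) \<partial>lborel)"
    by (intro mult_left_mono nn_integral_mono) auto
  also have "\<dots> = ennreal (1 / h) * ennreal (mu g A - mu g K)"
    unfolding mu_increment_tent[OF A] by (subst nn_integral_cmult) (simp_all only: ac_simps, measurable)
  also have "\<dots> = ennreal ((mu g A - mu g K) / h)" using \<open>h > 0\<close> by (simp flip: ennreal_mult')
  finally show ?thesis .
qed

definition gradient_mass :: "'a set \<Rightarrow> ennreal" where
  "gradient_mass S = (\<integral>\<^sup>+x\<in>S. ennreal (g x * (\<phi> x * norm (\<xi> x))) \<partial>lborel)"

definition directional_mass :: "'a \<Rightarrow> ennreal" where
  "directional_mass \<theta> = (\<integral>\<^sup>+x\<in>K. ennreal (g x * (\<phi> x * \<bar>\<xi> x \<bullet> \<theta>\<bar>)) \<partial>lborel)"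

lemma mu_ball_increment_le:
  assumes \<eta>: "\<eta> > 0" and r: "r > 0" "cball 0 r \<subseteq> K"
  shows "ennreal (mu g (msum K (sdil \<eta> (cball 0 1))) - mu g K)
    \<le> ennreal (\<eta> * (hom_deg + 1)) * gradient_mass (sdil (1 + \<eta> / r) K)"
proof -
  let ?A = "msum K (sdil \<eta> (cball 0 1))" and ?S = "sdil (1 + \<eta> / r) K"
  have A: "convex_body_origin ?A" by (intro convex_body_origin_msum) auto
  have "1 + \<eta> / r > 0" using \<eta> r by (simp add: add_pos_pos)
  then have [measurable]: "?S \<in> sets borel" by (intro sets_sdil) auto
  have "AE x in lborel. ennreal (g x) * ennreal (tent ?A x - tent K x)
      \<le> ennreal \<eta> * (ennreal (g x * (\<phi> x * norm (\<xi> x))) * indicator ?S x)"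
    using AE_subgradient_gradient[OF convex_gauge]
  proof eventually_elim
    case (elim x)
    have "g x * (tent ?A x - tent K x) \<le> g x * (\<eta> * (\<phi> x * norm (\<xi> x)) * indicator ?S x)"
      using tent_msum_ball_le[OF r \<eta> elim] by (intro mult_left_mono g_nonneg)
    then have "ennreal (g x * (tent ?A x - tent K x))
        \<le> ennreal (\<eta> * (g x * (\<phi> x * norm (\<xi> x))) * indicator ?S x)"
      by (intro ennreal_leI) (simp add: mult_ac)
    then show ?case
      using \<eta> g_nonneg by (simp add: ennreal_mult' ennreal_mult'' ennreal_indicator mult.assoc)
  qed
  then have "(\<integral>\<^sup>+x. ennreal (g x) * ennreal (tent ?A x - tent K x) \<partial>lborel) \<le> ennreal \<eta> * gradient_mass ?S"
    unfolding gradient_mass_def by (subst nn_integral_cmult[symmetric]) (auto intro: nn_integral_mono_AE)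
  then have "ennreal (hom_deg + 1) * (\<integral>\<^sup>+x. ennreal (g x) * ennreal (tent ?A x - tent K x) \<partial>lborel)
      \<le> ennreal (hom_deg + 1) * (ennreal \<eta> * gradient_mass ?S)"
    by (rule mult_left_mono) simp
  then show ?thesis
    using mu_increment_tent[OF A subset_msum] \<eta> by (simp add: ennreal_mult' mult_ac)
qed

lemma gradient_mass_finite:
  assumes "bounded S"
  shows "gradient_mass S < \<infinity>"
proof -
  obtain r where r: "r > 0" "cball 0 r \<subseteq> K" by (rule inner_ball)
  obtain R where R: "\<And>x. x \<in> S \<Longrightarrow> norm x \<le> R" "R > 0" using assms by (auto simp: bounded_pos)
  have "gradient_mass S \<le> (\<integral>\<^sup>+x\<in>cball 0 R. ennreal (R / r * (1 / r)) * ennreal (g x) \<partial>lborel)"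
    unfolding gradient_mass_def
  proof (intro nn_integral_mono_AE, use AE_subgradient_gradient[OF convex_gauge] in eventually_elim)
    case (elim x)
    show ?case
    proof (cases "x \<in> S")
      case True
      have "\<phi> x \<le> R / r"
        using gauge_le_norm[OF r, of x] R(1)[OF True] r(1)
        by (meson divide_right_mono less_imp_le order_trans)
      then have "\<phi> x * norm (\<xi> x) \<le> R / r * (1 / r)"
        using subgradient_norm_le[OF elim r] R r gauge_nonneg by (intro mult_mono) auto
      then have "\<phi> x * norm (\<xi> x) * g x \<le> R / r * (1 / r) * g x"
        by (intro mult_right_mono g_nonneg)
      then have "ennreal (g x * (\<phi> x * norm (\<xi> x))) \<le> ennreal (R / r * (1 / r) * g x)"
        by (intro ennreal_leI) (simp only: mult.commute[of "g x"])
      also have "\<dots> = ennreal (R / r * (1 / r)) * ennreal (g x)"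
        by (rule ennreal_mult''[OF g_nonneg])
      finally show ?thesis using True R(1) by simp
    qed simp
  qed
  also have "\<dots> = ennreal (R / r * (1 / r)) * (\<integral>\<^sup>+x\<in>cball 0 R. g x \<partial>lborel)"
    by (simp add: nn_integral_cmult mult.assoc)
  also have "\<dots> < \<infinity>"
    using nn_integral_g_finite[OF bounded_cball] by (simp add: ennreal_mult_less_top)
  finally show ?thesis .
qed

lemma gradient_mass_le_if_dilates:
  assumes "\<And>s. s > 1 \<Longrightarrow> c \<le> gradient_mass (sdil s K)"
  shows "c \<le> gradient_mass K"
proof -
  let ?M = "density lborel (\<lambda>x. ennreal (g x * (\<phi> x * norm (\<xi> x))))"
  define s where "s k = 1 + 1 / real (Suc k)" for k
  have s: "s k > 1" for k by (simp add: s_def)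
  have mass: "gradient_mass S = emeasure ?M S" if "S \<in> sets borel" for S
    using that by (simp add: gradient_mass_def emeasure_density)
  have levels: "sdil (s k) K = {x. \<phi> x \<le> s k}" for k using s[of k] by (intro sdil_eq_gauge) simp
  have [measurable]: "sdil (s k) K \<in> sets borel" for k using s[of k] by (intro sets_sdil) auto
  have "s \<longlonglongrightarrow> 1 + 0"
    unfolding s_def
    using LIMSEQ_inverse_real_of_nat by (intro tendsto_add tendsto_const) (simp add: inverse_eq_divide)
  then have "\<phi> x \<le> 1" if "\<And>k. \<phi> x \<le> s k" for x using that by (intro LIMSEQ_le_const) auto
  moreover have "\<phi> x \<le> s k" if "\<phi> x \<le> 1" for x k using that s[of k] by simp
  ultimately have "(\<Inter>k. sdil (s k) K) = K" by (auto simp: levels mem_iff_gauge)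
  moreover have "(INF k. emeasure ?M (sdil (s k) K)) = emeasure ?M (\<Inter>k. sdil (s k) K)"
  proof (rule INF_emeasure_decseq)
    have "s (Suc k) \<le> s k" for k unfolding s_def by (intro add_left_mono frac_le) auto
    then show "decseq (\<lambda>k. sdil (s k) K)"
      unfolding levels by (intro decseq_SucI) (auto intro: order_trans)
    show "emeasure ?M (sdil (s k) K) \<noteq> \<infinity>" for k
      using gradient_mass_finite[OF bounded_sdil[OF A_bounded], of "s k"] mass[of "sdil (s k) K"] by simp
  qed auto
  moreover have "c \<le> (INF k. emeasure ?M (sdil (s k) K))"
    using assms s by (intro INF_greatest) (simp flip: mass)
  ultimately show ?thesis using mass[OF A_borel] by simp
qed

lemma gradient_mass_lower:
  assumes ball: "mu g (cball 0 1) > 0" and "mu g K > 0"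
  shows "ennreal (hom_deg / (hom_deg + 1) * mixed_mean K (cball 0 1)) \<le> gradient_mass K"
proof (rule gradient_mass_le_if_dilates)
  obtain r where r: "r > 0" "cball 0 r \<subseteq> K" by (rule inner_ball)
  fix s :: real assume "s > 1"
  define \<eta> where "\<eta> = (s - 1) * r"
  have \<eta>: "\<eta> > 0" "1 + \<eta> / r = s" using \<open>s > 1\<close> r by (auto simp: \<eta>_def)
  have "ennreal (\<eta> * hom_deg * mixed_mean K (cball 0 1))
      \<le> ennreal (mu g (msum K (sdil \<eta> (cball 0 1))) - mu g K)"
    using assms \<eta> by (intro ennreal_leI mu_minkowski_first compact_A) auto
  also have "\<dots> \<le> ennreal (\<eta> * (hom_deg + 1)) * gradient_mass (sdil s K)"
    using mu_ball_increment_le[OF \<eta>(1) r] \<eta>(2) by simp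
  finally have "ennreal (1 / (\<eta> * (hom_deg + 1))) * ennreal (\<eta> * hom_deg * mixed_mean K (cball 0 1))
      \<le> ennreal (1 / (\<eta> * (hom_deg + 1))) * (ennreal (\<eta> * (hom_deg + 1)) * gradient_mass (sdil s K))"
    by (rule mult_left_mono) simp
  then show "ennreal (hom_deg / (hom_deg + 1) * mixed_mean K (cball 0 1)) \<le> gradient_mass (sdil s K)"
    using \<eta>(1) hom_deg_gt_1 by (simp add: mult.assoc[symmetric] flip: ennreal_mult')
qed

lemma mixed_mu_sdil:
  assumes "t > 0" and C: "compact C"
  shows "mixed_mu g (sdil t K) C = ennreal (t powr (hom_deg - 1)) * mixed_mu g K C"
proof -
  let ?F = "\<lambda>A h. ennreal ((mu g (msum A (sdil h C)) - mu g A) / h)"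
  have "?F (sdil t K) (t * h) = ennreal (t powr (hom_deg - 1)) * ?F K h" for h
  proof -
    have "msum (sdil t K) (sdil (t * h) C) = sdil t (msum K (sdil h C))" by (simp add: sdil_msum sdil_sdil)
    moreover have "msum K (sdil h C) \<in> sets borel"
      using compact_A C by (intro borel_compact compact_msum compact_sdil)
    ultimately have "(mu g (msum (sdil t K) (sdil (t * h) C)) - mu g (sdil t K)) / (t * h)
        = t powr (hom_deg - 1) * ((mu g (msum K (sdil h C)) - mu g K) / h)"
      using \<open>t > 0\<close> by (simp add: mu_sdil powr_diff flip: right_diff_distrib)
    then show ?thesis by (simp only: ennreal_mult' powr_ge_zero)
  qed
  then have "Liminf (at_right 0) (\<lambda>h. ?F (sdil t K) (t * h))
      = ennreal (t powr (hom_deg - 1)) * mixed_mu g K C"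
    unfolding mixed_mu_def by (simp add: Liminf_ennreal_cmult)
  then show ?thesis
    unfolding mixed_mu_def using Liminf_at_right_0_scale[OF \<open>t > 0\<close>, of "?F (sdil t K)"] by simp
qed

lemma mixed_mu_segment_lower:
  "ennreal (hom_deg + 1) * directional_mass \<theta> \<le> mixed_mu g K (closed_segment (- \<theta>) \<theta>)"
proof -
  let ?A = "\<lambda>h. msum K (sdil h (closed_segment (- \<theta>) \<theta>))"
  let ?q = "\<lambda>h x. ennreal ((\<phi> x - minkowski_gauge (?A h) x) / h)"
  let ?u = "\<lambda>h x. ennreal (g x) * ?q h x * indicator K x"
  have A: "convex_body_origin (?A h)" "K \<subseteq> ?A h" for h
    by (simp_all add: convex_body_origin_msum zero_in_symmetric_segment subset_msum)
  note [measurable] = convex_body_origin.gauge_measurable[OF A(1)]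
  have "directional_mass \<theta> \<le> Liminf (at_right 0) (\<lambda>h. \<integral>\<^sup>+x. ?u h x \<partial>lborel)"
    unfolding directional_mass_def
  proof (rule fatou_at_within)
    show "AE x in lborel. ennreal (g x * (\<phi> x * \<bar>\<xi> x \<bullet> \<theta>\<bar>)) * indicator K x
        \<le> Liminf (at_right 0) (\<lambda>h. ?u h x)"
      using AE_le_Liminf_gauge_decrement[of \<theta>]
    proof eventually_elim
      case (elim x)
      have "ennreal (g x) * indicator K x * ennreal (\<phi> x * \<bar>\<xi> x \<bullet> \<theta>\<bar>)
          \<le> ennreal (g x) * indicator K x * Liminf (at_right 0) (\<lambda>h. ?q h x)"
        by (intro mult_left_mono elim) simp
      also have "\<dots> = Liminf (at_right 0) (\<lambda>h. ennreal (g x) * indicator K x * ?q h x)"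
        by (intro Liminf_ennreal_cmult[symmetric]) (auto simp: indicator_def)
      finally show ?case by (simp add: ennreal_mult' g_nonneg mult_ac)
    qed
  qed measurable
  then have "ennreal (hom_deg + 1) * directional_mass \<theta>
      \<le> Liminf (at_right 0) (\<lambda>h. ennreal (hom_deg + 1) * (\<integral>\<^sup>+x. ?u h x \<partial>lborel))"
    by (simp add: Liminf_ennreal_cmult mult_left_mono)
  also have "\<dots> \<le> mixed_mu g K (closed_segment (- \<theta>) \<theta>)"
    unfolding mixed_mu_def
    by (rule Liminf_mono, use eventually_at_right_less in eventually_elim) (rule mu_increment_quotient_ge[OF A])
  finally show ?thesis .
qed

lemma directional_mass_scaleR: "c > 0 \<Longrightarrow> directional_mass (c *\<^sub>R v) = ennreal c * directional_mass v"
  unfolding directional_mass_def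
  by (subst nn_integral_cmult[symmetric])
     (auto intro!: nn_integral_cong simp: abs_mult indicator_def mult_ac simp flip: ennreal_mult')

end

section \<open>The ball maximizes the integral of the inverse norm\<close>

lemma nn_integral_bathtub:
  assumes [measurable]: "w \<in> borel_measurable M" "L \<in> sets M" "C \<in> sets M"
    and mass: "emeasure M L = emeasure M C" "emeasure M C < \<infinity>" and "c < \<infinity>"
    and w: "AE x in M. x \<in> C \<longrightarrow> c \<le> w x" "AE x in M. x \<notin> C \<longrightarrow> w x \<le> c"
  shows "(\<integral>\<^sup>+x\<in>L. w x \<partial>M) \<le> (\<integral>\<^sup>+x\<in>C. w x \<partial>M)"
proof -
  have "(\<integral>\<^sup>+x\<in>L. w x \<partial>M) + c * emeasure M C = (\<integral>\<^sup>+x. w x * indicator L x + c * indicator C x \<partial>M)"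
    by (subst nn_integral_add) (simp_all add: nn_integral_cmult)
  also have "\<dots> \<le> (\<integral>\<^sup>+x. w x * indicator C x + c * indicator L x \<partial>M)"
    using w by (intro nn_integral_mono_AE, eventually_elim) (auto simp: indicator_def add.commute)
  also have "\<dots> = (\<integral>\<^sup>+x\<in>C. w x \<partial>M) + c * emeasure M C"
    by (subst nn_integral_add) (simp_all add: nn_integral_cmult mass(1))
  finally show ?thesis
    using \<open>c < \<infinity>\<close> mass(2)
    by (auto simp: add.commute[of _ "c * _"] ennreal_add_left_cancel_le ennreal_mult_eq_top_iff)
qed

context homogeneous_density
begin

lemma nn_integral_over_norm_ball:
  assumes "r > 0"
  shows "(\<integral>\<^sup>+x\<in>cball 0 r. ennreal (g x) * ennreal (1 / norm x) \<partial>lborel)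
    = ennreal (hom_deg / (hom_deg - 1) * (mu g (cball 0 r) / r))"
proof -
  interpret homogeneous_function_on_star_set "\<lambda>x. ennreal (g x)" "1 / p" hom_deg "cball 0 r" "\<lambda>x. norm x / r"
    using \<open>r > 0\<close> hom_deg_gt_1 nn_integral_g_finite[OF bounded_cball, of 0 r]
    by unfold_locales (auto simp: g_scaleR ennreal_mult' hom_deg_def sdil_cball pos_divide_le_eq)
  have "ennreal (1 / norm x) = ennreal (1 / r) * ennreal ((norm x / r) powr - 1)" for x :: 'a
    using \<open>r > 0\<close> by (cases "x = 0") (simp_all add: powr_minus_divide flip: ennreal_mult')
  then have "(\<integral>\<^sup>+x\<in>cball 0 r. ennreal (g x) * ennreal (1 / norm x) \<partial>lborel)
      = ennreal (1 / r) * (\<integral>\<^sup>+x\<in>cball 0 r. ennreal (g x) * ennreal ((norm x / r) powr - 1) \<partial>lborel)"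
    by (subst nn_integral_cmult[symmetric]) (simp_all add: mult_ac)
  also have "\<dots> = ennreal (1 / r) * (ennreal (mu g (cball 0 r)) * ennreal (hom_deg / (hom_deg - 1)))"
    using nn_integral_mult_powr[of "- 1"] hom_deg_gt_1 by (simp add: ennreal_mu)
  finally show ?thesis
    using \<open>r > 0\<close> hom_deg_gt_1 by (simp add: mult_ac mu_nonneg flip: ennreal_mult')
qed

lemma equal_mass_ball:
  assumes A: "mu g A > 0" and ball: "mu g (cball 0 1) > 0"
  defines "r \<equiv> (mu g A / mu g (cball 0 1)) powr (1 / hom_deg)"
  shows "r > 0" "mu g (cball 0 r) = mu g A" "mu g A / r = mixed_mean A (cball 0 1)"
proof -
  show r: "r > 0" using A ball by (simp add: r_def)
  have "mu g (cball 0 r) = mu g (sdil r (cball 0 1))" using r by (simp add: sdil_cball)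
  also have "\<dots> = r powr hom_deg * mu g (cball 0 1)" using r by (intro mu_sdil) auto
  also have "r powr hom_deg = mu g A / mu g (cball 0 1)"
    using A ball hom_deg_gt_1 by (simp add: r_def powr_powr)
  finally show "mu g (cball 0 r) = mu g A" using ball by simp
  show "mu g A / r = mixed_mean A (cball 0 1)"
    using A ball by (simp add: r_def mixed_mean_def powr_divide powr_diff)
qed

lemma nn_integral_over_norm_le:
  assumes L: "compact L" and ball: "mu g (cball 0 1) > 0"
  shows "(\<integral>\<^sup>+x\<in>L. ennreal (g x) * ennreal (1 / norm x) \<partial>lborel)
    \<le> ennreal (hom_deg / (hom_deg - 1) * mixed_mean L (cball 0 1))"
proof -
  let ?M = "density lborel (\<lambda>x. ennreal (g x))"
  have [measurable]: "L \<in> sets borel" using L by (rule borel_compact)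
  have mass: "emeasure ?M A = ennreal (mu g A)" if "A \<in> sets borel" "bounded A" for A
    using that by (simp add: emeasure_density ennreal_mu)
  have integral: "(\<integral>\<^sup>+x\<in>A. ennreal (1 / norm x) \<partial>?M) = (\<integral>\<^sup>+x\<in>A. ennreal (g x) * ennreal (1 / norm x) \<partial>lborel)"
    if "A \<in> sets borel" for A
    using that by (subst nn_integral_density) (simp_all add: mult.assoc)
  show ?thesis
  proof (cases "mu g L = 0")
    case True
    then have "L \<in> null_sets ?M" using mass[of L] L by (simp add: null_sets_def compact_imp_bounded)
    then have "(\<integral>\<^sup>+x\<in>L. ennreal (1 / norm x) \<partial>?M) = 0" by (rule nn_integral_null_set)
    then show ?thesis using integral[of L] by simp
  next
    case False
    then have "mu g L > 0" using mu_nonneg[of L] by linarith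
    define r where "r = (mu g L / mu g (cball 0 1)) powr (1 / hom_deg)"
    note r = equal_mass_ball[OF \<open>mu g L > 0\<close> ball, folded r_def]
    have "AE x in ?M. x \<noteq> 0"
      using AE_lborel_singleton[of "0::'a"] by (subst AE_density) auto
    then have inner: "AE x in ?M. x \<in> cball 0 r \<longrightarrow> ennreal (1 / r) \<le> ennreal (1 / norm x)"
      using r(1) by (elim eventually_mono) (auto intro!: ennreal_leI divide_left_mono)
    have outer: "AE x in ?M. x \<notin> cball 0 r \<longrightarrow> ennreal (1 / norm x) \<le> ennreal (1 / r)"
      using r(1) by (intro AE_I2) (auto intro!: ennreal_leI divide_left_mono mult_pos_pos)
    have "(\<integral>\<^sup>+x\<in>L. ennreal (1 / norm x) \<partial>?M) \<le> (\<integral>\<^sup>+x\<in>cball 0 r. ennreal (1 / norm x) \<partial>?M)"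
      using L inner outer by (intro nn_integral_bathtub) (auto simp: mass r(2) compact_imp_bounded)
    then show ?thesis
      by (simp add: integral nn_integral_over_norm_ball[OF r(1)] r)
  qed
qed

end

section \<open>Averaging over directions\<close>

lemma (in measure_and_body) directional_mass_measurable [measurable]:
  "directional_mass \<in> borel_measurable borel"
  unfolding directional_mass_def[abs_def] by measurable

lemma (in measure_and_body) directional_mass_over_norm_square:
  "ennreal (1 / (norm v)\<^sup>2) * directional_mass v
    = (\<integral>\<^sup>+x\<in>K. ennreal (g x * \<phi> x) * ennreal (\<bar>\<xi> x \<bullet> v\<bar> / (norm v)\<^sup>2) \<partial>lborel)"
proof -
  have "ennreal (1 / (norm v)\<^sup>2) * ennreal (g x * (\<phi> x * \<bar>\<xi> x \<bullet> v\<bar>))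
      = ennreal (g x * \<phi> x) * ennreal (\<bar>\<xi> x \<bullet> v\<bar> / (norm v)\<^sup>2)" for x
    using g_nonneg gauge_nonneg by (simp add: mult.assoc flip: ennreal_mult')
  then show ?thesis
    unfolding directional_mass_def
    by (subst nn_integral_cmult[symmetric]) (simp_all add: mult.assoc[symmetric])
qed

lemma (in measure_and_body) nn_integral_unit_ball_directional_mass:
  fixes M :: "'m::euclidean_space itself"
  assumes dim: "DIM('m) + 1 = DIM('a)"
  shows "(\<integral>\<^sup>+v\<in>cball 0 1. ennreal (1 / (norm v)\<^sup>2) * directional_mass v \<partial>lborel)
    = ennreal (2 / DIM('m) * unit_ball_vol (DIM('m))) * gradient_mass K"
proof -
  let ?B = "cball (0::'a) 1" and ?c = "ennreal (2 / DIM('m) * unit_ball_vol (DIM('m)))"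
  let ?f = "\<lambda>x. ennreal (g x * \<phi> x) * indicator K x"
  let ?k = "\<lambda>x v. ennreal (\<bar>\<xi> x \<bullet> v\<bar> / (norm v)\<^sup>2) * indicator ?B v"
  have "(\<integral>\<^sup>+v\<in>?B. ennreal (1 / (norm v)\<^sup>2) * directional_mass v \<partial>lborel)
      = (\<integral>\<^sup>+v. \<integral>\<^sup>+x. ?f x * ?k x v \<partial>lborel \<partial>lborel)"
    unfolding directional_mass_over_norm_square
    by (subst nn_integral_multc[symmetric]) (simp_all add: mult_ac)
  also have "\<dots> = (\<integral>\<^sup>+x. \<integral>\<^sup>+v. ?f x * ?k x v \<partial>lborel \<partial>lborel)"
    by (rule lborel_pair.Fubini') measurable
  also have "\<dots> = (\<integral>\<^sup>+x. ?c * (ennreal (g x * (\<phi> x * norm (\<xi> x))) * indicator K x) \<partial>lborel)"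
  proof (rule nn_integral_cong)
    fix x
    have "(\<integral>\<^sup>+v. ?f x * ?k x v \<partial>lborel) = ?f x * ennreal (2 / DIM('m) * unit_ball_vol (DIM('m)) * norm (\<xi> x))"
      by (simp add: nn_integral_cmult nn_integral_unit_ball_abs_inner_over_norm_square[OF dim])
    also have "\<dots> = ?f x * (?c * ennreal (norm (\<xi> x)))"
      by (simp only: ennreal_mult''[OF norm_ge_zero])
    also have "\<dots> = ?c * ((ennreal (g x * \<phi> x) * ennreal (norm (\<xi> x))) * indicator K x)"
      by (simp only: ac_simps)
    also have "ennreal (g x * \<phi> x) * ennreal (norm (\<xi> x)) = ennreal (g x * (\<phi> x * norm (\<xi> x)))"
      by (simp only: ennreal_mult''[OF norm_ge_zero] mult.assoc[symmetric])
    finally show "(\<integral>\<^sup>+v. ?f x * ?k x v \<partial>lborel) = ?c * (ennreal (g x * (\<phi> x * norm (\<xi> x))) * indicator K x)" .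
  qed
  also have "\<dots> = ?c * gradient_mass K"
    unfolding gradient_mass_def by (rule nn_integral_cmult) measurable
  finally show ?thesis .
qed

locale projection_section_comparison = measure_and_body g p K
  for g :: "real^'n \<Rightarrow> real" and p :: real and K :: "(real^'n) set" +
  fixes L :: "(real^'n) set" and \<epsilon> :: real and M :: "'m::euclidean_space itself"
  assumes dim: "DIM('m) + 1 = CARD('n)" and star_body: "star_body L" and \<epsilon>: "\<epsilon> \<ge> 0"
    and comparison: "\<And>\<theta>. norm \<theta> = 1 \<Longrightarrow> mu_proj g K \<theta> \<le> mu_hyp M g \<theta> (L \<inter> {x. x \<bullet> \<theta> = 0}) + ennreal \<epsilon>"
begin

lemma mu_proj_eq:
  "mu_proj g K \<theta> = ennreal (real CARD('n) / (2 * hom_deg)) * mixed_mu g K (closed_segment (- \<theta>) \<theta>)"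
proof -
  let ?S = "closed_segment (- \<theta>) \<theta>"
  have "(\<integral>\<^sup>+t\<in>{0..1}. mixed_mu g (sdil t K) ?S \<partial>lborel)
      = (\<integral>\<^sup>+t. (ennreal (1 / hom_deg) * mixed_mu g K ?S)
          * (ennreal (hom_deg * t powr (hom_deg - 1)) * indicator {0..1} t) \<partial>lborel)"
  proof (intro nn_integral_cong_AE, use AE_lborel_singleton[of "0::real"] in eventually_elim)
    case (elim t)
    have "ennreal (t powr (hom_deg - 1)) = ennreal (1 / hom_deg) * ennreal (hom_deg * t powr (hom_deg - 1))"
      using hom_deg_gt_1 by (simp flip: ennreal_mult')
    then show ?case using elim by (simp add: indicator_def mixed_mu_sdil mult_ac)
  qed
  also have "\<dots> = ennreal (1 / hom_deg) * mixed_mu g K ?S"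
    using hom_deg_gt_1 by (subst nn_integral_cmult) (simp_all add: nn_integral_deriv_powr)
  finally show ?thesis
    unfolding mu_proj_def using hom_deg_gt_1 by (simp add: mult.assoc[symmetric] flip: ennreal_mult')
qed

definition averaging_constant :: real where
  "averaging_constant = real CARD('n) / 2 * ((hom_deg + 1) / hom_deg)"

lemma mu_proj_lower: "ennreal averaging_constant * directional_mass \<theta> \<le> mu_proj g K \<theta>"
proof -
  have "averaging_constant = real CARD('n) / (2 * hom_deg) * (hom_deg + 1)"
    by (simp add: averaging_constant_def)
  then have "ennreal averaging_constant * directional_mass \<theta>
      = ennreal (real CARD('n) / (2 * hom_deg)) * (ennreal (hom_deg + 1) * directional_mass \<theta>)"
    using hom_deg_gt_1 by (simp only: ennreal_mult' divide_nonneg_nonneg mult.assoc)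
  also have "\<dots> \<le> mu_proj g K \<theta>"
    unfolding mu_proj_eq by (intro mult_left_mono mixed_mu_segment_lower) simp
  finally show ?thesis .
qed

lemma directional_mass_le_Liminf_slab_average:
  assumes "v \<noteq> 0"
  shows "ennreal averaging_constant * (ennreal (1 / (norm v)\<^sup>2) * directional_mass v)
    \<le> Liminf (at_right 0) (\<lambda>h. slab_average (\<lambda>x. ennreal (g x) * indicator (interior L) x) v h
      + ennreal (\<epsilon> / norm v))"
proof -
  define \<theta> where "\<theta> = (1 / norm v) *\<^sub>R v"
  let ?A = "slab_average (\<lambda>x. ennreal (g x) * indicator (interior L) x) v"
  have \<theta>: "norm \<theta> = 1" "v = norm v *\<^sub>R \<theta>" using assms by (simp_all add: \<theta>_def)
  have "directional_mass v = ennreal (norm v) * directional_mass \<theta>"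
    using directional_mass_scaleR[of "norm v" \<theta>] \<theta>(2) assms by simp
  then have "ennreal (1 / (norm v)\<^sup>2) * directional_mass v = ennreal (1 / norm v) * directional_mass \<theta>"
    using assms by (simp add: mult.assoc[symmetric] power2_eq_square flip: ennreal_mult')
  then have "ennreal averaging_constant * (ennreal (1 / (norm v)\<^sup>2) * directional_mass v)
      = ennreal (1 / norm v) * (ennreal averaging_constant * directional_mass \<theta>)"
    by (simp add: mult.left_commute)
  also have "\<dots> \<le> ennreal (1 / norm v) * (mu_hyp M g \<theta> (L \<inter> {x. x \<bullet> \<theta> = 0}) + ennreal \<epsilon>)"
    by (intro mult_left_mono order_trans[OF mu_proj_lower comparison] \<theta>) simp
  also have "\<dots> = ennreal (1 / norm v) * mu_hyp M g \<theta> (L \<inter> {x. x \<bullet> \<theta> = 0}) + ennreal (\<epsilon> / norm v)"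
    using \<epsilon> by (simp add: distrib_left flip: ennreal_mult')
  also have "\<dots> \<le> Liminf (at_right 0) ?A + ennreal (\<epsilon> / norm v)"
    unfolding \<theta>_def
    by (intro add_right_mono mu_hyp_over_norm_le_Liminf_slab_average assms dim g_continuous star_body)
  also have "\<dots> = Liminf (at_right 0) (\<lambda>h. ?A h + ennreal (\<epsilon> / norm v))"
    by (rule Liminf_add_const[symmetric]) (simp_all add: trivial_limit_at_right_real)
  finally show ?thesis .
qed

lemma averaged_comparison:
  assumes "mu g (cball 0 1) > 0"
  shows "ennreal averaging_constant * (ennreal (2 / DIM('m) * unit_ball_vol (DIM('m))) * gradient_mass K)
    \<le> ennreal (unit_ball_vol (DIM('m))) * ennreal (hom_deg / (hom_deg - 1) * mixed_mean L (cball 0 1))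
      + ennreal \<epsilon> * ennreal (CARD('n) / DIM('m) * unit_ball_vol (CARD('n)))"
    (is "_ \<le> ?bound")
proof -
  let ?F = "\<lambda>x. ennreal (g x) * indicator (interior L) x" and ?B = "cball (0::real^'n) 1"
  let ?u = "\<lambda>h v. (slab_average ?F v h + ennreal (\<epsilon> / norm v)) * indicator ?B v"
  have "DIM('m) > 0" by simp
  have bound: "(\<integral>\<^sup>+v. ?u h v \<partial>lborel) \<le> ?bound" if "h > 0" for h
  proof -
    have "(\<integral>\<^sup>+v. ?u h v \<partial>lborel)
        = (\<integral>\<^sup>+v\<in>?B. slab_average ?F v h \<partial>lborel) + ennreal \<epsilon> * (\<integral>\<^sup>+v\<in>?B. ennreal (1 / norm v) \<partial>lborel)"
      using \<epsilon> by (subst nn_integral_cmult[symmetric], simp, subst nn_integral_add[symmetric])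
        (auto intro!: nn_integral_cong simp: distrib_right mult.assoc[symmetric] simp flip: ennreal_mult')
    also have "(\<integral>\<^sup>+v\<in>?B. slab_average ?F v h \<partial>lborel)
        \<le> ennreal (unit_ball_vol (DIM('m))) * (\<integral>\<^sup>+x. ?F x * ennreal (1 / norm x) \<partial>lborel)"
      using dim \<open>h > 0\<close> by (intro nn_integral_unit_ball_slab_average_le) auto
    also have "(\<integral>\<^sup>+x. ?F x * ennreal (1 / norm x) \<partial>lborel)
        \<le> (\<integral>\<^sup>+x\<in>L. ennreal (g x) * ennreal (1 / norm x) \<partial>lborel)"
      using interior_subset[of L] by (intro nn_integral_mono) (auto simp: indicator_def)
    also have "\<dots> \<le> ennreal (hom_deg / (hom_deg - 1) * mixed_mean L (cball 0 1))"
      using star_body assms by (intro nn_integral_over_norm_le) (auto simp: star_body_def)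
    also have "(\<integral>\<^sup>+v\<in>?B. ennreal (1 / norm v) \<partial>lborel)
        = ennreal (CARD('n) / DIM('m) * unit_ball_vol (CARD('n)))"
      using nn_integral_unit_ball_inverse_norm[where 'a="real^'n"] \<open>DIM('m) > 0\<close> by (simp flip: dim)
    finally show ?thesis by (simp add: mult_left_mono add_right_mono)
  qed
  have "ennreal averaging_constant * (ennreal (2 / DIM('m) * unit_ball_vol (DIM('m))) * gradient_mass K)
      = (\<integral>\<^sup>+v\<in>?B. ennreal averaging_constant * (ennreal (1 / (norm v)\<^sup>2) * directional_mass v) \<partial>lborel)"
    using dim
    by (subst nn_integral_unit_ball_directional_mass[symmetric]) (simp_all add: nn_integral_cmult mult.assoc)
  also have "\<dots> \<le> Liminf (at_right 0) (\<lambda>h. \<integral>\<^sup>+v. ?u h v \<partial>lborel)"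
  proof (rule fatou_at_within)
    show "AE v in lborel. ennreal averaging_constant * (ennreal (1 / (norm v)\<^sup>2) * directional_mass v)
          * indicator ?B v
        \<le> Liminf (at_right 0) (\<lambda>h. ?u h v)"
      using AE_lborel_singleton[of "0::real^'n"]
      by eventually_elim (use directional_mass_le_Liminf_slab_average in \<open>auto simp: indicator_def\<close>)
  qed measurable
  also have "\<dots> \<le> Liminf (at_right (0::real)) (\<lambda>_. ?bound)"
    by (rule Liminf_mono, use eventually_at_right_less in eventually_elim) (rule bound)
  also have "\<dots> = ?bound" by (rule Liminf_const) simp
  finally show ?thesis .
qed

theorem mixed_mean_comparison:
  assumes pos: "mu g K > 0"
  shows "mixed_mean K (cball 0 1)
    \<le> (real CARD('n) - 1) / real CARD('n) * (hom_deg / (hom_deg - 1)) * mixed_mean L (cball 0 1)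
      + unit_ball_vol (CARD('n)) / unit_ball_vol (real CARD('n) - 1) * \<epsilon>"
proof -
  have ball: "mu g (cball 0 1) > 0" using mu_pos_imp_ball_pos[OF A_borel A_bounded pos] .
  define m n :: real where "m = DIM('m)" and "n = CARD('n)"
  have nm: "n = m + 1" "m > 0" using dim by (simp_all add: m_def n_def flip: of_nat_Suc)
  define \<omega> where "\<omega> = unit_ball_vol m"
  have \<omega>: "\<omega> > 0" using nm by (simp add: \<omega>_def)
  define X Y where "X = mixed_mean K (cball 0 1)" and "Y = mixed_mean L (cball 0 1)"
  have XY: "X \<ge> 0" "Y \<ge> 0" by (simp_all add: X_def Y_def mixed_mean_def)
  define D where "D = hom_deg"
  have D: "D > 1" using hom_deg_gt_1 by (simp add: D_def)
  have nonneg: "0 \<le> averaging_constant" "0 \<le> 2 / m * \<omega>" "0 \<le> \<omega>"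
      "0 \<le> \<omega> * (D / (D - 1) * Y)" "0 \<le> \<epsilon> * (n / m * unit_ball_vol n)"
    using nm D \<omega> XY \<epsilon> hom_deg_gt_1 by (simp_all add: averaging_constant_def)
  have "ennreal (averaging_constant * (2 / m * \<omega> * (D / (D + 1) * X)))
      = ennreal averaging_constant * (ennreal (2 / m * \<omega>) * ennreal (D / (D + 1) * X))"
    by (simp only: ennreal_mult'[OF nonneg(1)] ennreal_mult'[OF nonneg(2)])
  also have "\<dots> \<le> ennreal averaging_constant * (ennreal (2 / m * \<omega>) * gradient_mass K)"
    unfolding X_def D_def by (intro mult_left_mono gradient_mass_lower ball pos) simp_all
  also have "\<dots> \<le> ennreal \<omega> * ennreal (D / (D - 1) * Y) + ennreal \<epsilon> * ennreal (n / m * unit_ball_vol n)"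
    using averaged_comparison[OF ball] by (simp add: m_def n_def \<omega>_def Y_def D_def)
  also have "\<dots> = ennreal (\<omega> * (D / (D - 1) * Y) + \<epsilon> * (n / m * unit_ball_vol n))"
    by (simp only: ennreal_plus[OF nonneg(4,5)] ennreal_mult'[OF nonneg(3)] ennreal_mult'[OF \<epsilon>])
  finally have "averaging_constant * (2 / m * \<omega> * (D / (D + 1) * X))
      \<le> \<omega> * (D / (D - 1) * Y) + \<epsilon> * (n / m * unit_ball_vol n)"
    using nonneg by (subst (asm) ennreal_le_iff) auto
  also have "averaging_constant * (2 / m * \<omega> * (D / (D + 1) * X)) = n * \<omega> / m * X"
    using D by (simp add: averaging_constant_def D_def[symmetric] n_def[symmetric])
  also have "\<omega> * (D / (D - 1) * Y) + \<epsilon> * (n / m * unit_ball_vol n)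
      = n * \<omega> / m * (m / n * (D / (D - 1)) * Y + unit_ball_vol n / \<omega> * \<epsilon>)"
    using nm \<omega> by (simp add: distrib_left)
  finally have "X \<le> m / n * (D / (D - 1)) * Y + unit_ball_vol n / \<omega> * \<epsilon>"
    using nm \<omega> by (subst (asm) mult_le_cancel_left_pos) simp_all
  moreover have "m = real CARD('n) - 1" using nm by (simp add: n_def)
  ultimately show ?thesis by (simp add: X_def Y_def D_def n_def \<omega>_def)
qed

lemma mu_comparison:
  "mu g K powr (1 - 1 / hom_deg)
    \<le> (1 - 1 / real CARD('n)) / (1 - 1 / hom_deg) * mu g L powr (1 - 1 / hom_deg)
      + unit_ball_vol (real CARD('n))
        / (mu g (cball 0 1) powr (1 / hom_deg) * unit_ball_vol (real CARD('n) - 1)) * \<epsilon>"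
proof (cases "mu g K = 0")
  case True
  have "1 - 1 / real CARD('n) \<ge> 0" "1 - 1 / hom_deg \<ge> 0" using hom_deg_gt_1 by simp_all
  with True \<epsilon> show ?thesis by simp
next
  case False
  then have pos: "mu g K > 0" using mu_nonneg[of K] by linarith
  let ?b = "mu g (cball 0 1) powr (1 / hom_deg)"
  have "?b > 0" using mu_pos_imp_ball_pos[OF A_borel A_bounded pos] by simp
  have "hom_deg / (hom_deg - 1) = 1 / (1 - 1 / hom_deg)"
    "1 - 1 / real CARD('n) = (real CARD('n) - 1) / real CARD('n)"
    using hom_deg_gt_1 by (simp_all add: field_simps)
  then have "mu g K powr (1 - 1 / hom_deg) * ?b
      \<le> ((1 - 1 / real CARD('n)) / (1 - 1 / hom_deg) * mu g L powr (1 - 1 / hom_deg)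
        + unit_ball_vol (real CARD('n)) / (?b * unit_ball_vol (real CARD('n) - 1)) * \<epsilon>) * ?b"
    using mixed_mean_comparison[OF pos] \<open>?b > 0\<close> by (simp add: mixed_mean_def distrib_right)
  then show ?thesis using \<open>?b > 0\<close> by (simp only: mult_le_cancel_right_pos)
qed

end

lemma origin_interior_if_symmetric:
  fixes K :: "'a::euclidean_space set"
  assumes "convex K" "interior K \<noteq> {}" "origin_symmetric K"
  shows "0 \<in> interior K"
proof -
  obtain x where x: "x \<in> interior K" using assms by auto
  have "uminus ` K = K" using assms(3) by (force simp: origin_symmetric_def image_iff)
  then have "- x \<in> interior K" using x interior_negations[of K] by (metis image_eqI)
  then have "(1/2) *\<^sub>R x + (1/2) *\<^sub>R (- x) \<in> interior K"
    using x by (intro convexD[OF convex_interior[OF assms(1)]]) auto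
  then show ?thesis by simp
qed

theorem theorem1p4:
  fixes g :: "real^'n \<Rightarrow> real" and p \<epsilon> :: real
    and K L :: "(real^'n) set"
    and M :: "'m::euclidean_space itself"
  assumes n2: "CARD('n) \<ge> 2"
    and dimM: "DIM('m) + 1 = CARD('n)"
    and p: "p > 0"
    and g_cont: "continuous_on UNIV g"
    and g_conc: "p_concave p g"
    and g_hom: "homogeneous (1 / p) g"
    and K: "convex_body K" "origin_symmetric K"
    and L: "star_body L"
    and eps: "\<epsilon> \<ge> 0"
    and hyp: "\<And>\<theta>. norm \<theta> = 1 \<Longrightarrow>
               mu_proj g K \<theta> \<le> mu_hyp M g \<theta> (L \<inter> {x. x \<bullet> \<theta> = 0}) + ennreal \<epsilon>"
  shows "let q = 1 / (real CARD('n) + 1 / p) in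
         mu g K powr (1 - q)
           \<le> ((1 - 1 / real CARD('n)) / (1 - q)) * mu g L powr (1 - q)
             + unit_ball_vol (real CARD('n))
               / (mu g (cball 0 1) powr q * unit_ball_vol (real CARD('n) - 1)) * \<epsilon>"
proof -
  have "convex_body_origin K"
    using K origin_interior_if_symmetric[of K] by (auto simp: convex_body_def convex_body_origin_def)
  moreover have "homogeneous_density g p"
    using p g_cont g_conc g_hom by unfold_locales
  ultimately interpret projection_section_comparison g p K L \<epsilon> M
    using dimM L eps hyp
    by (simp add: projection_section_comparison_def projection_section_comparison_axioms_def
      measure_and_body_def)
  show ?thesis using mu_comparison by (simp add: Let_def hom_deg_def)
qed

end
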